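(* If an orientation preserving homeomorphism $h : \mathbf{R} \to \mathbf{R}$ normalizes $\mathcal{B}_2$ or $\mathcal{P}_2$, then $h$ is $\mathcal{P}_2$-compatible. If an orientation preserving homeomorphism $h : S_1 \to S_1$ normalizes $\mathcal{B}_{2,1}$ or $\mathcal{T}_{2,1}$, then $h$ is $\mathcal{T}_{2,1}$-compatible.
   Context: $S_1=\mathbf{R}/\mathbf{Z}$; linearity, slope, etc. on $S_1$ are understood as on $\mathbf{R}$. $\mathbf{Z}[\frac12]$ is the set of points of $\mathbf{R}$ (or of $S_1$, i.e. its image) of the form $a2^b$, $a,b\in\mathbf{Z}$. A break of $f$ is a point of discontinuity of $f'$; $f$ is piecewise linear (PL) if each point has an open neighborhood on which it is at most the only break. $PL_2(\mathbf{R})$ (resp. $T_{2,1}$) is the group of homeomorphisms $f$ of $\mathbf{R}$ (resp. $S_1$) that are PL and orientation preserving, with all slopes integral powers of $2$, with breaks in a discrete subset of $\mathbf{Z}[\frac12]$, and with $f(\mathbf{Z}[\frac12])\subseteq\mathbf{Z}[\frac12]$. $BPL_2(\mathbf{R})$ is the subgroup of elements of $PL_2(\mathbf{R})$ with bounded support ($\{x:f(x)\ne x\}$ bounded); $BT_{2,1}$ is the subgroup of $T_{2,1}$ generated by those elements that are the identity on some nonempty open interval. For a topological space $X$ and $x,y\in X$, let $\mathcal{G}(X)_{x,y}$ be the set of germs at $x$ of homeomorphisms between open subsets of $X$ taking $x$ to $y$. A groupoid of germs $\mathcal{G}$ on $X$ is a choice of subsets $\mathcal{G}_{x,y}\subseteq\mathcal{G}(X)_{x,y}$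 for all $x,y$ that is closed under (allowable) composition and inversion of germs. A function $f:U\to X$, $U\subseteq X$ open, is $\mathcal{G}$-compatible if for each $x\in U$ the germ of $f$ at $x$ is in $\mathcal{G}_{x,f(x)}$. $F(\mathcal{G})$ is the set of all $\mathcal{G}$-compatible functions. A homeomorphism $h:X\to X$ preserves $\mathcal{G}$ under conjugation if $hfh^{-1}\in F(\mathcal{G})$ for all $f\in F(\mathcal{G})$; $h$ normalizes $\mathcal{G}$ if both $h$ and $h^{-1}$ preserve $\mathcal{G}$ under conjugation. The groupoid of germs generated by a set $\mathcal{F}$ of local homeomorphisms defined on open subsets of $X$ is the set of all finite allowable compositions of germs of elements of $\mathcal{F}$ and their inverses. $\mathcal{B}_2,\mathcal{P}_2$ are the groupoids of germs on $\mathbf{R}$ generated by $BPL_2(\mathbf{R})$, $PL_2(\mathbf{R})$; $\mathcal{B}_{2,1},\mathcal{T}_{2,1}$ are the groupoids of germs on $S_1$ generated by $BT_{2,1}$, $T_{2,1}$. *)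

theory Defs
  imports "HOL-Analysis.Analysis"
begin

section \<open>Germs and groupoids of germs\<close>

text \<open>Partial functions are represented by pairs of an open set \<open>U\<close> and a total function \<open>f\<close>
  whose values outside \<open>U\<close> are irrelevant. The germ of \<open>f\<close> at \<open>x\<close> is the class of all functions
  that agree with \<open>f\<close> on some neighbourhood of \<open>x\<close>.\<close>

definition germ :: "'a::topological_space \<Rightarrow> ('a \<Rightarrow> 'a) \<Rightarrow> ('a \<Rightarrow> 'a) set" where
  "germ x f = {k. \<forall>\<^sub>F z in nhds x. k z = f z}"

definition all_germs :: "'a::topological_space \<Rightarrow> 'a \<Rightarrow> ('a \<Rightarrow> 'a) set set" where
  "all_germs x y = {germ x f | f. f x = y \<and>
     (\<exists>U V g. open U \<and> open V \<and> x \<in> U \<and> homeomorphism U V f g)}"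

text \<open>Composition and inversion of germs are formulated on representatives.\<close>

definition groupoid_of_germs ::
  "('a::topological_space \<Rightarrow> 'a \<Rightarrow> ('a \<Rightarrow> 'a) set set) \<Rightarrow> bool" where
  "groupoid_of_germs G \<longleftrightarrow>
     (\<forall>x y. G x y \<subseteq> all_germs x y) \<and>
     (\<forall>x y z f g. germ x f \<in> G x y \<longrightarrow> germ y g \<in> G y z \<longrightarrow> germ x (g \<circ> f) \<in> G x z) \<and>
     (\<forall>x y f g U V. germ x f \<in> G x y \<longrightarrow> open U \<longrightarrow> open V \<longrightarrow> x \<in> U \<longrightarrow>
        homeomorphism U V f g \<longrightarrow> germ y g \<in> G y x)"

definition local_homeomorphism :: "'a::topological_space set \<Rightarrow> ('a \<Rightarrow> 'a) \<Rightarrow> bool" where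
  "local_homeomorphism U f \<longleftrightarrow> open U \<and>
     (\<forall>x\<in>U. \<exists>V W g. open V \<and> open W \<and> x \<in> V \<and> V \<subseteq> U \<and> homeomorphism V W f g)"

inductive generated_germ ::
  "('a::topological_space set \<times> ('a \<Rightarrow> 'a)) set \<Rightarrow> 'a \<Rightarrow> 'a \<Rightarrow> ('a \<Rightarrow> 'a) set \<Rightarrow> bool"
  for \<F> where
    generator: "\<lbrakk>(U, f) \<in> \<F>; x \<in> U\<rbrakk> \<Longrightarrow> generated_germ \<F> x (f x) (germ x f)"
  | inverse_generator:
      "\<lbrakk>(U, f) \<in> \<F>; open V; open W; x \<in> V; V \<subseteq> U; homeomorphism V W f g\<rbrakk>
       \<Longrightarrow> generated_germ \<F> (f x) x (germ (f x) g)"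
  | composition:
      "\<lbrakk>generated_germ \<F> x y (germ x f); generated_germ \<F> y z (germ y g)\<rbrakk>
       \<Longrightarrow> generated_germ \<F> x z (germ x (g \<circ> f))"

definition generated_groupoid ::
  "('a::topological_space set \<times> ('a \<Rightarrow> 'a)) set \<Rightarrow> 'a \<Rightarrow> 'a \<Rightarrow> ('a \<Rightarrow> 'a) set set" where
  "generated_groupoid \<F> x y = {\<gamma>. generated_germ \<F> x y \<gamma>}"

definition compatible_functions ::
  "('a::topological_space \<Rightarrow> 'a \<Rightarrow> ('a \<Rightarrow> 'a) set set) \<Rightarrow> ('a set \<times> ('a \<Rightarrow> 'a)) set" where
  "compatible_functions G = {(U, f). open U \<and> (\<forall>x\<in>U. germ x f \<in> G x (f x))}"

definition compatible ::
  "('a::topological_space \<Rightarrow> 'a \<Rightarrow> ('a \<Rightarrow> 'a) set set) \<Rightarrow> ('a \<Rightarrow> 'a) \<Rightarrow> bool" where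
  "compatible G h \<longleftrightarrow> (UNIV, h) \<in> compatible_functions G"

text \<open>If \<open>f\<close> has domain \<open>U\<close>, then the conjugate of \<open>f\<close> by \<open>h\<close> has domain \<open>h ` U\<close>.\<close>

definition preserves ::
  "('a::topological_space \<Rightarrow> 'a \<Rightarrow> ('a \<Rightarrow> 'a) set set) \<Rightarrow> ('a \<Rightarrow> 'a) \<Rightarrow> bool" where
  "preserves G h \<longleftrightarrow>
     (\<forall>(U, f) \<in> compatible_functions G. (h ` U, h \<circ> f \<circ> inv h) \<in> compatible_functions G)"

definition normalizes ::
  "('a::topological_space \<Rightarrow> 'a) \<Rightarrow> ('a \<Rightarrow> 'a \<Rightarrow> ('a \<Rightarrow> 'a) set set) \<Rightarrow> bool" where
  "normalizes h G \<longleftrightarrow> preserves G h \<and> preserves G (inv h)"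

lemma germ_eq_iff: "germ x f = germ x g \<longleftrightarrow> (\<forall>\<^sub>F z in nhds x. f z = g z)"
proof
  assume "germ x f = germ x g"
  moreover have "f \<in> germ x f" by (simp add: germ_def)
  ultimately show "\<forall>\<^sub>F z in nhds x. f z = g z" by (simp add: germ_def)
next
  assume fg: "\<forall>\<^sub>F z in nhds x. f z = g z"
  show "germ x f = germ x g"
    unfolding germ_def using fg by (auto elim: eventually_elim2)
qed

lemma generated_germ_representative:
  assumes "generated_germ \<F> x y \<gamma>" and "\<forall>(U, f)\<in>\<F>. local_homeomorphism U f"
  shows "\<exists>f g U V. \<gamma> = germ x f \<and> f x = y \<and> open U \<and> open V \<and> x \<in> U \<and> homeomorphism U V f g \<and>
           generated_germ \<F> y x (germ y g)"
  using assms(1)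
proof induction
  case (generator U f x)
  then obtain V W g where *: "open V" "open W" "x \<in> V" "V \<subseteq> U" "homeomorphism V W f g"
    using assms(2) generator(1) unfolding local_homeomorphism_def by fast
  have "generated_germ \<F> (f x) x (germ (f x) g)"
    by (rule generated_germ.inverse_generator[OF generator(1) *])
  then show ?case using * by blast
next
  case (inverse_generator U f V W x g)
  have "homeomorphism W V g f"
    using inverse_generator(6) by (rule homeomorphism_symD)
  moreover have "g (f x) = x" "f x \<in> W"
    using inverse_generator(4,6) unfolding homeomorphism_def by blast+
  moreover have "generated_germ \<F> x (f x) (germ x f)"
    using generated_germ.generator[OF inverse_generator(1)] inverse_generator(4,5) by blast
  ultimately show ?case using inverse_generator(2,3) by blast
next
  case (composition x y f z g)
  obtain f1 f2 U V where 1: "germ x f = germ x f1" "f1 x = y" "open U" "open V" "x \<in> U"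
      "homeomorphism U V f1 f2" "generated_germ \<F> y x (germ y f2)"
    using composition.IH(1) by (elim exE conjE) (rule that)
  obtain g1 g2 U' V' where 2: "germ y g = germ y g1" "g1 y = z" "open U'" "open V'" "y \<in> U'"
      "homeomorphism U' V' g1 g2" "generated_germ \<F> z y (germ z g2)"
    using composition.IH(2) by (elim exE conjE) (rule that)
  have f1: "f1 x = y" "y \<in> V" "f2 y = x" and cont: "continuous_on U f1" "continuous_on V f2"
    using 1(2,5,6) unfolding homeomorphism_def by blast+
  define A where "A = U \<inter> f1 -` (V \<inter> U')"
  have A: "open A" "x \<in> A" "A \<subseteq> U"
    using 1(3-5) 2(3,5) f1 continuous_open_preimage[OF cont(1) 1(3) open_Int[OF 1(4) 2(3)]]
    unfolding A_def by blast+
  have img1: "f1 ` A = V \<inter> U'"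
    using 1(6) unfolding homeomorphism_def A_def by blast
  have h1: "homeomorphism A (V \<inter> U') f1 f2"
    by (rule homeomorphism_of_subsets[OF 1(6) A(3) _ img1, of V]) simp
  define B where "B = g1 ` (V \<inter> U')"
  have h2: "homeomorphism (V \<inter> U') B g1 g2"
  proof (rule homeomorphism_of_subsets[OF 2(6)])
    show "B \<subseteq> V'" using 2(6) unfolding homeomorphism_def B_def by blast
  qed (auto simp: B_def)
  have g1g2: "\<And>w. w \<in> U' \<Longrightarrow> g2 (g1 w) = w" "\<And>w. w \<in> V' \<Longrightarrow> g1 (g2 w) = w"
      "g1 ` U' = V'" "continuous_on V' g2"
    using 2(6) unfolding homeomorphism_def by auto
  have "B = V' \<inter> g2 -` (V \<inter> U')"
  proof
    show "B \<subseteq> V' \<inter> g2 -` (V \<inter> U')" using g1g2 unfolding B_def by auto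
    show "V' \<inter> g2 -` (V \<inter> U') \<subseteq> B"
    proof
      fix w assume "w \<in> V' \<inter> g2 -` (V \<inter> U')"
      then show "w \<in> B" using g1g2(2)[of w] unfolding B_def by (metis IntE imageI vimageE)
    qed
  qed
  then have B: "open B"
    using continuous_open_preimage[OF g1g2(4) 2(4) open_Int[OF 1(4) 2(3)]] by simp
  have h: "homeomorphism A B (g1 \<circ> f1) (f2 \<circ> g2)"
    using homeomorphism_compose[OF h1 h2] .
  have ev_g: "\<forall>\<^sub>F w in nhds (f1 x). g w = g1 w"
    using 2(1) unfolding f1(1) germ_eq_iff .
  have "filterlim f1 (nhds (f1 x)) (nhds x)"
    using cont(1) 1(5) unfolding continuous_on_def
    by (simp add: at_within_open[OF _ 1(3)] tendsto_at_iff_tendsto_nhds)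
  then have "\<forall>\<^sub>F w in nhds x. g (f1 w) = g1 (f1 w)"
    using ev_g unfolding filterlim_iff by blast
  moreover have "\<forall>\<^sub>F w in nhds x. f w = f1 w"
    using 1(1) unfolding germ_eq_iff .
  ultimately have "\<forall>\<^sub>F w in nhds x. (g \<circ> f) w = (g1 \<circ> f1) w"
    by eventually_elim simp
  then have "germ x (g \<circ> f) = germ x (g1 \<circ> f1)"
    by (simp only: germ_eq_iff)
  moreover have "generated_germ \<F> z x (germ z (f2 \<circ> g2))"
    by (rule generated_germ.composition[OF 2(7) 1(7)])
  moreover have "(g1 \<circ> f1) x = z" using f1(1) 2(2) by simp
  ultimately show ?case using h A(1,2) B by blast
qed

lemma germ_inverse_unique:
  assumes "germ x f = germ x f'" "open U" "open V" "x \<in> U" "homeomorphism U V f g"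
    and "open U'" "open V'" "x \<in> U'" "homeomorphism U' V' f' g'"
  shows "germ (f x) g = germ (f x) g'"
proof -
  obtain S where S: "open S" "x \<in> S" "\<And>z. z \<in> S \<Longrightarrow> f z = f' z"
    using assms(1) unfolding germ_eq_iff eventually_nhds by auto
  have "continuous_on V g" using assms(5) homeomorphism_def by metis
  then have "open (V \<inter> g -` (S \<inter> U'))"
    using continuous_open_preimage assms S by blast
  moreover have "f x \<in> V" "g (f x) = x"
    using assms(4,5) unfolding homeomorphism_def by blast+
  then have "f x \<in> V \<inter> g -` (S \<inter> U')"
    using assms(8) S(2) by simp
  moreover have "g z = g' z" if "z \<in> V \<inter> g -` (S \<inter> U')" for z
  proof -
    have z: "z \<in> V" "g z \<in> S" "g z \<in> U'" using that by auto
    have "f (g z) = z" "g' (f' (g z)) = g z"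
      using z assms(5,9) unfolding homeomorphism_def by blast+
    then show ?thesis using S(3)[OF z(2)] by simp
  qed
  ultimately show ?thesis unfolding germ_eq_iff eventually_nhds by meson
qed

lemma groupoid_of_germs_generated_groupoid:
  assumes "\<forall>(U, f)\<in>\<F>. local_homeomorphism U f"
  shows "groupoid_of_germs (generated_groupoid \<F>)"
  unfolding groupoid_of_germs_def
proof (intro conjI allI impI)
  fix x y
  show "generated_groupoid \<F> x y \<subseteq> all_germs x y"
  proof
    fix \<gamma> assume "\<gamma> \<in> generated_groupoid \<F> x y"
    then have "generated_germ \<F> x y \<gamma>" by (simp add: generated_groupoid_def)
    from generated_germ_representative[OF this assms] show "\<gamma> \<in> all_germs x y"
      unfolding all_germs_def by blast
  qed
next
  fix x y z f g
  assume "germ x f \<in> generated_groupoid \<F> x y" "germ y g \<in> generated_groupoid \<F> y z"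
  then show "germ x (g \<circ> f) \<in> generated_groupoid \<F> x z"
    unfolding generated_groupoid_def using generated_germ.composition by blast
next
  fix x y f g U V
  assume *: "germ x f \<in> generated_groupoid \<F> x y" "open U" "open V" "x \<in> U" "homeomorphism U V f g"
  then have "generated_germ \<F> x y (germ x f)" by (simp add: generated_groupoid_def)
  from generated_germ_representative[OF this assms]
  obtain f' g' U' V' where 1: "germ x f = germ x f'" "f' x = y" "open U'" "open V'" "x \<in> U'"
      "homeomorphism U' V' f' g'" "generated_germ \<F> y x (germ y g')"
    by (elim exE conjE) (rule that)
  have "f x = f' x"
    using 1(1) unfolding germ_eq_iff by (rule eventually_nhds_x_imp_x)
  then have "germ y g = germ y g'"
    using germ_inverse_unique[OF 1(1) *(2-5) 1(3-6)] 1(2) by simp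
  then show "germ y g \<in> generated_groupoid \<F> y x"
    using 1(7) unfolding generated_groupoid_def by simp
qed

definition homeo :: "('a::topological_space \<Rightarrow> 'a) \<Rightarrow> bool" where
  "homeo f \<longleftrightarrow> (\<exists>g. homeomorphism UNIV UNIV f g)"

inductive_set generated_group :: "('a \<Rightarrow> 'a) set \<Rightarrow> ('a \<Rightarrow> 'a) set"
  for S where
    one: "id \<in> generated_group S"
  | incl: "f \<in> S \<Longrightarrow> f \<in> generated_group S"
  | inverse: "f \<in> generated_group S \<Longrightarrow> inv f \<in> generated_group S"
  | comp: "\<lbrakk>f \<in> generated_group S; g \<in> generated_group S\<rbrakk> \<Longrightarrow> f \<circ> g \<in> generated_group S"


section \<open>Piecewise linear homeomorphisms of the line\<close>

definition dyadics :: "real set" where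
  "dyadics = {of_int a * 2 powi b | a b. True}"

text \<open>Points where the derivative is not defined count as discontinuities of the derivative.\<close>

definition breaks :: "(real \<Rightarrow> real) \<Rightarrow> real set" where
  "breaks f = {x. \<not> ((\<forall>\<^sub>F y in nhds x. f differentiable (at y)) \<and> isCont (deriv f) x)}"

definition piecewise_linear :: "(real \<Rightarrow> real) \<Rightarrow> bool" where
  "piecewise_linear f \<longleftrightarrow>
     (\<forall>x. \<exists>U. open U \<and> x \<in> U \<and> U \<inter> breaks f \<subseteq> {x}) \<and>
     (\<forall>x. x \<notin> breaks f \<longrightarrow> (\<exists>m c. \<forall>\<^sub>F y in nhds x. f y = m * y + c))"

definition power_of_two_slopes :: "(real \<Rightarrow> real) \<Rightarrow> bool" where
  "power_of_two_slopes f \<longleftrightarrow> (\<forall>x. x \<notin> breaks f \<longrightarrow> (\<exists>k::int. deriv f x = 2 powi k))"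

definition PL2 :: "(real \<Rightarrow> real) set" where
  "PL2 = {f. homeo f \<and> strict_mono f \<and> piecewise_linear f \<and> power_of_two_slopes f \<and>
     discrete (breaks f) \<and> breaks f \<subseteq> dyadics \<and> f ` dyadics \<subseteq> dyadics}"

definition BPL2 :: "(real \<Rightarrow> real) set" where
  "BPL2 = {f \<in> PL2. bounded {x. f x \<noteq> x}}"

definition germs_P2 :: "real \<Rightarrow> real \<Rightarrow> (real \<Rightarrow> real) set set" where
  "germs_P2 = generated_groupoid ({UNIV} \<times> PL2)"

definition germs_B2 :: "real \<Rightarrow> real \<Rightarrow> (real \<Rightarrow> real) set set" where
  "germs_B2 = generated_groupoid ({UNIV} \<times> BPL2)"


section \<open>The circle and its piecewise linear homeomorphisms\<close>

text \<open>The circle \<open>\<real>/\<int>\<close> with the quotient topology; \<open>to_circle\<close> is the projection.\<close>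

quotient_type circle = real / "\<lambda>x y. x - y \<in> \<int>"
  morphisms rep_circle to_circle
proof (rule equivpI)
  show "reflp (\<lambda>x y::real. x - y \<in> \<int>)" by (simp add: reflp_def)
  show "symp (\<lambda>x y::real. x - y \<in> \<int>)"
    unfolding symp_def by (metis Ints_minus minus_diff_eq)
  show "transp (\<lambda>x y::real. x - y \<in> \<int>)"
    unfolding transp_def by (metis Ints_add diff_add_cancel add_diff_eq)
qed

instantiation circle :: topological_space
begin

definition open_circle :: "circle set \<Rightarrow> bool" where
  "open_circle U \<longleftrightarrow> open (to_circle -` U)"

instance
  by standard (auto simp: open_circle_def vimage_Union open_Int)

end

definition circle_lift :: "(real \<Rightarrow> real) \<Rightarrow> (circle \<Rightarrow> circle) \<Rightarrow> bool" where
  "circle_lift F f \<longleftrightarrow> continuous_on UNIV F \<and> (\<forall>x. f (to_circle x) = to_circle (F x))"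

definition circle_orientation_preserving :: "(circle \<Rightarrow> circle) \<Rightarrow> bool" where
  "circle_orientation_preserving f \<longleftrightarrow> (\<exists>F. circle_lift F f \<and> strict_mono F)"

definition circle_dyadics :: "circle set" where
  "circle_dyadics = to_circle ` dyadics"

text \<open>Linearity, slopes and breaks of a map of the circle are those of a lift to the line; any two
  lifts differ by an integer constant, so the choice of the lift is irrelevant.\<close>

definition T21 :: "(circle \<Rightarrow> circle) set" where
  "T21 = {f. homeo f \<and>
     (\<exists>F. circle_lift F f \<and> strict_mono F \<and> piecewise_linear F \<and> power_of_two_slopes F \<and>
        discrete (to_circle ` breaks F) \<and> to_circle ` breaks F \<subseteq> circle_dyadics) \<and>
     f ` circle_dyadics \<subseteq> circle_dyadics}"

definition BT21 :: "(circle \<Rightarrow> circle) set" where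
  "BT21 = generated_group {f \<in> T21. \<exists>a b. a < b \<and> (\<forall>p \<in> to_circle ` {a<..<b}. f p = p)}"

definition germs_T21 :: "circle \<Rightarrow> circle \<Rightarrow> (circle \<Rightarrow> circle) set set" where
  "germs_T21 = generated_groupoid ({UNIV} \<times> T21)"

definition germs_B21 :: "circle \<Rightarrow> circle \<Rightarrow> (circle \<Rightarrow> circle) set set" where
  "germs_B21 = generated_groupoid ({UNIV} \<times> BT21)"

end

theory Submission
  imports Defs
begin

text \<open>A germ belongs to any of the four groupoids iff it is dyadic piecewise linear, because such germs
  are compositions of germs of small bumps. Hence \<open>h\<close> (on the circle, a lift of it) and its inverse
  conjugate dyadic piecewise linear germs to such germs, and this property of a homeomorphism \<open>\<kappa>\<close>
  of the line forces \<open>\<kappa>\<close> to be piecewise linear.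

  Call two standard dyadic intervals \<open>[i / 2 ^ n, (i + 1) / 2 ^ n]\<close> in the unit interval equivalent if the
  restrictions of \<open>\<kappa>\<close> to them, both read on \<open>[0, 1]\<close>, differ by an affine map with slope a power of 2.
  Conjugating \<open>y / 2\<close> and \<open>(y + 1) / 2\<close> shows that, in the binary address of a sufficiently short interval,
  the leading digit can be dropped without leaving the class, so the class depends only on the last
  \<open>n\<^sub>0\<close> digits. Pulling back a small dyadic translation by \<open>\<kappa>\<close> gives a piecewise linear map that moves
  \<open>1/2\<close>; it cannot respect the last digit of all intervals, so two short intervals with different last
  digits are equivalent. By downward induction on the number of relevant digits, all short
  intervals are equivalent. In particular an interval is equivalent to both of its halves; the two
  slopes are powers of 2 with sum 1, hence both are \<open>1/2\<close>, and \<open>\<kappa>\<close> is affine on the interval.\<close>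

section \<open>Dyadic rationals\<close>

text \<open>Powers of 2 are essential in the comparison of intervals: the distribution function of a
  Bernoulli measure with weights \<open>p\<close> and \<open>1 - p\<close> also makes every dyadic
  interval similar to its two halves, yet it is singular unless \<open>p = 1/2\<close>. What
  excludes it is that two powers of 2 with sum 1 must be equal. Hence the aim of having a single
  class, in which an interval can be compared with both of its halves. Dropping leading digits
  leaves one class for each ending of \<open>n\<^sub>0\<close> digits. To merge them, append the
  same \<open>p\<close> digits \<open>r\<close> to two equivalent intervals whose last digits are 0
  and 1: the endings \<open>0r\<close> and \<open>1r\<close> become equivalent, so the first of
  \<open>p + 1\<close> relevant digits stops to matter. The pair must lie at levels where dropping
  is valid, on both sides; therefore the translation is chosen after that level, and so small that
  all intervals involved are short enough. A break inside an interval would spoil its comparison.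
  Since \<open>\<kappa>\<close> and its inverse preserve the dyadics, breaks become endpoints of all
  intervals of high level.\<close>

lemma dyadics_iff: "x \<in> dyadics \<longleftrightarrow> (\<exists>n::nat. x * 2 ^ n \<in> \<int>)"
proof
  assume "x \<in> dyadics"
  then obtain a b :: int where x: "x = of_int a * 2 powi b" by (auto simp: dyadics_def)
  have "x * 2 ^ nat (- b) = of_int (a * 2 ^ nat b)"
  proof (cases "b \<ge> 0")
    case True
    then show ?thesis by (simp add: x power_int_def)
  next
    case False
    then show ?thesis by (simp add: x power_int_def field_simps)
  qed
  then show "\<exists>n::nat. x * 2 ^ n \<in> \<int>" by (metis Ints_of_int)
next
  assume "\<exists>n::nat. x * 2 ^ n \<in> \<int>"
  then obtain n :: nat and a :: int where "x * 2 ^ n = of_int a" by (auto elim: Ints_cases)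
  then have "x = of_int a * 2 powi (- int n)"
    by (simp add: power_int_minus field_simps)
  then show "x \<in> dyadics" unfolding dyadics_def by blast
qed

lemma dyadics_scale: "x * 2 ^ m \<in> \<int> \<Longrightarrow> m \<le> n \<Longrightarrow> x * 2 ^ n \<in> (\<int>::real set)"
proof -
  assume a: "x * 2 ^ m \<in> \<int>" and "m \<le> n"
  then obtain p where "n = m + p" using le_Suc_ex by blast
  then have "x * 2 ^ n = (x * 2 ^ m) * of_int (2 ^ p)" by (simp add: power_add)
  then show ?thesis using a by (metis Ints_mult Ints_of_int)
qed

lemma dyadics_of_int [simp]: "of_int a \<in> dyadics"
  unfolding dyadics_iff by (rule exI[of _ 0]) simp

lemma dyadics_0 [simp]: "0 \<in> dyadics" and dyadics_1 [simp]: "1 \<in> dyadics"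
  using dyadics_of_int[of 0] dyadics_of_int[of 1] by simp_all

lemma dyadics_numeral [simp]: "numeral w \<in> dyadics"
  using dyadics_of_int[of "numeral w"] by simp

lemma dyadics_Ints: "x \<in> \<int> \<Longrightarrow> x \<in> dyadics"
  by (auto elim: Ints_cases)

lemma dyadics_add [simp]: assumes "x \<in> dyadics" "y \<in> dyadics" shows "x + y \<in> dyadics"
proof -
  obtain m n where "x * 2 ^ m \<in> \<int>" "y * 2 ^ n \<in> \<int>" using assms by (auto simp: dyadics_iff)
  then have "x * 2 ^ max m n \<in> \<int>" "y * 2 ^ max m n \<in> \<int>"
    using dyadics_scale max.cobounded1 max.cobounded2 by blast+
  then have "(x + y) * 2 ^ max m n \<in> \<int>" by (simp add: distrib_right)
  then show ?thesis unfolding dyadics_iff by blast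
qed

lemma dyadics_minus [simp]: "x \<in> dyadics \<Longrightarrow> - x \<in> dyadics"
  unfolding dyadics_iff by simp

lemma dyadics_diff [simp]: "x \<in> dyadics \<Longrightarrow> y \<in> dyadics \<Longrightarrow> x - y \<in> dyadics"
  using dyadics_add[of x "- y"] by simp

lemma dyadics_mult [simp]: assumes "x \<in> dyadics" "y \<in> dyadics" shows "x * y \<in> dyadics"
proof -
  obtain m n where "x * 2 ^ m \<in> \<int>" "y * 2 ^ n \<in> \<int>" using assms by (auto simp: dyadics_iff)
  then have "(x * 2 ^ m) * (y * 2 ^ n) \<in> \<int>" by (rule Ints_mult)
  then have "(x * y) * 2 ^ (m + n) \<in> \<int>" by (simp add: power_add mult_ac)
  then show ?thesis unfolding dyadics_iff by blast
qed

lemma dyadics_powi [simp]: "2 powi k \<in> dyadics"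
proof -
  have "(2::real) powi k = of_int 1 * 2 powi k" by simp
  then show ?thesis unfolding dyadics_def by blast
qed

lemma dyadics_power [simp]: "2 ^ n \<in> dyadics"
  using dyadics_powi[of "int n"] by simp

lemma dyadics_inverse_power [simp]: "1 / 2 ^ n \<in> dyadics"
  using dyadics_powi[of "- int n"] by (simp add: power_int_minus field_simps)

lemma dyadics_divide_power [simp]: "x \<in> dyadics \<Longrightarrow> x / 2 ^ n \<in> dyadics"
  using dyadics_mult[OF _ dyadics_inverse_power, of x n] by simp

lemma dyadics_half [simp]: "x \<in> dyadics \<Longrightarrow> x / 2 \<in> dyadics"
  using dyadics_divide_power[of x 1] by simp

lemma dyadics_affine_iff: "c \<in> dyadics \<Longrightarrow> 2 powi k * x + c \<in> dyadics \<longleftrightarrow> x \<in> dyadics"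
proof
  assume c: "c \<in> dyadics" and a: "2 powi k * x + c \<in> dyadics"
  have "x = 2 powi (- k) * ((2 powi k * x + c) - c)"
    by (simp add: power_int_minus)
  also have "\<dots> \<in> dyadics" using c a by (intro dyadics_mult dyadics_diff) auto
  finally show "x \<in> dyadics" .
qed simp

lemma dyadics_dense: assumes "a < b" shows "\<exists>x\<in>dyadics. a < x \<and> x < (b::real)"
proof -
  obtain n :: nat where n: "1 / (b - a) < 2 ^ n"
    using real_arch_pow[of 2 "1 / (b - a)"] by auto
  then have n': "1 < (b - a) * 2 ^ n" using assms by (simp add: field_simps)
  define i where "i = \<lfloor>a * 2 ^ n\<rfloor> + 1"
  have "a * 2 ^ n < of_int i" "of_int i \<le> a * 2 ^ n + 1"
    unfolding i_def by linarith+
  then have "a * 2 ^ n < of_int i" "of_int i < b * 2 ^ n"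
    using n' by (simp_all add: algebra_simps)
  then have "a < of_int i / 2 ^ n" "of_int i / 2 ^ n < b" by (simp_all add: field_simps)
  then show ?thesis using dyadics_divide_power dyadics_of_int by blast
qed

text \<open>The positive units of the ring of dyadic rationals are the powers of 2: the numerators
  of \<open>\<sigma>\<close> and \<open>1 / \<sigma>\<close> multiply to a power of 2, so each is
  one by unique factorization. This later identifies the slope of \<open>\<kappa>\<close> on an
  interval.\<close>

lemma dyadic_unit:
  assumes "\<sigma> \<in> dyadics" "1 / \<sigma> \<in> dyadics" "\<sigma> > 0"
  shows "\<exists>k::int. \<sigma> = 2 powi k"
proof -
  obtain m n and a b :: int where a: "\<sigma> * 2 ^ m = of_int a" and b: "1 / \<sigma> * 2 ^ n = of_int b"
    using assms(1,2) unfolding dyadics_iff by (metis Ints_cases)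
  have "of_int (a * b) = (\<sigma> * 2 ^ m) * (1 / \<sigma> * 2 ^ n)" by (simp only: a b of_int_mult)
  also have "\<dots> = of_int (2 ^ (m + n))" using assms(3) by (simp add: power_add)
  finally have "a * b = 2 ^ (m + n)" by (simp only: of_int_eq_iff)
  then have "a dvd 2 ^ (m + n)" by (metis dvd_triv_left)
  moreover have "a > 0" using a assms(3) by (metis of_int_0_less_iff zero_less_mult_iff zero_less_numeral zero_less_power)
  ultimately have "nat a dvd 2 ^ (m + n)"
    by (metis nat_dvd_iff nat_numeral nat_power_eq zero_le_numeral abs_of_pos nat_abs_dvd_iff int_dvd_int_iff of_nat_numeral of_nat_power int_nat_eq less_imp_le)
  then obtain r where "nat a = 2 ^ r"
    using divides_primepow_nat[OF two_is_prime_nat, of "nat a" "m + n"] by blast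
  then have "a = 2 ^ r" using \<open>a > 0\<close> by (metis int_nat_eq less_imp_le of_nat_numeral of_nat_power)
  then have "\<sigma> * 2 ^ m = 2 ^ r" using a by simp
  then have "\<sigma> = 2 powi (int r - int m)"
    by (simp add: power_int_diff field_simps)
  then show ?thesis by blast
qed

section \<open>Dyadic piecewise linear germs\<close>

text \<open>Germs at \<open>x\<close> of elements of \<open>PL2\<close>; the one-sided formulas carry their dyadic constant terms, so
  that nothing has to be said separately about the image of the dyadics.\<close>

definition pl2_at :: "(real \<Rightarrow> real) \<Rightarrow> real \<Rightarrow> bool" where
  "pl2_at f x \<longleftrightarrow> (\<exists>(k::int) (l::int). \<exists>c\<in>dyadics. \<exists>d\<in>dyadics.
     f x = 2 powi k * x + c \<and> f x = 2 powi l * x + d \<and>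
     (\<forall>\<^sub>F t in at_left x. f t = 2 powi k * t + c) \<and>
     (\<forall>\<^sub>F t in at_right x. f t = 2 powi l * t + d) \<and>
     (x \<notin> dyadics \<longrightarrow> k = l \<and> c = d))"

lemma pl2_atI:
  fixes k l :: int
  assumes "c \<in> dyadics" "d \<in> dyadics" "f x = 2 powi k * x + c" "f x = 2 powi l * x + d"
    "\<forall>\<^sub>F t in at_left x. f t = 2 powi k * t + c" "\<forall>\<^sub>F t in at_right x. f t = 2 powi l * t + d"
    "x \<notin> dyadics \<Longrightarrow> k = l \<and> c = d"
  shows "pl2_at f x"
  unfolding pl2_at_def using assms by blast

lemma pl2_atE:
  assumes "pl2_at f x"
  obtains k l :: int and c d where "c \<in> dyadics" "d \<in> dyadics"
    "f x = 2 powi k * x + c" "f x = 2 powi l * x + d"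
    "\<forall>\<^sub>F t in at_left x. f t = 2 powi k * t + c" "\<forall>\<^sub>F t in at_right x. f t = 2 powi l * t + d"
    "x \<notin> dyadics \<Longrightarrow> k = l \<and> c = d"
  using assms unfolding pl2_at_def by blast

lemma eventually_nhds_split:
  "(\<forall>\<^sub>F t in nhds (x::real). P t) \<longleftrightarrow> P x \<and> (\<forall>\<^sub>F t in at_left x. P t) \<and> (\<forall>\<^sub>F t in at_right x. P t)"
  by (simp add: eventually_nhds_conv_at eventually_at_split) blast

text \<open>Slopes are positive, so the two sides of a point are never exchanged; this lets
  one-sided formulas be composed and inverted side by side.\<close>

lemma filterlim_affine_at_right:
  "filterlim (\<lambda>t. 2 powi (k::int) * t + c) (at_right (2 powi k * x + c)) (at_right (x::real))"
  unfolding filterlim_at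
proof
  show "\<forall>\<^sub>F t in at_right x. 2 powi k * t + c \<in> {2 powi k * x + c<..} \<and> 2 powi k * t + c \<noteq> 2 powi k * x + c"
    unfolding eventually_at_right_field by (intro exI[of _ "x + 1"]) auto
qed (intro tendsto_intros)

lemma filterlim_affine_at_left:
  "filterlim (\<lambda>t. 2 powi (k::int) * t + c) (at_left (2 powi k * x + c)) (at_left (x::real))"
  unfolding filterlim_at
proof
  show "\<forall>\<^sub>F t in at_left x. 2 powi k * t + c \<in> {..<2 powi k * x + c} \<and> 2 powi k * t + c \<noteq> 2 powi k * x + c"
    unfolding eventually_at_left_field by (intro exI[of _ "x - 1"]) auto
qed (intro tendsto_intros)

lemma pl2_at_filterlim:
  assumes "pl2_at f x"
  shows "filterlim f (at_left (f x)) (at_left x)" "filterlim f (at_right (f x)) (at_right x)"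
    "filterlim f (nhds (f x)) (nhds x)" "isCont f x"
proof -
  obtain k l :: int and c d where f: "f x = 2 powi k * x + c" "f x = 2 powi l * x + d"
    "\<forall>\<^sub>F t in at_left x. f t = 2 powi k * t + c" "\<forall>\<^sub>F t in at_right x. f t = 2 powi l * t + d"
    using assms by (rule pl2_atE)
  have "filterlim (\<lambda>t. 2 powi k * t + c) (at_left (f x)) (at_left x)"
    unfolding f(1) by (rule filterlim_affine_at_left)
  then show 1: "filterlim f (at_left (f x)) (at_left x)"
    by (rule filterlim_cong[OF refl refl f(3), THEN iffD2])
  have "filterlim (\<lambda>t. 2 powi l * t + d) (at_right (f x)) (at_right x)"
    unfolding f(2) by (rule filterlim_affine_at_right)
  then show 2: "filterlim f (at_right (f x)) (at_right x)"
    by (rule filterlim_cong[OF refl refl f(4), THEN iffD2])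
  have "(f \<longlongrightarrow> f x) (at_left x)" "(f \<longlongrightarrow> f x) (at_right x)"
    using 1 2 unfolding filterlim_at by auto
  then show "isCont f x"
    unfolding isCont_def by (simp add: filterlim_split_at)
  then show "filterlim f (nhds (f x)) (nhds x)"
    by (simp add: isCont_def tendsto_at_iff_tendsto_nhds)
qed

lemma pl2_at_cong:
  assumes "pl2_at f x" "\<forall>\<^sub>F t in nhds x. g t = f t"
  shows "pl2_at g x"
proof -
  have g: "g x = f x" "\<forall>\<^sub>F t in at_left x. g t = f t" "\<forall>\<^sub>F t in at_right x. g t = f t"
    using assms(2) by (simp_all add: eventually_nhds_split)
  obtain k l :: int and c d where f: "c \<in> dyadics" "d \<in> dyadics"
    "f x = 2 powi k * x + c" "f x = 2 powi l * x + d"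
    "\<forall>\<^sub>F t in at_left x. f t = 2 powi k * t + c" "\<forall>\<^sub>F t in at_right x. f t = 2 powi l * t + d"
    "x \<notin> dyadics \<Longrightarrow> k = l \<and> c = d"
    using assms(1) by (rule pl2_atE) blast
  show ?thesis
  proof (rule pl2_atI[OF f(1,2)])
    show "\<forall>\<^sub>F t in at_left x. g t = 2 powi k * t + c" using g(2) f(5) by eventually_elim simp
    show "\<forall>\<^sub>F t in at_right x. g t = 2 powi l * t + d" using g(3) f(6) by eventually_elim simp
  qed (use f g in auto)
qed

text \<open>If \<open>x\<close> is not dyadic, neither is \<open>f x\<close>, because affine maps
  with slope a power of 2 and dyadic constant term preserve and reflect the dyadics. So
  \<open>g\<close> contributes no break at such a point.\<close>

lemma pl2_at_compose:
  assumes "pl2_at f x" "pl2_at g (f x)"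
  shows "pl2_at (g \<circ> f) x"
proof -
  obtain k l :: int and c d where f: "c \<in> dyadics" "d \<in> dyadics"
    "f x = 2 powi k * x + c" "f x = 2 powi l * x + d"
    "\<forall>\<^sub>F t in at_left x. f t = 2 powi k * t + c" "\<forall>\<^sub>F t in at_right x. f t = 2 powi l * t + d"
    "x \<notin> dyadics \<Longrightarrow> k = l \<and> c = d"
    using assms(1) by (rule pl2_atE) blast
  obtain k' l' :: int and c' d' where g: "c' \<in> dyadics" "d' \<in> dyadics"
    "g (f x) = 2 powi k' * f x + c'" "g (f x) = 2 powi l' * f x + d'"
    "\<forall>\<^sub>F t in at_left (f x). g t = 2 powi k' * t + c'"
    "\<forall>\<^sub>F t in at_right (f x). g t = 2 powi l' * t + d'"
    "f x \<notin> dyadics \<Longrightarrow> k' = l' \<and> c' = d'"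
    using assms(2) by (rule pl2_atE) blast
  have ev: "\<forall>\<^sub>F t in at_left x. g (f t) = 2 powi k' * f t + c'"
    "\<forall>\<^sub>F t in at_right x. g (f t) = 2 powi l' * f t + d'"
    using filterlim_iff[THEN iffD1, OF pl2_at_filterlim(1)[OF assms(1)]] g(5)
      filterlim_iff[THEN iffD1, OF pl2_at_filterlim(2)[OF assms(1)]] g(6) by blast+
  show ?thesis
  proof (rule pl2_atI[where k = "k' + k" and l = "l' + l" and c = "2 powi k' * c + c'" and d = "2 powi l' * d + d'"])
    show "\<forall>\<^sub>F t in at_left x. (g \<circ> f) t = 2 powi (k' + k) * t + (2 powi k' * c + c')"
      using ev(1) f(5) by eventually_elim (simp add: power_int_add algebra_simps)
    show "\<forall>\<^sub>F t in at_right x. (g \<circ> f) t = 2 powi (l' + l) * t + (2 powi l' * d + d')"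
      using ev(2) f(6) by eventually_elim (simp add: power_int_add algebra_simps)
    show "(g \<circ> f) x = 2 powi (k' + k) * x + (2 powi k' * c + c')"
      using g(3) f(3) by (simp add: power_int_add algebra_simps)
    show "(g \<circ> f) x = 2 powi (l' + l) * x + (2 powi l' * d + d')"
      using g(4) f(4) by (simp add: power_int_add algebra_simps)
    show "k' + k = l' + l \<and> 2 powi k' * c + c' = 2 powi l' * d + d'" if "x \<notin> dyadics"
      using that f g(7) dyadics_affine_iff[OF f(1), of k x] by auto
  qed (use f g in auto)
qed

lemma pl2_at_affine: "c \<in> dyadics \<Longrightarrow> pl2_at (\<lambda>t. 2 powi k * t + c) x"
  by (rule pl2_atI[where k = k and l = k and c = c and d = c]) auto

text \<open>Provides germs with a prescribed break at a dyadic point, the probes for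
  \<open>conjugation_dyadics\<close>.\<close>

lemma pl2_at_two_sided:
  assumes "x \<in> dyadics" "y \<in> dyadics"
  shows "pl2_at (\<lambda>t. if t \<le> x then y + 2 powi k * (t - x) else y + 2 powi l * (t - x)) x"
  by (rule pl2_atI[where k = k and l = l and c = "y - 2 powi k * x" and d = "y - 2 powi l * x"])
    (use assms in \<open>auto simp: algebra_simps eventually_at_right_field eventually_at_left_field
      intro: exI[of _ "x + 1"] exI[of _ "x - 1"]\<close>)

lemma pl2_at_dyadics: "pl2_at f x \<Longrightarrow> f x \<in> dyadics \<longleftrightarrow> x \<in> dyadics"
  by (elim pl2_atE) (metis dyadics_affine_iff)

text \<open>The substitution is the inverse affine map, again increasing with slope a power of 2, so
  it takes left neighbourhoods of \<open>y\<close> to left neighbourhoods of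
  \<open>x\<close>.\<close>

lemma eventually_at_left_affine:
  assumes "\<forall>\<^sub>F t in at_left (x::real). P t" "y = 2 powi (k::int) * x + c"
  shows "\<forall>\<^sub>F s in at_left y. P ((s - c) / 2 powi k)"
proof -
  have x: "x = 2 powi (- k) * y + - (c / 2 powi k)"
    using assms(2) by (simp add: power_int_minus field_simps)
  have "\<forall>\<^sub>F s in at_left y. P (2 powi (- k) * s + - (c / 2 powi k))"
    using filterlim_iff[THEN iffD1, OF filterlim_affine_at_left[of "- k" "- (c / 2 powi k)" y]] assms(1)
    unfolding x[symmetric] by blast
  then show ?thesis by (simp add: power_int_minus field_simps)
qed

lemma eventually_at_right_affine:
  assumes "\<forall>\<^sub>F t in at_right (x::real). P t" "y = 2 powi (k::int) * x + c"
  shows "\<forall>\<^sub>F s in at_right y. P ((s - c) / 2 powi k)"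
proof -
  have x: "x = 2 powi (- k) * y + - (c / 2 powi k)"
    using assms(2) by (simp add: power_int_minus field_simps)
  have "\<forall>\<^sub>F s in at_right y. P (2 powi (- k) * s + - (c / 2 powi k))"
    using filterlim_iff[THEN iffD1, OF filterlim_affine_at_right[of "- k" "- (c / 2 powi k)" y]] assms(1)
    unfolding x[symmetric] by blast
  then show ?thesis by (simp add: power_int_minus field_simps)
qed

text \<open>Only a left inverse near \<open>x\<close> is given. The one-sided formulas of
  \<open>f\<close> cover both sides of \<open>f x\<close>, so on each side \<open>g\<close> is
  forced to be the inverse affine map and is then a right inverse too.\<close>

lemma pl2_at_local_inverse:
  assumes "pl2_at f x" "\<forall>\<^sub>F t in nhds x. g (f t) = t"
  shows "pl2_at g (f x)" "\<forall>\<^sub>F s in nhds (f x). f (g s) = s"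
proof -
  obtain k l :: int and c d where f: "c \<in> dyadics" "d \<in> dyadics"
    "f x = 2 powi k * x + c" "f x = 2 powi l * x + d"
    "\<forall>\<^sub>F t in at_left x. f t = 2 powi k * t + c" "\<forall>\<^sub>F t in at_right x. f t = 2 powi l * t + d"
    "x \<notin> dyadics \<Longrightarrow> k = l \<and> c = d"
    using assms(1) by (rule pl2_atE) blast
  have g: "g (f x) = x" "\<forall>\<^sub>F t in at_left x. g (f t) = t" "\<forall>\<^sub>F t in at_right x. g (f t) = t"
    using assms(2) by (simp_all add: eventually_nhds_split)
  have "\<forall>\<^sub>F t in at_left x. g (2 powi k * t + c) = t \<and> f t = 2 powi k * t + c"
    using f(5) g(2) by eventually_elim simp
  from eventually_at_left_affine[OF this f(3)]
  have L: "\<forall>\<^sub>F s in at_left (f x). g s = (s - c) / 2 powi k \<and> f (g s) = s"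
    by eventually_elim simp
  have "\<forall>\<^sub>F t in at_right x. g (2 powi l * t + d) = t \<and> f t = 2 powi l * t + d"
    using f(6) g(3) by eventually_elim simp
  from eventually_at_right_affine[OF this f(4)]
  have R: "\<forall>\<^sub>F s in at_right (f x). g s = (s - d) / 2 powi l \<and> f (g s) = s"
    by eventually_elim simp
  show "\<forall>\<^sub>F s in nhds (f x). f (g s) = s"
    unfolding eventually_nhds_split using g(1) L R by (auto elim: eventually_mono)
  show "pl2_at g (f x)"
  proof (rule pl2_atI[where k = "- k" and l = "- l" and c = "2 powi (- k) * - c" and d = "2 powi (- l) * - d"])
    show "\<forall>\<^sub>F s in at_left (f x). g s = 2 powi - k * s + 2 powi - k * - c"
      using L by eventually_elim (simp add: power_int_minus field_simps)
    show "\<forall>\<^sub>F s in at_right (f x). g s = 2 powi - l * s + 2 powi - l * - d"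
      using R by eventually_elim (simp add: power_int_minus field_simps)
    show "g (f x) = 2 powi - k * f x + 2 powi - k * - c"
      unfolding g(1) by (simp add: f(3) power_int_minus field_simps)
    show "g (f x) = 2 powi - l * f x + 2 powi - l * - d"
      unfolding g(1) by (simp add: f(4) power_int_minus field_simps)
    show "- k = - l \<and> 2 powi - k * - c = 2 powi - l * - d" if "f x \<notin> dyadics"
      using that f(7) pl2_at_dyadics[OF assms(1)] by simp
  qed (use f in \<open>auto simp del: mult_minus_right\<close>)
qed

lemma pl2_at_local_inverse_exists:
  assumes "pl2_at f x"
  shows "\<exists>g. g (f x) = x \<and> (\<forall>\<^sub>F t in nhds x. g (f t) = t)"
proof -
  obtain k l :: int and c d where f: "f x = 2 powi k * x + c" "f x = 2 powi l * x + d"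
    "\<forall>\<^sub>F t in at_left x. f t = 2 powi k * t + c" "\<forall>\<^sub>F t in at_right x. f t = 2 powi l * t + d"
    using assms by (rule pl2_atE) blast
  define g where "g s = (if s \<le> f x then (s - c) / 2 powi k else (s - d) / 2 powi l)" for s
  have gx: "g (f x) = x" by (simp add: g_def f(1))
  have lt: "\<forall>\<^sub>F t in at_left x. t < x" "\<forall>\<^sub>F t in at_right x. x < t"
    by (simp_all add: eventually_at_filter)
  have "\<forall>\<^sub>F t in at_left x. g (f t) = t"
    using f(3) lt(1)
  proof eventually_elim
    case (elim t)
    then have "f t \<le> f x" using f(1) by simp
    then show ?case using elim by (simp add: g_def)
  qed
  moreover have "\<forall>\<^sub>F t in at_right x. g (f t) = t"
    using f(4) lt(2)
  proof eventually_elim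
    case (elim t)
    then have "f t > f x" using f(2) by simp
    then show ?case using elim by (simp add: g_def)
  qed
  ultimately have "\<forall>\<^sub>F t in nhds x. g (f t) = t"
    using gx by (simp add: eventually_nhds_split)
  then show ?thesis using gx by blast
qed

lemma pl2_at_affine_near:
  assumes "c \<in> dyadics" "\<forall>\<^sub>F t in nhds x. f t = 2 powi k * t + c"
  shows "pl2_at f x"
  using pl2_at_cong[OF pl2_at_affine[OF assms(1), of k x]] assms(2) by simp

text \<open>A one-sided formula holds on a whole open interval ending at \<open>x\<close>, so the
  points near \<open>x\<close> other than \<open>x\<close> carry plain affine germs. Isolation of
  breaks rests on this.\<close>

lemma pl2_at_near:
  assumes "pl2_at f x"
  shows "\<forall>\<^sub>F y in at x. \<exists>k::int. \<exists>c\<in>dyadics. \<forall>\<^sub>F t in nhds y. f t = 2 powi k * t + c"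
proof -
  obtain k l :: int and c d where f: "c \<in> dyadics" "d \<in> dyadics"
    "\<forall>\<^sub>F t in at_left x. f t = 2 powi k * t + c" "\<forall>\<^sub>F t in at_right x. f t = 2 powi l * t + d"
    using assms by (rule pl2_atE) blast
  obtain a where a: "a < x" "\<And>t. a < t \<Longrightarrow> t < x \<Longrightarrow> f t = 2 powi k * t + c"
    using f(3) unfolding eventually_at_left_field by blast
  obtain b where b: "x < b" "\<And>t. x < t \<Longrightarrow> t < b \<Longrightarrow> f t = 2 powi l * t + d"
    using f(4) unfolding eventually_at_right_field by blast
  have "\<forall>\<^sub>F y in at_left x. \<exists>k::int. \<exists>c\<in>dyadics. \<forall>\<^sub>F t in nhds y. f t = 2 powi k * t + c"
    unfolding eventually_at_left_field
  proof (intro exI[of _ a] conjI allI impI a(1))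
    fix y assume "a < y" "y < x"
    then have "\<forall>\<^sub>F t in nhds y. f t = 2 powi k * t + c"
      using eventually_nhds_in_open[of "{a<..<x}" y] a(2) by (auto elim: eventually_mono)
    then show "\<exists>k::int. \<exists>c\<in>dyadics. \<forall>\<^sub>F t in nhds y. f t = 2 powi k * t + c" using f(1) by blast
  qed
  moreover have "\<forall>\<^sub>F y in at_right x. \<exists>k::int. \<exists>c\<in>dyadics. \<forall>\<^sub>F t in nhds y. f t = 2 powi k * t + c"
    unfolding eventually_at_right_field
  proof (intro exI[of _ b] conjI allI impI b(1))
    fix y assume "x < y" "y < b"
    then have "\<forall>\<^sub>F t in nhds y. f t = 2 powi l * t + d"
      using eventually_nhds_in_open[of "{x<..<b}" y] b(2) by (auto elim: eventually_mono)
    then show "\<exists>k::int. \<exists>c\<in>dyadics. \<forall>\<^sub>F t in nhds y. f t = 2 powi k * t + c" using f(2) by blast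
  qed
  ultimately show ?thesis by (simp add: eventually_at_split)
qed

text \<open>Being dyadic piecewise linear is an open condition. This matters because
  \<open>preserves\<close> speaks of functions compatible on an open set, not of single
  germs.\<close>

lemma pl2_at_nhds:
  assumes "pl2_at f x"
  shows "\<forall>\<^sub>F y in nhds x. pl2_at f y"
  unfolding eventually_nhds_conv_at using assms pl2_at_near[OF assms]
  by (auto elim!: eventually_mono intro: pl2_at_affine_near)

section \<open>Standard dyadic intervals\<close>

text \<open>Otherwise there are bad intervals of arbitrarily high level. Their left ends accumulate
  at some \<open>y\<close> in \<open>[a, b]\<close> and their lengths tend to 0, so some of them
  fall into the neighbourhood of \<open>y\<close> where \<open>P\<close> holds.\<close>

lemma dyadic_intervals_compact:
  fixes P :: "nat \<Rightarrow> int \<Rightarrow> bool"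
  assumes loc: "\<And>y. a \<le> y \<Longrightarrow> y \<le> b \<Longrightarrow> \<exists>\<delta>>0. \<exists>N. \<forall>n\<ge>N. \<forall>i.
      y - \<delta> < of_int i / 2 ^ n \<longrightarrow> (of_int i + 1) / 2 ^ n < y + \<delta> \<longrightarrow> P n i"
  shows "\<exists>N. \<forall>n\<ge>N. \<forall>i. a \<le> of_int i / 2 ^ n \<longrightarrow> (of_int i + 1) / 2 ^ n \<le> (b::real) \<longrightarrow> P n i"
proof (rule ccontr)
  assume "\<not> ?thesis"
  then have "\<forall>N. \<exists>n i. n \<ge> N \<and> a \<le> of_int i / 2 ^ n \<and> (of_int i + 1) / 2 ^ n \<le> b \<and> \<not> P n i"
    by blast
  then obtain n i where ni: "\<And>N. n N \<ge> N" "\<And>N. a \<le> of_int (i N) / 2 ^ n N"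
      "\<And>N. (of_int (i N) + 1) / 2 ^ n N \<le> b" "\<And>N. \<not> P (n N) (i N)"
    by metis
  define x :: "nat \<Rightarrow> real" where "x N = of_int (i N) / 2 ^ n N" for N
  have x': "(of_int (i N) + 1) / 2 ^ n N = x N + 1 / 2 ^ n N" for N
    by (simp add: x_def add_divide_distrib)
  have "x N \<in> {a..b}" for N
  proof -
    have "0 \<le> 1 / (2::real) ^ n N" by simp
    then show ?thesis using ni(2,3)[of N] unfolding x' x_def[symmetric] atLeastAtMost_iff by linarith
  qed
  then obtain y r where y: "y \<in> {a..b}" "strict_mono r" "(x \<circ> r) \<longlonglongrightarrow> y"
    using compact_imp_seq_compact[OF compact_Icc, of a b] unfolding seq_compact_def by metis
  obtain \<delta> N where \<delta>: "\<delta> > 0" and P: "\<And>m j. m \<ge> N \<Longrightarrow> y - \<delta> < of_int j / 2 ^ m \<Longrightarrow>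
      (of_int j + 1) / 2 ^ m < y + \<delta> \<Longrightarrow> P m j"
    using loc[of y] y(1) by auto
  have "\<forall>\<^sub>F k in sequentially. dist ((x \<circ> r) k) y < \<delta> / 2"
    by (rule tendstoD[OF y(3)]) (use \<delta> in simp)
  moreover have "\<forall>\<^sub>F k in sequentially. (1/2::real) ^ k < \<delta> / 2"
    using \<delta> by (intro order_tendstoD(2)[OF LIMSEQ_power_zero]) auto
  moreover have "\<forall>\<^sub>F k in sequentially. k \<ge> N" by (rule eventually_ge_at_top)
  ultimately have "\<forall>\<^sub>F k in sequentially. dist ((x \<circ> r) k) y < \<delta> / 2 \<and> (1/2::real) ^ k < \<delta> / 2 \<and> k \<ge> N"
    by eventually_elim simp
  then obtain k where k: "dist (x (r k)) y < \<delta> / 2" "(1/2::real) ^ k < \<delta> / 2" "k \<ge> N"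
    by (auto simp: eventually_sequentially)
  \<comment> \<open>The level along the subsequence is still at least \<open>k\<close>; this bounds
    the length of the interval by \<open>\<delta> / 2\<close> and puts its level above
    \<open>N\<close>.\<close>
  have "k \<le> n (r k)" using ni(1)[of "r k"] seq_suble[OF y(2), of k] by linarith
  then have "(1/2::real) ^ n (r k) \<le> (1/2) ^ k" by (intro power_decreasing) auto
  then have "1 / 2 ^ n (r k) < \<delta> / 2" using k(2) by (simp add: power_one_over)
  then have "y - \<delta> < x (r k)" "x (r k) + 1 / 2 ^ n (r k) < y + \<delta>"
    using abs_ge_self[of "x (r k) - y"] abs_ge_minus_self[of "x (r k) - y"] k(1) \<delta>
    unfolding dist_real_def by linarith+
  then have "P (n (r k)) (i (r k))"
    using k(3) \<open>k \<le> n (r k)\<close> by (intro P) (simp_all only: x' x_def[symmetric])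
  then show False using ni(4) by blast
qed

text \<open>If \<open>y\<close> is dyadic, it is a grid point at high levels, no interval straddles
  it, and one of the two one-sided formulas holds on the whole interval. If not,
  \<open>\<kappa> y\<close> is not dyadic either and the two formulas agree. \<open>\<kappa>\<close>
  is kept apart from \<open>f\<close> because a conjugate is known at \<open>\<kappa> y\<close>,
  while the intervals live in the variable \<open>y\<close>.\<close>

lemma pl2_at_dyadic_intervals:
  assumes f: "pl2_at f (\<kappa> y)" and \<kappa>: "strict_mono \<kappa>" "isCont \<kappa> y"
    and dy: "\<kappa> y \<in> dyadics \<Longrightarrow> y \<in> dyadics"
  shows "\<exists>\<delta>>0. \<exists>N k l. \<exists>c\<in>dyadics. \<exists>d\<in>dyadics. \<forall>n\<ge>N. \<forall>i.
      y - \<delta> < of_int i / 2 ^ n \<longrightarrow> (of_int i + 1) / 2 ^ n < y + \<delta> \<longrightarrow>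
      (\<forall>t\<in>{of_int i / 2 ^ n..(of_int i + 1) / 2 ^ n}. f (\<kappa> t) = 2 powi (k::int) * \<kappa> t + c) \<or>
      (\<forall>t\<in>{of_int i / 2 ^ n..(of_int i + 1) / 2 ^ n}. f (\<kappa> t) = 2 powi (l::int) * \<kappa> t + d)"
proof -
  obtain k l :: int and c d where e: "c \<in> dyadics" "d \<in> dyadics"
    "f (\<kappa> y) = 2 powi k * \<kappa> y + c" "f (\<kappa> y) = 2 powi l * \<kappa> y + d"
    "\<forall>\<^sub>F t in at_left (\<kappa> y). f t = 2 powi k * t + c" "\<forall>\<^sub>F t in at_right (\<kappa> y). f t = 2 powi l * t + d"
    "\<kappa> y \<notin> dyadics \<Longrightarrow> k = l \<and> c = d"
    using f by (rule pl2_atE) blast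
  obtain a where a: "a < \<kappa> y" "\<And>t. a < t \<Longrightarrow> t < \<kappa> y \<Longrightarrow> f t = 2 powi k * t + c"
    using e(5) unfolding eventually_at_left_field by blast
  obtain b where b: "\<kappa> y < b" "\<And>t. \<kappa> y < t \<Longrightarrow> t < b \<Longrightarrow> f t = 2 powi l * t + d"
    using e(6) unfolding eventually_at_right_field by blast
  have "\<forall>\<^sub>F t in nhds y. \<kappa> t \<in> {a<..<b}"
    using \<kappa>(2) a(1) b(1) unfolding isCont_def
    by (intro topological_tendstoD[where f = \<kappa> and l = "\<kappa> y"])
      (auto simp: tendsto_at_iff_tendsto_nhds)
  then obtain \<delta> where \<delta>: "\<delta> > 0" "\<And>t. dist t y < \<delta> \<Longrightarrow> a < \<kappa> t \<and> \<kappa> t < b"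
    unfolding eventually_nhds_metric by auto
  have L: "f (\<kappa> t) = 2 powi k * \<kappa> t + c" if "t \<le> y" "y - \<delta> < t" for t
    using a(2)[of "\<kappa> t"] \<delta>(2)[of t] that \<delta>(1) e(3) strict_mono_less[OF \<kappa>(1), of t y]
    by (cases "t = y") (auto simp: dist_real_def)
  have R: "f (\<kappa> t) = 2 powi l * \<kappa> t + d" if "t \<ge> y" "t < y + \<delta>" for t
    using b(2)[of "\<kappa> t"] \<delta>(2)[of t] that \<delta>(1) e(4) strict_mono_less[OF \<kappa>(1), of y t]
    by (cases "t = y") (auto simp: dist_real_def)
  obtain N where N: "y \<in> dyadics \<longrightarrow> y * 2 ^ N \<in> \<int>" by (auto simp: dyadics_iff)
  have "(\<forall>t\<in>{of_int i / 2 ^ n..(of_int i + 1) / 2 ^ n}. f (\<kappa> t) = 2 powi k * \<kappa> t + c) \<or>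
      (\<forall>t\<in>{of_int i / 2 ^ n..(of_int i + 1) / 2 ^ n}. f (\<kappa> t) = 2 powi l * \<kappa> t + d)"
    if n: "n \<ge> N" and i: "y - \<delta> < of_int i / 2 ^ n" "(of_int i + 1) / 2 ^ n < y + \<delta>" for n and i :: int
  proof (cases "y \<in> dyadics")
    case True
    then obtain z :: int where z: "y * 2 ^ n = of_int z"
      using dyadics_scale[of y N n] N n by (auto elim: Ints_cases)
    then have y: "y = of_int z / 2 ^ n" by (simp add: field_simps)
    show ?thesis
    proof (cases "i + 1 \<le> z")
      case True
      then have "of_int i + 1 \<le> (of_int z :: real)" by linarith
      then have "(of_int i + 1) / 2 ^ n \<le> y" unfolding y by (simp add: divide_right_mono)
      then show ?thesis using L i by force
    next
      case False
      then have "of_int z \<le> (of_int i :: real)" by linarith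
      then have "y \<le> of_int i / 2 ^ n" unfolding y by (simp add: divide_right_mono)
      then show ?thesis using R i by force
    qed
  next
    case False
    then have "k = l" "c = d" using e(7) dy by blast+
    then show ?thesis using L R i by (smt (verit) atLeastAtMost_iff)
  qed
  then show ?thesis using \<delta>(1) e(1,2) by blast
qed

text \<open>The \<open>i\<close>-th interval of level \<open>n\<close> is \<open>[i / 2 ^ n, (i + 1) / 2 ^ n]\<close>.\<close>

definition interval_map :: "(real \<Rightarrow> real) \<Rightarrow> nat \<Rightarrow> int \<Rightarrow> nat \<Rightarrow> int \<Rightarrow> bool" where
  "interval_map f n i m j \<longleftrightarrow>
     (\<forall>s. 0 \<le> s \<longrightarrow> s \<le> 1 \<longrightarrow> f ((of_int i + s) / 2 ^ n) = (of_int j + s) / 2 ^ m)"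

text \<open>Slope \<open>2 powi k\<close> carries level \<open>n\<close> to level
  \<open>m = n - k\<close>, and \<open>c\<close> is a whole number \<open>z\<close> of intervals of
  level \<open>m\<close>, so \<open>j = i + z\<close>. The bound on \<open>n\<close> ensures that
  \<open>n - k\<close> is not negative and that \<open>m \<ge> p\<close>.\<close>

lemma interval_map_affine:
  assumes f: "\<forall>t\<in>{of_int i / 2 ^ n..(of_int i + 1) / 2 ^ n}. f t = 2 powi (k::int) * t + c"
    and c: "c * 2 ^ p \<in> \<int>" and n: "n \<ge> nat k + p"
  shows "\<exists>m j. interval_map f n i m j"
proof -
  define m where "m = nat (int n - k)"
  have m: "int m = int n - k" "m \<ge> p" using n by (auto simp: m_def)
  have pw: "(2::real) ^ n = 2 powi k * 2 ^ m"
  proof -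
    have "(2::real) powi (int n) = 2 powi (k + int m)" using m by simp
    then show ?thesis by (simp add: power_int_add)
  qed
  obtain z :: int where z: "c * 2 ^ m = of_int z"
    using dyadics_scale[OF c m(2)] by (auto elim: Ints_cases)
  have "interval_map f n i m (i + z)"
    unfolding interval_map_def
  proof (intro allI impI)
    fix s :: real assume s: "0 \<le> s" "s \<le> 1"
    then have "f ((of_int i + s) / 2 ^ n) = 2 powi k * ((of_int i + s) / 2 ^ n) + c"
      using f by (simp add: divide_right_mono)
    also have "\<dots> = (of_int i + s) / 2 ^ m + of_int z / 2 ^ m"
      unfolding pw by (simp add: z[symmetric])
    finally show "f ((of_int i + s) / 2 ^ n) = (of_int (i + z) + s) / 2 ^ m"
      by (simp add: add_divide_distrib)
  qed
  then show ?thesis by blast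
qed

lemma pl2_interval_maps:
  assumes "\<And>y. a \<le> y \<Longrightarrow> y \<le> b \<Longrightarrow> pl2_at f y"
  shows "\<exists>N. \<forall>n\<ge>N. \<forall>i. a \<le> of_int i / 2 ^ n \<longrightarrow> (of_int i + 1) / 2 ^ n \<le> b \<longrightarrow> (\<exists>m j. interval_map f n i m j)"
proof (rule dyadic_intervals_compact)
  fix y assume y: "a \<le> y" "y \<le> b"
  have "strict_mono (\<lambda>t::real. t)" "isCont (\<lambda>t::real. t) y" by (simp_all add: strict_mono_def)
  from pl2_at_dyadic_intervals[OF assms[OF y] this]
  obtain \<delta> N k l c d where \<delta>: "\<delta> > 0" "c \<in> dyadics" "d \<in> dyadics" and *: "\<forall>n\<ge>N. \<forall>i.
      y - \<delta> < of_int i / 2 ^ n \<longrightarrow> (of_int i + 1) / 2 ^ n < y + \<delta> \<longrightarrow>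
      (\<forall>t\<in>{of_int i / 2 ^ n..(of_int i + 1) / 2 ^ n}. f t = 2 powi (k::int) * t + c) \<or>
      (\<forall>t\<in>{of_int i / 2 ^ n..(of_int i + 1) / 2 ^ n}. f t = 2 powi (l::int) * t + d)"
    by blast
  obtain p q where pq: "c * 2 ^ p \<in> \<int>" "d * 2 ^ q \<in> \<int>" using \<delta> by (auto simp: dyadics_iff)
  have "\<exists>m j. interval_map f n i m j"
    if "n \<ge> max N (max (nat k + p) (nat l + q))" "y - \<delta> < of_int i / 2 ^ n" "(of_int i + 1) / 2 ^ n < y + \<delta>" for n i
    using *[rule_format, of n i] that interval_map_affine[OF _ pq(1), of i n f k] interval_map_affine[OF _ pq(2), of i n f l]
    by auto
  then show "\<exists>\<delta>>0. \<exists>N. \<forall>n\<ge>N. \<forall>i. y - \<delta> < of_int i / 2 ^ n \<longrightarrow> (of_int i + 1) / 2 ^ n < y + \<delta> \<longrightarrow>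
      (\<exists>m j. interval_map f n i m j)"
    using \<delta>(1) by blast
qed

text \<open>An odd numerator puts a dyadic rational in lowest terms; different exponents would
  equate an even and an odd integer after clearing denominators.\<close>

lemma odd_over_power_eq:
  assumes "(2 * of_int a + 1) / 2 ^ m = (2 * of_int b + 1 :: real) / 2 ^ n"
  shows "m = n \<and> a = b"
proof -
  have *: False if "(2 * of_int a + 1) / 2 ^ m = (2 * of_int b + 1 :: real) / 2 ^ (m + Suc p)" for a b :: int and m p
  proof -
    have "(2 * of_int a + 1) * 2 ^ Suc p = (2 * of_int a + 1 :: real) / 2 ^ m * 2 ^ (m + Suc p)"
      by (simp add: power_add del: power_Suc add_Suc_right)
    also have "\<dots> = 2 * of_int b + 1" unfolding that by simp
    finally have "(2 * of_int a + 1) * 2 ^ Suc p = (2 * of_int b + 1 :: real)" .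
    then have "of_int ((2 * a + 1) * 2 ^ Suc p) = (of_int (2 * b + 1) :: real)" by simp
    then have "(2 * a + 1) * 2 ^ Suc p = 2 * b + 1" by (simp only: of_int_eq_iff)
    then have "even (2 * b + 1)" by (metis even_mult_iff even_power even_numeral zero_less_Suc)
    then show False by simp
  qed
  have "m = n"
    using assms *[of a m b "n - m - 1"] *[of b n a "m - n - 1"]
    by (cases m n rule: linorder_cases) auto
  then show ?thesis using assms by simp
qed

text \<open>An interval starting at \<open>1/2\<close> begins with left children and an interval ending at \<open>1/2\<close> ends
  with a right child. If \<open>f\<close> preserved the parity of all intervals, then a smallest maximal left child in
  the domain would be followed by its sibling and the two could be merged.\<close>

lemma parity_mismatch:
  assumes mono: "\<And>s t. 1/2 \<le> s \<Longrightarrow> s \<le> t \<Longrightarrow> t \<le> y \<Longrightarrow> f s \<le> (f t :: real)"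
    and y: "1/2 < y" "y < 1" "y * 2 ^ N \<in> \<int>"
    and f: "f (1/2) > 0" "f y = 1/2"
    and fine: "\<And>n i. n \<ge> N \<Longrightarrow> 1/2 \<le> of_int i / (2::real) ^ n \<Longrightarrow> (of_int i + 1) / 2 ^ n \<le> y \<Longrightarrow> \<exists>m j. interval_map f n i m j"
    and parity: "\<And>n i m j. 1/2 \<le> of_int i / (2::real) ^ n \<Longrightarrow> (of_int i + 1) / 2 ^ n \<le> y \<Longrightarrow>
      interval_map f n i m j \<Longrightarrow> even i = even j"
  shows False
proof -
  define G where "G n i \<longleftrightarrow> 1/2 \<le> of_int i / (2::real) ^ n \<and> (of_int i + 1) / 2 ^ n \<le> y \<and> (\<exists>m j. interval_map f n i m j)"
    for n and i :: int
  \<comment> \<open>Call an interval good if it satisfies \<open>G\<close>. \<open>B n\<close>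
    provides a good left child of level \<open>Suc n\<close> with a bad parent; the contradiction
    comes from one of greatest level.\<close>
  define B where "B n \<longleftrightarrow> (\<exists>j. G (Suc n) (2 * j) \<and> \<not> G n j)" for n
  have par: "even i = even j" if "G n i" "interval_map f n i m j" for n i m j
    by (rule parity[OF _ _ that(2)]) (use that(1) in \<open>simp_all add: G_def\<close>)
  \<comment> \<open>Follow the leftmost descendants of a bad interval. They shrink to its left end,
    which lies before \<open>y\<close>, so they eventually become good; the first good one is a left
    child with a bad parent.\<close>
  have descend: "\<exists>t\<ge>n. G (Suc t) (2 ^ (Suc t - n) * i) \<and> \<not> G t (2 ^ (t - n) * i)"
    if ni: "\<not> G n i" "1/2 \<le> of_int i / (2::real) ^ n" "of_int i / 2 ^ n < y" for n i
  proof -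
    have eq: "of_int (2 ^ (t - n) * i) / 2 ^ t = (of_int i / 2 ^ n :: real)" if "t \<ge> n" for t
    proof -
      obtain p where "t = n + p" using le_Suc_ex[OF \<open>n \<le> t\<close>] by blast
      then show ?thesis by (simp add: power_add)
    qed
    have "\<forall>\<^sub>F t in sequentially. (1/2::real) ^ t < y - of_int i / 2 ^ n"
      using ni(3) by (intro order_tendstoD(2)[OF LIMSEQ_power_zero]) auto
    then obtain T where T: "\<And>t. t \<ge> T \<Longrightarrow> (1/2::real) ^ t < y - of_int i / 2 ^ n"
      by (auto simp: eventually_sequentially)
    have big: "G t (2 ^ (t - n) * i)" if t: "t \<ge> T" "t \<ge> N" "t \<ge> n" for t
    proof -
      have "(of_int (2 ^ (t - n) * i) + 1) / 2 ^ t = of_int i / 2 ^ n + (1/2::real) ^ t"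
        unfolding add_divide_distrib eq[OF t(3)] by (simp add: power_one_over)
      then have "(of_int (2 ^ (t - n) * i) + 1) / 2 ^ t \<le> y" using T[OF t(1)] by linarith
      moreover have "1/2 \<le> of_int (2 ^ (t - n) * i) / (2::real) ^ t" unfolding eq[OF t(3)] by (rule ni(2))
      ultimately show ?thesis unfolding G_def using fine[OF t(2)] by blast
    qed
    define Q where "Q p \<longleftrightarrow> G (n + p) (2 ^ p * i)" for p
    have "Q (T + N)" unfolding Q_def using big[of "n + (T + N)"] by simp
    moreover have "\<not> Q 0" using ni(1) by (simp add: Q_def)
    moreover have "\<exists>p. Q (Suc p) \<and> \<not> Q p"
    proof (rule ccontr)
      assume no: "\<not> ?thesis"
      have "\<not> Q p" for p
        by (induction p) (use no \<open>\<not> Q 0\<close> in auto)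
      then show False using \<open>Q (T + N)\<close> by blast
    qed
    ultimately obtain p where "Q (Suc p)" "\<not> Q p" by blast
    then show ?thesis
      by (intro exI[of _ "n + p"]) (simp add: Q_def Suc_diff_le)
  qed
  have "\<exists>n. B n"
  proof -
    \<comment> \<open>The interval \<open>[1/2, 1]\<close> starts at the left end of the domain but
      reaches beyond \<open>y < 1\<close>.\<close>
    have "\<not> G 1 1" using y(2) by (simp add: G_def)
    from descend[OF this] y(1) obtain t where t: "t \<ge> 1" "G (Suc t) (2 ^ t)" "\<not> G t (2 ^ (t - 1))"
      by auto
    then show ?thesis unfolding B_def
      by (intro exI[of _ t] exI[of _ "2 ^ (t - 1)"]) (cases t, auto)
  qed
  \<comment> \<open>From level \<open>N\<close> on, \<open>y\<close> is a grid point. If a left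
    child ends at or before \<open>y\<close>, so does its parent, and \<open>fine\<close> makes the
    parent good.\<close>
  moreover have bound: "n < N" if "B n" for n
  proof (rule ccontr)
    assume "\<not> n < N"
    then have n: "n \<ge> N" by simp
    obtain j where j: "G (Suc n) (2 * j)" "\<not> G n j" using \<open>B n\<close> unfolding B_def by blast
    obtain z :: int where z: "y * 2 ^ n = of_int z"
      using dyadics_scale[OF y(3) n] by (auto elim: Ints_cases)
    have "(2 * of_int j + 1) / 2 ^ Suc n \<le> y" using j(1) by (simp add: G_def)
    then have "2 * of_int j + 1 \<le> 2 * (y * 2 ^ n)" by (simp add: field_simps)
    then have "2 * j + 1 \<le> 2 * z" unfolding z by linarith
    then have "j + 1 \<le> z" by linarith
    then have "of_int j + 1 \<le> y * 2 ^ n" unfolding z by linarith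
    then have "(of_int j + 1) / 2 ^ n \<le> y" by (simp add: field_simps)
    moreover have "1/2 \<le> of_int j / (2::real) ^ n" using j(1) by (simp add: G_def)
    ultimately have "G n j" unfolding G_def using fine[OF n] by blast
    then show False using j(2) by blast
  qed
  ultimately obtain n where n: "B n" and max: "\<And>t. B t \<Longrightarrow> t \<le> n"
    using ex_has_greatest_nat[of B _ "\<lambda>n. n" N] by blast
  obtain j where j: "G (Suc n) (2 * j)" "\<not> G n j" using n unfolding B_def by blast
  then obtain m k where k: "interval_map f (Suc n) (2 * j) m k" unfolding G_def by blast
  \<comment> \<open>By parity the image is again a left child; \<open>l\<close> is the index of its
    parent.\<close>
  then obtain l where l: "k = 2 * l" using par[OF j(1) k] by (auto elim: evenE)
  have dom: "1/2 \<le> of_int j / (2::real) ^ n" "(2 * of_int j + 1) / 2 ^ Suc n \<le> y"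
    using j(1) by (auto simp: G_def)
  have k': "f ((2 * of_int j + s) / 2 ^ Suc n) = (2 * of_int l + s) / 2 ^ m" if "0 \<le> s" "s \<le> 1" for s
    using k that unfolding interval_map_def l by auto
  have pos: "l > 0 \<or> m = 0"
  proof -
    have lt: "of_int (2 * j) / 2 ^ Suc n \<le> y"
      using dom(2) by (simp add: add_divide_distrib) (smt (verit) zero_le_divide_1_iff zero_le_power)
    have "f (1/2) \<le> f ((2 * of_int j + 0) / 2 ^ Suc n)"
      by (rule mono) (use dom lt in auto)
    then have "(2 * of_int l + 0) / (2::real) ^ m > 0" using k'[of 0] f(1) by simp
    then show ?thesis by (simp add: zero_less_divide_iff)
  qed
  have mid: "1/2 \<le> (2 * of_int j + 1) / (2::real) ^ Suc n"
  proof -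
    have "of_int j / (2::real) ^ n \<le> (2 * of_int j + 1) / 2 ^ Suc n"
      by (simp add: field_simps)
    then show ?thesis using dom(1) by linarith
  qed
  have half: "f ((2 * of_int j + 1) / 2 ^ Suc n) \<le> 1/2"
    unfolding f(2)[symmetric] by (rule mono[OF mid dom(2)]) simp
  then have lm: "(2 * of_int l + 1) / 2 ^ m \<le> (1/2 :: real)" using k'[of 1] by simp
  have "l > 0" using pos
  proof
    assume "m = 0"
    then have "2 * of_int l + 1 \<le> (1/2 :: real)" using lm by simp
    moreover have "f (1/2) \<le> f ((2 * of_int j + 1) / 2 ^ Suc n)"
      by (rule mono[OF _ mid dom(2)]) simp
    then have "2 * of_int l + 1 > (0::real)" using k'[of 1] f(1) \<open>m = 0\<close> by simp
    ultimately have "2 * l + 1 > 0" "2 * l + 1 < 1" by linarith+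
    then show ?thesis by linarith
  qed
  then have "m \<noteq> 0" using lm by (intro notI) auto
  then obtain m' where m': "m = Suc m'" using not0_implies_Suc by blast
  \<comment> \<open>Ending at \<open>y\<close> would make the image end at \<open>f y = 1/2\<close>.
    Comparing lowest terms forces \<open>l = 0\<close>, against \<open>l > 0\<close>. Hence the
    sibling starts before \<open>y\<close>.\<close>
  have ne: "(2 * of_int j + 1) / 2 ^ Suc n \<noteq> y"
  proof
    assume "(2 * of_int j + 1) / 2 ^ Suc n = y"
    then have "(2 * of_int l + 1) / 2 ^ m = f y" using k'[of 1] by simp
    moreover have "f y = (2 * of_int 0 + 1 :: real) / 2 ^ 1" by (simp add: f(2))
    ultimately have "(2 * of_int l + 1) / 2 ^ m = (2 * of_int 0 + 1 :: real) / 2 ^ 1" by (rule trans)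
    then show False using odd_over_power_eq[of l m 0 1] \<open>l > 0\<close> by simp
  qed
  then have lt: "(2 * of_int j + 1) / 2 ^ Suc n < y" using dom(2) by simp
  show False
  proof (cases "G (Suc n) (2 * j + 1)")
    case True
    then obtain m2 k2 where k2: "interval_map f (Suc n) (2 * j + 1) m2 k2" unfolding G_def by blast
    then have "odd k2" using par[OF True] by simp
    then obtain l2 where l2: "k2 = 2 * l2 + 1" by (auto elim: oddE)
    have k2': "f ((2 * of_int j + 1 + s) / 2 ^ Suc n) = (2 * of_int l2 + 1 + s) / 2 ^ m2" if "0 \<le> s" "s \<le> 1" for s
      using k2 that unfolding interval_map_def l2 by auto
    \<comment> \<open>The image of the sibling starts where the image of the left child ends. Both
      descriptions of this point are in lowest terms, so the images are siblings as well and the two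
      pieces merge into a good parent.\<close>
    have "m2 = m" "l2 = l"
      using k'[of 1] k2'[of 0] odd_over_power_eq[of l m l2 m2] by auto
    have "interval_map f n j m' l"
      unfolding interval_map_def
    proof (intro allI impI)
      fix s :: real assume s: "0 \<le> s" "s \<le> 1"
      have eq: "(of_int j + s) / 2 ^ n = (2 * of_int j + 2 * s) / 2 ^ Suc n"
        "(2 * of_int l + 2 * s) / 2 ^ m = (of_int l + s) / 2 ^ m'"
        by (simp_all add: m' field_simps)
      show "f ((of_int j + s) / 2 ^ n) = (of_int l + s) / 2 ^ m'"
      proof (cases "s \<le> 1/2")
        case True
        then show ?thesis using k'[of "2 * s"] s unfolding eq by simp
      next
        case False
        have eq2: "2 * of_int j + 1 + (2 * s - 1) = 2 * of_int j + 2 * s"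
          "2 * of_int l + 1 + (2 * s - 1) = 2 * of_int l + 2 * s" by simp_all
        show ?thesis using k2'[of "2 * s - 1"] s False
          unfolding \<open>m2 = m\<close> \<open>l2 = l\<close> eq2 eq by simp
      qed
    qed
    moreover have "(of_int j + 1) / 2 ^ n \<le> y"
      using True by (simp add: G_def field_simps)
    ultimately show False using j(2) dom(1) unfolding G_def by blast
  next
    case False
    \<comment> \<open>A bad sibling has a good left child with a bad parent among its leftmost
      descendants, at a level beyond the maximal one.\<close>
    have "1/2 \<le> of_int (2 * j + 1) / (2::real) ^ Suc n" using mid by simp
    from descend[OF False this] lt obtain t where t: "t \<ge> Suc n"
      "G (Suc t) (2 ^ (Suc t - Suc n) * (2 * j + 1))" "\<not> G t (2 ^ (t - Suc n) * (2 * j + 1))"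
      by auto
    have "Suc t - Suc n = Suc (t - Suc n)" using t(1) by simp
    then have "2 ^ (Suc t - Suc n) * (2 * j + 1) = 2 * (2 ^ (t - Suc n) * (2 * j + 1))"
      by (simp only: power_Suc mult.assoc)
    then have "G (Suc t) (2 * (2 ^ (t - Suc n) * (2 * j + 1)))" using t(2) by (simp only:)
    then have "B t" unfolding B_def using t(3) by blast
    then show False using max t(1) by fastforce
  qed
qed

section \<open>The normalizer on the line\<close>

text \<open>\<open>i mod 2 ^ p\<close> encodes the last \<open>p\<close> digits of an address, and
  \<open>2 ^ p * i + r\<close> is the address of \<open>i\<close> with the \<open>p\<close> digits
  of \<open>r\<close> appended. The relation \<open>E\<close> is abstract because the argument only
  manipulates digits.\<close>

lemma all_equivalent:
  fixes E :: "nat \<Rightarrow> int \<Rightarrow> nat \<Rightarrow> int \<Rightarrow> bool"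
  assumes refl: "\<And>n i. E n i n i"
    and sym: "\<And>n i m j. E n i m j \<Longrightarrow> E m j n i"
    and trans: "\<And>n i m j p k. E n i m j \<Longrightarrow> E m j p k \<Longrightarrow> E n i p k"
    and drop: "\<And>n i. n \<ge> n0 \<Longrightarrow> 0 \<le> i \<Longrightarrow> i < 2 ^ n \<Longrightarrow> E n i (Suc n) i \<and> E n i (Suc n) (i + 2 ^ n)"
    and sub: "\<And>n i m j p r. E n i m j \<Longrightarrow> 0 \<le> r \<Longrightarrow> r < 2 ^ p \<Longrightarrow> E (n + p) (2 ^ p * i + r) (m + p) (2 ^ p * j + r)"
    and mis: "a \<ge> n0" "b \<ge> n0" "0 \<le> u" "u < 2 ^ a" "0 \<le> v" "v < 2 ^ b" "E a u b v" "even u" "odd v"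
    and n: "n \<ge> n0" "0 \<le> i" "i < 2 ^ n"
    and m: "m \<ge> n0" "0 \<le> j" "j < 2 ^ m"
  shows "E n i m j"
proof -
  have base: "E n0 (i mod 2 ^ n0) n i" if "n \<ge> n0" "0 \<le> i" "i < 2 ^ n" for n i
    using that
  proof (induction n arbitrary: i rule: dec_induct)
    case base
    then show ?case using refl by simp
  next
    case (step n)
    define i' where "i' = i mod 2 ^ n"
    have i': "0 \<le> i'" "i' < 2 ^ n" by (simp_all add: i'_def)
    \<comment> \<open>The leading digit of \<open>i\<close> at level \<open>Suc n\<close> is 0 or 1,
      and \<open>i'\<close> is the rest of the address.\<close>
    have "i = i' \<or> i = i' + 2 ^ n"
    proof (cases "i < 2 ^ n")
      case True
      then show ?thesis using step.prems by (simp add: i'_def)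
    next
      case False
      then have "(i - 2 ^ n) mod 2 ^ n = i - 2 ^ n" using step.prems by (intro mod_pos_pos_trivial) auto
      then show ?thesis by (simp add: i'_def)
    qed
    then have "E n i' (Suc n) i" using drop[OF step.hyps(1) i'] by auto
    moreover have "E n0 (i' mod 2 ^ n0) n i'" by (rule step.IH[OF i'])
    moreover have "i' mod 2 ^ n0 = i mod 2 ^ n0"
      unfolding i'_def by (rule mod_mod_cancel) (simp add: le_imp_power_dvd step.hyps(1))
    ultimately show ?case using trans by metis
  qed
  define Q where "Q p \<longleftrightarrow> (\<forall>n m i j. n \<ge> n0 \<longrightarrow> m \<ge> n0 \<longrightarrow> 0 \<le> i \<longrightarrow> i < 2 ^ n \<longrightarrow> 0 \<le> j \<longrightarrow> j < 2 ^ m \<longrightarrow>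
      i mod 2 ^ p = j mod 2 ^ p \<longrightarrow> E n i m j)" for p
  have "Q n0" unfolding Q_def using base sym trans by metis
  moreover have "Q p" if Q: "Q (Suc p)" for p
  proof -
    have aux: "E n i m j" if n: "n \<ge> n0" "0 \<le> i" "i < 2 ^ n" and m: "m \<ge> n0" "0 \<le> j" "j < 2 ^ m"
      and ij: "i mod 2 ^ Suc p = r" "j mod 2 ^ Suc p = 2 ^ p + r" and r: "0 \<le> r" "r < 2 ^ p" for n i m j r
    proof -
      obtain u' v' where uv: "u = 2 * u'" "v = 2 * v' + 1" using mis(8,9) by (auto elim!: evenE oddE)
      \<comment> \<open>The last \<open>Suc p\<close> digits of the extended addresses are
        \<open>0r\<close> and \<open>1r\<close>, the two endings to be identified.\<close>
      have "2 ^ p * u + r = r + 2 ^ Suc p * u'" "2 ^ p * v + r = (2 ^ p + r) + 2 ^ Suc p * v'"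
        by (simp_all add: uv algebra_simps)
      then have res: "(2 ^ p * u + r) mod 2 ^ Suc p = r" "(2 ^ p * v + r) mod 2 ^ Suc p = 2 ^ p + r"
        using r by (simp_all only: mod_mult_self2) (simp_all add: mod_pos_pos_trivial)
      have rng: "0 \<le> 2 ^ p * w + r \<and> 2 ^ p * w + r < 2 ^ (e + p)" if "0 \<le> w" "w < 2 ^ e" for w :: int and e
      proof -
        have "2 ^ p * (w + 1) \<le> 2 ^ p * 2 ^ e" using that(2) by (intro mult_left_mono) auto
        then have "2 ^ p * w + r < 2 ^ (e + p)" using r by (simp add: power_add algebra_simps)
        moreover have "0 \<le> 2 ^ p * w + r" using that(1) r(1) by simp
        ultimately show ?thesis by simp
      qed
      have "E n i (a + p) (2 ^ p * u + r)"
        using Q n mis(1) rng[OF mis(3,4)] ij(1) res(1) unfolding Q_def by (metis trans_le_add1)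
      moreover have "E (a + p) (2 ^ p * u + r) (b + p) (2 ^ p * v + r)"
        by (rule sub[OF mis(7) r])
      moreover have "E (b + p) (2 ^ p * v + r) m j"
        using Q m mis(2) rng[OF mis(5,6)] ij(2) res(2) unfolding Q_def by (metis trans_le_add1)
      ultimately show ?thesis using trans by blast
    qed
    have split: "k mod 2 ^ Suc p = k mod 2 ^ p \<or> k mod 2 ^ Suc p = 2 ^ p + k mod 2 ^ p" for k :: int
    proof -
      have "k mod 2 ^ Suc p = 2 ^ p * (k div 2 ^ p mod 2) + k mod 2 ^ p"
        using zmod_zmult2_eq[of 2 k "2 ^ p"] by (simp add: mult.commute)
      then show ?thesis by (metis add_0 mult.right_neutral mult_zero_right not_mod_2_eq_0_eq_1)
    qed
    show ?thesis
      unfolding Q_def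
    proof (intro allI impI)
      fix n m i j assume n: "n \<ge> n0" and m: "m \<ge> n0" and i: "0 \<le> i" "i < 2 ^ n" and j: "0 \<le> j" "j < 2 ^ m"
        and eq: "i mod 2 ^ p = (j::int) mod 2 ^ p"
      have r: "0 \<le> i mod 2 ^ p" "i mod 2 ^ p < 2 ^ p" by simp_all
      consider "i mod 2 ^ Suc p = j mod 2 ^ Suc p"
        | "i mod 2 ^ Suc p = i mod 2 ^ p" "j mod 2 ^ Suc p = 2 ^ p + i mod 2 ^ p"
        | "j mod 2 ^ Suc p = i mod 2 ^ p" "i mod 2 ^ Suc p = 2 ^ p + i mod 2 ^ p"
        using split[of i] split[of j] unfolding eq by fastforce
      then show "E n i m j"
      proof cases
        case 1
        then show ?thesis using Q n m i j unfolding Q_def by blast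
      next
        case 2
        then show ?thesis using aux[OF n i m j _ _ r] by blast
      next
        case 3
        then show ?thesis using aux[OF m j n i _ _ r] sym by blast
      qed
    qed
  qed
  moreover have "Q p \<Longrightarrow> Q 0" for p
    by (induction p) (use \<open>\<And>p. Q (Suc p) \<Longrightarrow> Q p\<close> in blast)+
  ultimately have "Q 0" by blast
  then show ?thesis using n m unfolding Q_def by simp
qed

section \<open>Powers of 2 with sum 1, and functions that reproduce themselves on both
  halves\<close>

lemma of_int_add_1_le_power: "of_int i + 1 \<le> (2::real) ^ n \<longleftrightarrow> i < 2 ^ n"
proof -
  have "of_int i + 1 \<le> (2::real) ^ n \<longleftrightarrow> of_int (i + 1) \<le> (of_int (2 ^ n) :: real)" by simp
  then show ?thesis unfolding of_int_le_iff by linarith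
qed

text \<open>Each exponent is negative since the other summand is positive; so both summands are at
  most \<open>1/2\<close>, and the sum 1 leaves no slack.\<close>

lemma powi_add_eq_1:
  assumes "2 powi k + 2 powi l = (1::real)"
  shows "k = -1 \<and> l = (-1::int)"
proof -
  have pos: "2 powi k > (0::real)" "2 powi l > (0::real)" by simp_all
  have "1 \<le> (2::real) powi e" if "e \<ge> 0" for e :: int
    using power_int_increasing[OF that, of "2::real"] by simp
  then have "\<not> k \<ge> 0" "\<not> l \<ge> 0"
    using pos assms by (smt (verit))+
  then have "k \<le> -1" "l \<le> -1" by simp_all
  then have le: "2 powi k \<le> (2::real) powi -1" "2 powi l \<le> (2::real) powi -1"
    by (intro power_int_increasing; simp)+
  then have eq: "2 powi k = (2::real) powi -1" "2 powi l = (2::real) powi -1"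
    using assms by (simp_all add: power_int_minus)
  have "e = -1" if "e \<le> -1" "2 powi e = (2::real) powi -1" for e :: int
    using that power_int_strict_increasing[of e "-1" "2::real"] by (cases "e = -1") auto
  then show ?thesis using eq \<open>k \<le> -1\<close> \<open>l \<le> -1\<close> by blast
qed

text \<open>The two functional equations determine the values at dyadic points level by level;
  monotonicity extends the formula to all points.\<close>

lemma affine_of_halves:
  fixes F :: "real \<Rightarrow> real"
  assumes mono: "\<And>s t. 0 \<le> s \<Longrightarrow> s < t \<Longrightarrow> t \<le> 1 \<Longrightarrow> F s < F t"
    and left: "\<And>s. 0 \<le> s \<Longrightarrow> s \<le> 1 \<Longrightarrow> F (s / 2) = F 0 + (F s - F 0) / 2"
    and right: "\<And>s. 0 \<le> s \<Longrightarrow> s \<le> 1 \<Longrightarrow> F ((1 + s) / 2) = (F 0 + F 1) / 2 + (F s - F 0) / 2"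
    and s: "0 \<le> s" "s \<le> 1"
  shows "F s = F 0 + (F 1 - F 0) * s"
proof -
  define T where "T = F 1 - F 0"
  have T: "T > 0" using mono[of 0 1] by (simp add: T_def)
  have dy: "F (of_int j / 2 ^ m) = F 0 + T * (of_int j / 2 ^ m)" if "0 \<le> j" "j \<le> 2 ^ m" for j m
    using that
  proof (induction m arbitrary: j)
    case 0
    then have "j = 0 \<or> j = 1" by auto
    then show ?case by (auto simp: T_def)
  next
    case (Suc m)
    show ?case
    proof (cases "j \<le> 2 ^ m")
      case True
      define s :: real where "s = of_int j / 2 ^ m"
      have s: "0 \<le> s" "s \<le> 1" "of_int j / 2 ^ Suc m = s / 2"
        using Suc.prems True by (simp_all add: s_def)
      have "F s = F 0 + T * s" unfolding s_def by (rule Suc.IH[OF Suc.prems(1) True])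
      then show ?thesis unfolding s(3) using left[OF s(1,2)] by (simp add: algebra_simps)
    next
      case False
      define s :: real where "s = of_int (j - 2 ^ m) / 2 ^ m"
      have "(of_int j :: real) \<le> of_int (2 * 2 ^ m)" using Suc.prems(2) by (simp only: of_int_le_iff power_Suc)
      then have "of_int j \<le> (2 * 2 ^ m :: real)" by simp
      then have s: "0 \<le> s" "s \<le> 1" "of_int j / 2 ^ Suc m = (1 + s) / 2"
        using False by (simp_all add: s_def field_simps)
      have "F s = F 0 + T * s" unfolding s_def using Suc.prems False by (intro Suc.IH) auto
      then show ?thesis unfolding s(3) using right[OF s(1,2)] by (simp add: T_def field_simps)
    qed
  qed
  have dy': "F u = F 0 + T * u" if u01: "u \<in> dyadics" "0 \<le> u" "u \<le> 1" for u
  proof -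
    obtain m where "u * 2 ^ m \<in> \<int>" using u01(1) by (auto simp: dyadics_iff)
    then obtain j :: int where "u * 2 ^ m = of_int j" by (auto elim: Ints_cases)
    then have u: "u = of_int j / 2 ^ m" by (simp add: field_simps)
    have "0 \<le> u * 2 ^ m" using u01(2) by simp
    then have "0 \<le> j" by (simp add: u)
    moreover have "of_int j \<le> (2 ^ m :: real)" using u01(3) by (simp add: u)
    then have "j \<le> 2 ^ m" by (metis of_int_le_iff of_int_numeral of_int_power)
    ultimately show ?thesis unfolding u by (rule dy)
  qed
  have bnd: "F 0 \<le> F s" "F s \<le> F 1"
    using mono[of 0 s] mono[of s 1] s by (cases "s = 0"; cases "s = 1"; force)+
  \<comment> \<open>\<open>w\<close> is the point where the affine function takes the value
    \<open>F s\<close>. A dyadic point strictly between \<open>w\<close> and \<open>s\<close> would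
    have its known value on the wrong side of \<open>F s\<close>.\<close>
  define w where "w = (F s - F 0) / T"
  have w: "0 \<le> w" "w \<le> 1" "F s = F 0 + T * w"
    using bnd T by (auto simp: w_def T_def)
  have "w = s"
  proof (rule ccontr)
    assume "w \<noteq> s"
    then consider "w < s" | "s < w" by linarith
    then show False
    proof cases
      case 1
      then obtain u where u: "u \<in> dyadics" "w < u" "u < s" using dyadics_dense by blast
      then have "F u < F s" using w(1) s by (intro mono) auto
      moreover have "F u = F 0 + T * u" using u w(1,2) s by (intro dy') auto
      ultimately show False using w(3) mult_strict_left_mono[OF u(2) T] by linarith
    next
      case 2
      then obtain u where u: "u \<in> dyadics" "s < u" "u < w" using dyadics_dense by blast
      then have "F s < F u" using w(2) s by (intro mono) auto
      moreover have "F u = F 0 + T * u" using u w(1,2) s by (intro dy') auto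
      ultimately show False using w(3) mult_strict_left_mono[OF u(3) T] by linarith
    qed
  qed
  then show ?thesis using w(3) by (simp add: T_def)
qed

text \<open>Stated pointwise and with an explicit inverse so that it fits a homeomorphism of the
  line, a lift of one of the circle, and an affine rescaling of \<open>\<kappa>\<close>
  itself.\<close>

locale pl2_conjugation =
  fixes \<kappa> \<eta> :: "real \<Rightarrow> real"
  assumes mono: "strict_mono \<kappa>" and \<kappa>\<eta> [simp]: "\<And>x. \<kappa> (\<eta> x) = x" and \<eta>\<kappa> [simp]: "\<And>x. \<eta> (\<kappa> x) = x"
    and cont: "\<And>x. isCont \<kappa> x"
    and pres_\<kappa>: "\<And>f x. pl2_at f x \<Longrightarrow> pl2_at (\<kappa> \<circ> f \<circ> \<eta>) (\<kappa> x)"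
    and pres_\<eta>: "\<And>f x. pl2_at f x \<Longrightarrow> pl2_at (\<eta> \<circ> f \<circ> \<kappa>) (\<eta> x)"
begin

lemma less_iff: "\<kappa> s < \<kappa> t \<longleftrightarrow> s < t"
  using mono by (rule strict_mono_less)

lemma \<eta>_less_iff: "\<eta> s < \<eta> t \<longleftrightarrow> s < t"
  using less_iff[of "\<eta> s" "\<eta> t"] by simp

lemma \<eta>_le_iff: "\<eta> s \<le> \<eta> t \<longleftrightarrow> s \<le> t"
  using \<eta>_less_iff[of t s] by (simp flip: not_less)

end

text \<open>A germ that is the identity on one side and not on the other lives at a dyadic point.\<close>

lemma conjugation_dyadics:
  assumes mono: "\<And>s t. \<kappa> s < \<kappa> t \<longleftrightarrow> s < t" and inv: "\<And>x. \<kappa> (\<eta> x) = x" "\<And>x. \<eta> (\<kappa> x) = x"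
    and pres: "\<And>f x. pl2_at f x \<Longrightarrow> pl2_at (\<kappa> \<circ> f \<circ> \<eta>) (\<kappa> x)"
    and x: "x \<in> dyadics"
  shows "\<kappa> x \<in> dyadics"
proof (rule ccontr)
  assume no: "\<kappa> x \<notin> dyadics"
  \<comment> \<open>Identity on the left, slope 2 on the right. The conjugate is also the identity
    on the left; at a non-dyadic \<open>\<kappa> x\<close> its two formulas agree, so it would be
    the identity on the right too.\<close>
  define f where "f t = (if t \<le> x then x + 2 powi (0::int) * (t - x) else x + 2 powi (1::int) * (t - x))" for t
  have "pl2_at f x" unfolding f_def by (rule pl2_at_two_sided[OF x x])
  from pres[OF this] obtain k l :: int and c d where "c \<in> dyadics" "d \<in> dyadics"
    and g1: "(\<kappa> \<circ> f \<circ> \<eta>) (\<kappa> x) = 2 powi k * \<kappa> x + c" and "(\<kappa> \<circ> f \<circ> \<eta>) (\<kappa> x) = 2 powi l * \<kappa> x + d"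
    and g2: "\<forall>\<^sub>F t in at_left (\<kappa> x). (\<kappa> \<circ> f \<circ> \<eta>) t = 2 powi k * t + c"
    and g3: "\<forall>\<^sub>F t in at_right (\<kappa> x). (\<kappa> \<circ> f \<circ> \<eta>) t = 2 powi l * t + d"
    and kl: "\<kappa> x \<notin> dyadics \<Longrightarrow> k = l \<and> c = d" by (rule pl2_atE) blast
  have ord: "\<eta> s < x \<longleftrightarrow> s < \<kappa> x" "x < \<eta> s \<longleftrightarrow> \<kappa> x < s" for s
    using mono[of "\<eta> s" x] mono[of x "\<eta> s"] inv by simp_all
  have id: "(\<kappa> \<circ> f \<circ> \<eta>) t = t" if "t \<le> \<kappa> x" for t
    using that ord(2)[of t] by (simp add: f_def inv)
  have "\<forall>\<^sub>F t in at_left (\<kappa> x). t < \<kappa> x" by (simp add: eventually_at_filter)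
  with g2 have "\<forall>\<^sub>F t in at_left (\<kappa> x). t < \<kappa> x \<and> (\<kappa> \<circ> f \<circ> \<eta>) t = 2 powi k * t + c"
    by eventually_elim simp
  then obtain t where "t < \<kappa> x" "(\<kappa> \<circ> f \<circ> \<eta>) t = 2 powi k * t + c"
    using eventually_happens'[OF trivial_limit_at_left_real] by blast
  then have t: "t < \<kappa> x" "t = 2 powi k * t + c" "\<kappa> x = 2 powi k * \<kappa> x + c"
    using id[of t] id[of "\<kappa> x"] g1 by simp_all
  then have "(\<kappa> x - t) * (2 powi k - 1) = 0" by (simp add: algebra_simps)
  then have kc: "2 powi k = (1::real)" "c = 0" using t by auto
  have "\<forall>\<^sub>F t in at_right (\<kappa> x). \<kappa> x < t" by (simp add: eventually_at_filter)
  with g3 have "\<forall>\<^sub>F t in at_right (\<kappa> x). \<kappa> x < t \<and> (\<kappa> \<circ> f \<circ> \<eta>) t = t"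
    by eventually_elim (use kl[OF no] kc in simp)
  then obtain s where s: "\<kappa> x < s" "\<kappa> (f (\<eta> s)) = s"
    using eventually_happens'[OF trivial_limit_at_right_real] by fastforce
  then have "x < \<eta> s" using ord by simp
  then have "\<eta> s < f (\<eta> s)" by (simp add: f_def)
  then have "\<kappa> (\<eta> s) < \<kappa> (f (\<eta> s))" by (simp only: mono)
  then show False using s inv by simp
qed

section \<open>Classes of dyadic intervals on which \<open>\<kappa>\<close> has the same
  shape\<close>

context pl2_conjugation
begin

lemma \<kappa>_dyadics: "x \<in> dyadics \<Longrightarrow> \<kappa> x \<in> dyadics"
  by (rule conjugation_dyadics[OF less_iff \<kappa>\<eta> \<eta>\<kappa> pres_\<kappa>])

lemma \<eta>_dyadics: "x \<in> dyadics \<Longrightarrow> \<eta> x \<in> dyadics"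
  by (rule conjugation_dyadics[OF \<eta>_less_iff \<eta>\<kappa> \<kappa>\<eta> pres_\<eta>])

text \<open>The constant \<open>q\<close> may be any real number, but the slope has to be a power of
  2: the sum of two such slopes finally determines \<open>\<kappa>\<close>.\<close>

definition same_shape :: "nat \<Rightarrow> int \<Rightarrow> nat \<Rightarrow> int \<Rightarrow> bool" where
  "same_shape n i m j \<longleftrightarrow> (\<exists>(k::int) q. \<forall>s. 0 \<le> s \<longrightarrow> s \<le> 1 \<longrightarrow>
     \<kappa> ((of_int j + s) / 2 ^ m) = 2 powi k * \<kappa> ((of_int i + s) / 2 ^ n) + q)"

lemma same_shape_refl: "same_shape n i n i"
  unfolding same_shape_def by (rule exI[of _ 0], rule exI[of _ 0]) simp

lemma same_shape_sym: assumes "same_shape n i m j" shows "same_shape m j n i"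
proof -
  obtain k :: int and q where *: "\<And>s. 0 \<le> s \<Longrightarrow> s \<le> 1 \<Longrightarrow>
     \<kappa> ((of_int j + s) / 2 ^ m) = 2 powi k * \<kappa> ((of_int i + s) / 2 ^ n) + q"
    using assms unfolding same_shape_def by blast
  have "\<kappa> ((of_int i + s) / 2 ^ n) = 2 powi (- k) * \<kappa> ((of_int j + s) / 2 ^ m) + - (q / 2 powi k)"
    if "0 \<le> s" "s \<le> 1" for s
    unfolding *[OF that] by (simp add: power_int_minus field_simps)
  then show ?thesis unfolding same_shape_def by blast
qed

lemma same_shape_trans: assumes "same_shape n i m j" "same_shape m j p l" shows "same_shape n i p l"
proof -
  obtain k :: int and q where *: "\<And>s. 0 \<le> s \<Longrightarrow> s \<le> 1 \<Longrightarrow>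
     \<kappa> ((of_int j + s) / 2 ^ m) = 2 powi k * \<kappa> ((of_int i + s) / 2 ^ n) + q"
    using assms(1) unfolding same_shape_def by blast
  obtain k' :: int and q' where **: "\<And>s. 0 \<le> s \<Longrightarrow> s \<le> 1 \<Longrightarrow>
     \<kappa> ((of_int l + s) / 2 ^ p) = 2 powi k' * \<kappa> ((of_int j + s) / 2 ^ m) + q'"
    using assms(2) unfolding same_shape_def by blast
  have "\<kappa> ((of_int l + s) / 2 ^ p) = 2 powi (k' + k) * \<kappa> ((of_int i + s) / 2 ^ n) + (2 powi k' * q + q')"
    if "0 \<le> s" "s \<le> 1" for s
    unfolding **[OF that] *[OF that] by (simp add: power_int_add algebra_simps)
  then show ?thesis unfolding same_shape_def by blast
qed

text \<open>The affine relation between two intervals restricts to the pieces at the same position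
  \<open>r\<close> after \<open>p\<close> halvings.\<close>

lemma same_shape_sub:
  assumes "same_shape n i m j" "0 \<le> r" "r < 2 ^ p"
  shows "same_shape (n + p) (2 ^ p * i + r) (m + p) (2 ^ p * j + r)"
proof -
  obtain k :: int and q where *: "\<And>s. 0 \<le> s \<Longrightarrow> s \<le> 1 \<Longrightarrow>
     \<kappa> ((of_int j + s) / 2 ^ m) = 2 powi k * \<kappa> ((of_int i + s) / 2 ^ n) + q"
    using assms(1) unfolding same_shape_def by blast
  have "\<kappa> ((of_int (2 ^ p * j + r) + s) / 2 ^ (m + p)) =
      2 powi k * \<kappa> ((of_int (2 ^ p * i + r) + s) / 2 ^ (n + p)) + q" if s: "0 \<le> s" "s \<le> 1" for s
  proof -
    have "of_int r + 1 \<le> (2 ^ p :: real)" using assms(3) by (simp add: of_int_add_1_le_power)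
    then have "0 \<le> (of_int r + s) / 2 ^ p" "(of_int r + s) / 2 ^ p \<le> 1"
      using assms(2) s by (simp_all add: divide_nonneg_pos)
    from *[OF this] have "\<kappa> ((of_int j + (of_int r + s) / 2 ^ p) / 2 ^ m) =
        2 powi k * \<kappa> ((of_int i + (of_int r + s) / 2 ^ p) / 2 ^ n) + q" .
    moreover have "(of_int l + (of_int r + s) / 2 ^ p) / 2 ^ e = (of_int (2 ^ p * l + r) + s) / (2::real) ^ (e + p)" for l e
      by (simp add: power_add field_simps)
    ultimately show ?thesis by simp
  qed
  then show ?thesis unfolding same_shape_def by blast
qed

text \<open>For \<open>e\<close> equal to 0 or 1, \<open>f\<close> prepends the digit
  \<open>e\<close> to an address. The conjugate \<open>\<kappa> \<circ> f \<circ> \<eta>\<close> is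
  piecewise linear, so on short intervals \<open>\<kappa> \<circ> f\<close> is an affine function of
  \<open>\<kappa>\<close>; compactness of the unit interval makes \<open>N\<close> uniform.\<close>

lemma same_shape_drop:
  "\<exists>N. \<forall>n\<ge>N. \<forall>i. 0 \<le> i \<longrightarrow> i < 2 ^ n \<longrightarrow> same_shape n i (Suc n) (i + e * 2 ^ n)"
proof -
  define f where "f t = 2 powi (-1::int) * t + of_int e / 2" for t :: real
  have f: "pl2_at f t" for t unfolding f_def by (rule pl2_at_affine) simp
  have "\<exists>N. \<forall>n\<ge>N. \<forall>i. 0 \<le> of_int i / (2::real) ^ n \<longrightarrow> (of_int i + 1) / 2 ^ n \<le> (1::real) \<longrightarrow>
      (\<exists>(k::int) q. \<forall>t\<in>{of_int i / 2 ^ n..(of_int i + 1) / 2 ^ n}. \<kappa> (f t) = 2 powi k * \<kappa> t + q)"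
  proof (rule dyadic_intervals_compact)
    fix y :: real
    from pl2_at_dyadic_intervals[OF pres_\<kappa>[OF f] mono cont, of y] \<eta>_dyadics[of "\<kappa> y"]
    show "\<exists>\<delta>>0. \<exists>N. \<forall>n\<ge>N. \<forall>i. y - \<delta> < of_int i / 2 ^ n \<longrightarrow> (of_int i + 1) / 2 ^ n < y + \<delta> \<longrightarrow>
      (\<exists>(k::int) q. \<forall>t\<in>{of_int i / 2 ^ n..(of_int i + 1) / 2 ^ n}. \<kappa> (f t) = 2 powi k * \<kappa> t + q)"
      unfolding o_apply \<eta>\<kappa> by meson
  qed
  then obtain N where N: "\<And>n i. n \<ge> N \<Longrightarrow> 0 \<le> of_int i / (2::real) ^ n \<Longrightarrow> (of_int i + 1) / 2 ^ n \<le> (1::real) \<Longrightarrow>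
      \<exists>(k::int) q. \<forall>t\<in>{of_int i / 2 ^ n..(of_int i + 1) / 2 ^ n}. \<kappa> (f t) = 2 powi k * \<kappa> t + q"
    by blast
  have "same_shape n i (Suc n) (i + e * 2 ^ n)" if n: "n \<ge> N" and i: "0 \<le> i" "i < 2 ^ n" for n i
  proof -
    have "of_int i + 1 \<le> (2 ^ n :: real)" using i by (simp add: of_int_add_1_le_power)
    then obtain k :: int and q where *: "\<forall>t\<in>{of_int i / 2 ^ n..(of_int i + 1) / 2 ^ n}. \<kappa> (f t) = 2 powi k * \<kappa> t + q"
      using N[OF n, of i] i by auto
    have "\<kappa> ((of_int (i + e * 2 ^ n) + s) / 2 ^ Suc n) = 2 powi k * \<kappa> ((of_int i + s) / 2 ^ n) + q"
      if "0 \<le> s" "s \<le> 1" for s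
    proof -
      have "(of_int (i + e * 2 ^ n) + s) / 2 ^ Suc n = f ((of_int i + s) / 2 ^ n)"
        by (simp add: f_def power_int_minus field_simps)
      then show ?thesis using * that by (simp add: divide_right_mono)
    qed
    then show ?thesis unfolding same_shape_def by blast
  qed
  then show ?thesis by blast
qed

text \<open>\<open>f\<close> is the pull-back of the translation by \<open>- \<epsilon>\<close>.
  Since \<open>\<kappa> (f t) = \<kappa> t - \<epsilon>\<close>, any standard interval that
  \<open>f\<close> carries affinely onto another has the same shape as its image, with slope 1;
  \<open>parity_mismatch\<close> supplies one whose index changes parity.\<close>

lemma same_shape_mismatch:
  "\<exists>a u b v. a \<ge> n0 \<and> b \<ge> n0 \<and> 0 \<le> u \<and> u < 2 ^ a \<and> 0 \<le> v \<and> v < 2 ^ b \<and>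
     same_shape a u b v \<and> even u \<noteq> even v"
proof -
  \<comment> \<open>Intervals shorter than \<open>\<delta>\<close> have level at least
    \<open>n0\<close>. The summand 2 gives \<open>\<delta> \<le> 1 / 4\<close>, which keeps the
    intervals and their images inside the unit interval.\<close>
  define \<delta> :: real where "\<delta> = 1 / 2 ^ (n0 + 2)"
  have "(2::real) ^ 2 \<le> 2 ^ (n0 + 2)" by (intro power_increasing) auto
  then have \<delta>: "0 < \<delta>" "\<delta> \<le> 1 / 4" by (simp_all add: \<delta>_def field_simps)
  have "\<kappa> (1/2) < \<kappa> (1/2 + \<delta>)" "\<kappa> (1/2 - \<delta>) < \<kappa> (1/2)" using \<delta> by (simp_all add: less_iff)
  then obtain \<epsilon> where \<epsilon>: "\<epsilon> \<in> dyadics" "0 < \<epsilon>" "\<epsilon> < min (\<kappa> (1/2 + \<delta>) - \<kappa> (1/2)) (\<kappa> (1/2) - \<kappa> (1/2 - \<delta>))"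
    using dyadics_dense[of 0 "min (\<kappa> (1/2 + \<delta>) - \<kappa> (1/2)) (\<kappa> (1/2) - \<kappa> (1/2 - \<delta>))"] by auto
  define f where "f = \<eta> \<circ> (\<lambda>t. 2 powi (0::int) * t + - \<epsilon>) \<circ> \<kappa>"
  have f: "f t = \<eta> (\<kappa> t - \<epsilon>)" for t by (simp add: f_def)
  have pl: "pl2_at f t" for t
    using pres_\<eta>[OF pl2_at_affine[of "- \<epsilon>" 0], of "\<kappa> t"] \<epsilon>(1) unfolding f_def by simp
  \<comment> \<open>\<open>y\<close> is the point that \<open>f\<close> moves to \<open>1/2\<close>.
    It is dyadic because the pull-back of the translation by \<open>\<epsilon>\<close> carries
    \<open>1/2\<close> to it.\<close>
  define y where "y = \<eta> (\<kappa> (1/2) + \<epsilon>)"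
  have "pl2_at (\<eta> \<circ> (\<lambda>t. 2 powi (0::int) * t + \<epsilon>) \<circ> \<kappa>) (1/2)"
    using pres_\<eta>[OF pl2_at_affine[of \<epsilon> 0], of "\<kappa> (1/2)"] \<epsilon>(1) by simp
  from pl2_at_dyadics[OF this] have "y \<in> dyadics" by (simp add: y_def)
  then obtain N1 where N1: "y * 2 ^ N1 \<in> \<int>" by (auto simp: dyadics_iff)
  have "1/2 < y"
    using \<eta>_less_iff[of "\<kappa> (1/2)" "\<kappa> (1/2) + \<epsilon>"] \<epsilon>(2) by (simp add: y_def)
  have ylt: "y < 1/2 + \<delta>"
    using \<eta>_less_iff[of "\<kappa> (1/2) + \<epsilon>" "\<kappa> (1/2 + \<delta>)"] \<epsilon>(3) by (simp add: y_def)
  have fgt: "1/2 - \<delta> < f (1/2)"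
    using \<eta>_less_iff[of "\<kappa> (1/2 - \<delta>)" "\<kappa> (1/2) - \<epsilon>"] \<epsilon>(3) by (simp add: f)
  have fy: "f y = 1/2" by (simp add: f y_def)
  have fmono: "f s \<le> f t" if "s \<le> t" for s t
    using that less_iff[of t s] by (simp add: f \<eta>_le_iff)
  obtain N2 where N2: "\<And>n i. n \<ge> N2 \<Longrightarrow> 1/2 \<le> of_int i / (2::real) ^ n \<Longrightarrow> (of_int i + 1) / 2 ^ n \<le> y \<Longrightarrow>
      \<exists>m j. interval_map f n i m j"
    using pl2_interval_maps[OF pl, of "1/2" y] by blast
  have "\<exists>n i m j. 1/2 \<le> of_int i / (2::real) ^ n \<and> (of_int i + 1) / 2 ^ n \<le> y \<and> interval_map f n i m j \<and> even i \<noteq> even j"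
  proof (rule ccontr)
    assume no: "\<not> ?thesis"
    show False
    proof (rule parity_mismatch[of y f "max N1 N2"])
      show "y * 2 ^ max N1 N2 \<in> \<int>" by (rule dyadics_scale[OF N1]) simp
      show "y < 1" "0 < f (1/2)" using ylt fgt \<delta> by simp_all
    qed (use fmono \<open>1/2 < y\<close> fy N2 no in auto)
  qed
  then obtain n i m j where nij: "1/2 \<le> of_int i / (2::real) ^ n" "(of_int i + 1) / 2 ^ n \<le> y"
    "interval_map f n i m j" "even i \<noteq> even j" by blast
  have ends: "f (of_int i / 2 ^ n) = of_int j / 2 ^ m" "f ((of_int i + 1) / 2 ^ n) = (of_int j + 1) / 2 ^ m"
    using nij(3)[unfolded interval_map_def, rule_format, of 0] nij(3)[unfolded interval_map_def, rule_format, of 1] by simp_all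
  have j: "1/2 - \<delta> < of_int j / (2::real) ^ m" "(of_int j + 1) / 2 ^ m \<le> (1/2::real)"
    using fmono[OF nij(1)] fmono[OF nij(2)] fgt fy unfolding ends by linarith+
  have level: "e \<ge> n0" if "(1::real) / 2 ^ e < \<delta>" for e
  proof (rule ccontr)
    assume "\<not> e \<ge> n0"
    then have "(2::real) ^ e \<le> 2 ^ (n0 + 2)" by (intro power_increasing) auto
    then show False using that by (simp add: \<delta>_def field_simps)
  qed
  have range: "0 \<le> l \<and> l < 2 ^ e" if "0 \<le> of_int l / (2::real) ^ e" "(of_int l + 1) / 2 ^ e \<le> (1::real)" for l :: int and e
  proof -
    have "of_int l + 1 \<le> (2::real) ^ e" using that(2) by simp
    then have "l < 2 ^ e" by (simp add: of_int_add_1_le_power)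
    moreover have "0 \<le> of_int l / (2::real) ^ e * 2 ^ e" using that(1) by (intro mult_nonneg_nonneg) auto
    ultimately show ?thesis by simp
  qed
  have "n \<ge> n0" "m \<ge> n0"
    using nij(1,2) j ylt by (intro level; simp only: add_divide_distrib; linarith)+
  moreover have "0 \<le> i \<and> i < 2 ^ n" "0 \<le> j \<and> j < 2 ^ m"
    using nij(1,2) j ylt \<delta> by (intro range; linarith)+
  moreover have "same_shape n i m j"
    unfolding same_shape_def
  proof (intro exI[of _ "0::int"] exI[of _ "- \<epsilon>"] allI impI)
    fix s :: real assume "0 \<le> s" "s \<le> 1"
    then have "(of_int j + s) / 2 ^ m = f ((of_int i + s) / 2 ^ n)"
      using nij(3) by (simp add: interval_map_def)
    then show "\<kappa> ((of_int j + s) / 2 ^ m) = 2 powi (0::int) * \<kappa> ((of_int i + s) / 2 ^ n) + - \<epsilon>"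
      by (simp add: f)
  qed
  ultimately show ?thesis using nij(4) by blast
qed

lemma same_shape_all:
  "\<exists>N. \<forall>n m i j. n \<ge> N \<longrightarrow> m \<ge> N \<longrightarrow> 0 \<le> i \<longrightarrow> i < 2 ^ n \<longrightarrow> 0 \<le> j \<longrightarrow> j < 2 ^ m \<longrightarrow> same_shape n i m j"
proof -
  obtain N1 where N1: "\<And>n i. n \<ge> N1 \<Longrightarrow> 0 \<le> i \<Longrightarrow> i < 2 ^ n \<Longrightarrow> same_shape n i (Suc n) i"
    using same_shape_drop[of 0] by auto
  obtain N2 where N2: "\<And>n i. n \<ge> N2 \<Longrightarrow> 0 \<le> i \<Longrightarrow> i < 2 ^ n \<Longrightarrow> same_shape n i (Suc n) (i + 2 ^ n)"
    using same_shape_drop[of 1] by auto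
  define N where "N = max N1 N2"
  obtain a u b v where "a \<ge> N" "b \<ge> N" "0 \<le> u" "u < 2 ^ a" "0 \<le> v" "v < 2 ^ b" "same_shape a u b v" "even u \<noteq> even v"
    using same_shape_mismatch[of N] by blast
  then obtain a u b v where mis: "a \<ge> N" "b \<ge> N" "0 \<le> u" "u < 2 ^ a" "0 \<le> v" "v < 2 ^ b" "same_shape a u b v" "even u" "odd v"
    using same_shape_sym by (cases "even u") blast+
  have "same_shape n i m j" if "n \<ge> N" "0 \<le> i" "i < 2 ^ n" "m \<ge> N" "0 \<le> j" "j < 2 ^ m" for n m i j
  proof (rule all_equivalent[where E = same_shape, OF same_shape_refl same_shape_sym same_shape_trans _ same_shape_sub mis that])
    show "same_shape n i (Suc n) i \<and> same_shape n i (Suc n) (i + 2 ^ n)" if "N \<le> n" "0 \<le> i" "i < 2 ^ n" for n i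
      using that N1 N2 by (simp add: N_def)
  qed
  then show ?thesis by blast
qed

text \<open>Comparison with both halves makes \<open>\<kappa>\<close> affine on an interval of level
  \<open>N\<close>. Its slope \<open>\<sigma>\<close> is dyadic because the images of the endpoints
  are, and \<open>1 / \<sigma>\<close> is dyadic because \<open>\<eta>\<close> preserves the dyadics
  too; so \<open>\<sigma>\<close> is a power of 2.\<close>

lemma affine_on_intervals:
  "\<exists>N. \<forall>i. 0 \<le> i \<longrightarrow> i < 2 ^ N \<longrightarrow> (\<exists>k::int. \<exists>c\<in>dyadics.
     \<forall>t\<in>{of_int i / 2 ^ N..(of_int i + 1) / 2 ^ N}. \<kappa> t = 2 powi k * t + c)"
proof -
  obtain N where N: "\<And>n m i j. n \<ge> N \<Longrightarrow> m \<ge> N \<Longrightarrow> 0 \<le> i \<Longrightarrow> i < 2 ^ n \<Longrightarrow> 0 \<le> j \<Longrightarrow> j < 2 ^ m \<Longrightarrow> same_shape n i m j"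
    using same_shape_all by blast
  have "\<exists>k::int. \<exists>c\<in>dyadics. \<forall>t\<in>{of_int i / 2 ^ N..(of_int i + 1) / 2 ^ N}. \<kappa> t = 2 powi k * t + c"
    if i: "0 \<le> i" "i < 2 ^ N" for i
  proof -
    define F where "F s = \<kappa> ((of_int i + s) / 2 ^ N)" for s
    have Fmono: "F s < F t" if "s < t" for s t
      using that by (simp add: F_def less_iff divide_strict_right_mono)
    obtain k1 :: int and q1 where "\<And>s. 0 \<le> s \<Longrightarrow> s \<le> 1 \<Longrightarrow>
        \<kappa> ((of_int (2 * i) + s) / 2 ^ Suc N) = 2 powi k1 * \<kappa> ((of_int i + s) / 2 ^ N) + q1"
      using N[of N "Suc N" i "2 * i"] i unfolding same_shape_def by auto
    moreover have "(of_int (2 * i) + s) / 2 ^ Suc N = (of_int i + s / 2) / (2::real) ^ N" for s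
      by (simp add: field_simps)
    ultimately have F1: "F (s / 2) = 2 powi k1 * F s + q1" if "0 \<le> s" "s \<le> 1" for s
      using that unfolding F_def by simp
    obtain k2 :: int and q2 where "\<And>s. 0 \<le> s \<Longrightarrow> s \<le> 1 \<Longrightarrow>
        \<kappa> ((of_int (2 * i + 1) + s) / 2 ^ Suc N) = 2 powi k2 * \<kappa> ((of_int i + s) / 2 ^ N) + q2"
      using N[of N "Suc N" i "2 * i + 1"] i unfolding same_shape_def by auto
    moreover have "(of_int (2 * i + 1) + s) / 2 ^ Suc N = (of_int i + (1 + s) / 2) / (2::real) ^ N" for s
      by (simp add: field_simps)
    ultimately have F2: "F ((1 + s) / 2) = 2 powi k2 * F s + q2" if "0 \<le> s" "s \<le> 1" for s
      using that unfolding F_def by simp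
    define T where "T = F 1 - F 0"
    have T: "T > 0" using Fmono[of 0 1] by (simp add: T_def)
    have e: "F 0 = 2 powi k1 * F 0 + q1" "F (1/2) = 2 powi k1 * F 1 + q1"
      "F (1/2) = 2 powi k2 * F 0 + q2" "F 1 = 2 powi k2 * F 1 + q2"
      using F1[of 0] F1[of 1] F2[of 0] F2[of 1] by simp_all
    \<comment> \<open>The images of the halves have lengths \<open>2 powi k1 * T\<close> and
      \<open>2 powi k2 * T\<close>, and together they make up the image of the interval.\<close>
    have "(2 powi k1 + 2 powi k2) * T = 1 * T"
      using e unfolding T_def by (simp add: algebra_simps)
    then have "2 powi k1 + 2 powi k2 = (1::real)" using T by simp
    then have k: "k1 = -1" "k2 = -1" using powi_add_eq_1 by blast+
    have half: "2 powi k1 = (1/2::real)" "2 powi k2 = (1/2::real)" by (simp_all add: k power_int_minus)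
    have aff: "F s = F 0 + T * s" if "0 \<le> s" "s \<le> 1" for s
      unfolding T_def
    proof (rule affine_of_halves[OF _ _ _ that])
      show "F (s / 2) = F 0 + (F s - F 0) / 2" if "0 \<le> s" "s \<le> 1" for s
        using F1[OF that] e(1) unfolding half by (simp add: field_simps)
      show "F ((1 + s) / 2) = (F 0 + F 1) / 2 + (F s - F 0) / 2" if "0 \<le> s" "s \<le> 1" for s
        using F2[OF that] e(4) unfolding half by (simp add: field_simps)
    qed (use Fmono in auto)
    define \<sigma> where "\<sigma> = T * 2 ^ N"
    define c where "c = F 0 - \<sigma> * (of_int i / 2 ^ N)"
    have \<kappa>: "\<kappa> t = \<sigma> * t + c" if "t \<in> {of_int i / 2 ^ N..(of_int i + 1) / 2 ^ N}" for t
    proof -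
      define s where "s = t * 2 ^ N - of_int i"
      have s: "0 \<le> s" "s \<le> 1" "t = (of_int i + s) / 2 ^ N" using that by (auto simp: s_def field_simps)
      have "\<kappa> t = F s" unfolding F_def s(3) ..
      also have "\<dots> = F 0 + T * s" by (rule aff[OF s(1,2)])
      finally show ?thesis by (simp add: \<sigma>_def c_def s_def algebra_simps)
    qed
    have F_dy: "F 0 \<in> dyadics" "F 1 \<in> dyadics"
      unfolding F_def by (intro \<kappa>_dyadics dyadics_divide_power; metis dyadics_of_int of_int_add of_int_0 of_int_1)+
    then have \<sigma>_dy: "\<sigma> \<in> dyadics" by (simp add: \<sigma>_def T_def)
    have \<sigma>_pos: "\<sigma> > 0" using T by (simp add: \<sigma>_def)
    have c_dy: "c \<in> dyadics" unfolding c_def using F_dy \<sigma>_dy by simp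
    have "1 / \<sigma> \<in> dyadics"
    proof -
      have "\<forall>\<^sub>F p in sequentially. (1/2::real) ^ p < T"
        using T by (intro order_tendstoD(2)[OF LIMSEQ_power_zero]) auto
      then obtain p where p: "(1/2::real) ^ p < T" by (auto simp: eventually_sequentially)
      \<comment> \<open>\<open>t\<close> is the preimage of the dyadic point
        \<open>F 0 + 1 / 2 ^ p\<close>, hence dyadic, and its distance to the left end of the
        interval is \<open>1 / \<sigma>\<close> divided by \<open>2 ^ p\<close>. The choice of
        \<open>p\<close> keeps it inside the interval.\<close>
      define t where "t = of_int i / 2 ^ N + (1 / 2 ^ p) / \<sigma>"
      have "(1 / 2 ^ p) / \<sigma> \<le> T / \<sigma>" using p \<sigma>_pos by (intro divide_right_mono) (simp_all add: power_one_over)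
      also have "T / \<sigma> = 1 / 2 ^ N" using T by (simp add: \<sigma>_def)
      finally have "t \<in> {of_int i / 2 ^ N..(of_int i + 1) / 2 ^ N}"
        using \<sigma>_pos by (simp add: t_def add_divide_distrib)
      then have "\<kappa> t = \<sigma> * t + c" by (rule \<kappa>)
      also have "\<dots> = F 0 + 1 / 2 ^ p" using \<sigma>_pos by (simp add: t_def c_def field_simps)
      finally have "\<kappa> t = F 0 + 1 / 2 ^ p" .
      then have "t = \<eta> (F 0 + 1 / 2 ^ p)" by (metis \<eta>\<kappa>)
      then have "t \<in> dyadics" using \<eta>_dyadics F_dy by simp
      then have "(t - of_int i / 2 ^ N) * 2 ^ p \<in> dyadics" by simp
      then show ?thesis by (simp add: t_def)
    qed
    from dyadic_unit[OF \<sigma>_dy this \<sigma>_pos] obtain k :: int where "\<sigma> = 2 powi k" by blast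
    then show ?thesis using \<kappa> c_dy by blast
  qed
  then show ?thesis by blast
qed

lemma pl2_at_unit:
  assumes "0 < y" "y < 1"
  shows "pl2_at \<kappa> y"
proof -
  obtain N where "\<And>i. 0 \<le> i \<Longrightarrow> i < 2 ^ N \<Longrightarrow> \<exists>k::int. \<exists>c\<in>dyadics.
     \<forall>t\<in>{of_int i / 2 ^ N..(of_int i + 1) / 2 ^ N}. \<kappa> t = 2 powi k * t + c"
    using affine_on_intervals by blast
  then obtain k :: "int \<Rightarrow> int" and c where kc: "\<And>i. 0 \<le> i \<Longrightarrow> i < 2 ^ N \<Longrightarrow> c i \<in> dyadics"
    "\<And>i t. 0 \<le> i \<Longrightarrow> i < 2 ^ N \<Longrightarrow> of_int i / 2 ^ N \<le> t \<Longrightarrow> t \<le> (of_int i + 1) / 2 ^ N \<Longrightarrow> \<kappa> t = 2 powi k i * t + c i"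
    by (metis atLeastAtMost_iff)
  \<comment> \<open>Interval \<open>i\<close> continues to the right of \<open>y\<close> and
    interval \<open>j\<close> reaches \<open>y\<close> from the left; they differ only if
    \<open>y\<close> is a grid point.\<close>
  define i where "i = \<lfloor>y * 2 ^ N\<rfloor>"
  define j where "j = \<lceil>y * 2 ^ N\<rceil> - 1"
  have y2: "0 < y * 2 ^ N" "y * 2 ^ N < 2 ^ N" using assms by simp_all
  have i: "of_int i \<le> y * 2 ^ N" "y * 2 ^ N < of_int i + 1" unfolding i_def by linarith+
  have j: "of_int j < y * 2 ^ N" "y * 2 ^ N \<le> of_int j + 1" unfolding j_def by linarith+
  have ir: "0 \<le> i" "i < 2 ^ N"
    using y2 unfolding i_def by (auto simp: floor_less_iff)
  have "of_int j < (2::real) ^ N" using j(1) y2(2) by linarith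
  then have jr: "0 \<le> j" "j < 2 ^ N"
    using y2(1) less_ceiling_iff[of 0 "y * 2 ^ N"] by (simp_all add: j_def[symmetric]) (simp add: j_def)
  have ib: "of_int i / 2 ^ N \<le> y" "y < (of_int i + 1) / 2 ^ N" using i by (simp_all add: field_simps)
  have jb: "of_int j / 2 ^ N < y" "y \<le> (of_int j + 1) / 2 ^ N" using j by (simp_all add: field_simps)
  show ?thesis
  proof (rule pl2_atI[where k = "k j" and c = "c j" and l = "k i" and d = "c i"])
    show "\<forall>\<^sub>F t in at_left y. \<kappa> t = 2 powi k j * t + c j"
      unfolding eventually_at_left_field
      using jb by (intro exI[of _ "of_int j / 2 ^ N"]) (auto intro!: kc(2)[OF jr])
    show "\<forall>\<^sub>F t in at_right y. \<kappa> t = 2 powi k i * t + c i"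
      unfolding eventually_at_right_field
      using ib by (intro exI[of _ "(of_int i + 1) / 2 ^ N"]) (auto intro!: kc(2)[OF ir])
    show "k j = k i \<and> c j = c i" if "y \<notin> dyadics"
    proof -
      have "y * 2 ^ N \<notin> \<int>" using that by (auto simp: dyadics_iff)
      then have "of_int i \<noteq> y * 2 ^ N" by (metis Ints_of_int)
      then have "i = j" using i j by linarith
      then show ?thesis by simp
    qed
    show "\<kappa> y = 2 powi k j * y + c j" using kc(2)[OF jr] jb by simp
    show "\<kappa> y = 2 powi k i * y + c i" using kc(2)[OF ir] ib by simp
  qed (use kc(1) ir jr in auto)
qed

end

text \<open>The result on the open unit interval is applied to \<open>\<kappa> \<circ> A\<close> for
  a dyadic affine map \<open>A\<close> whose image of that interval contains \<open>y\<close>.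
  Conjugation by \<open>A\<close> preserves dyadic germs, so the locale hypotheses carry
  over.\<close>

lemma (in pl2_conjugation) pl2_at_everywhere: "pl2_at \<kappa> y"
proof -
  obtain K :: nat where K: "\<bar>y\<bar> < 2 ^ K" using real_arch_pow[of 2 "\<bar>y\<bar>"] by auto
  \<comment> \<open>\<open>A\<close> maps \<open>(0, 1)\<close> onto
    \<open>(- 2 ^ K, 2 ^ K)\<close>, an interval of length \<open>2 powi e\<close>, and
    \<open>B\<close> is its inverse.\<close>
  define e where "e = int K + 1"
  define A where "A t = 2 powi e * t + - (2 ^ K)" for t :: real
  define B where "B t = 2 powi - e * t + 1 / 2" for t :: real
  have pw: "(2::real) powi e = 2 * 2 ^ K" by (simp add: e_def power_int_add)
  have AB: "A (B t) = t" "B (A t) = t" for t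
    by (simp_all add: A_def B_def power_int_minus pw field_simps)
  have A: "pl2_at A t" for t unfolding A_def by (rule pl2_at_affine) simp
  have B: "pl2_at B t" for t unfolding B_def by (rule pl2_at_affine) simp
  have conj: "pl2_at (A \<circ> f \<circ> B) (A x)" "pl2_at (B \<circ> f \<circ> A) (B x)" if "pl2_at f x" for f x
  proof -
    have "pl2_at (f \<circ> B) (A x)" by (rule pl2_at_compose[OF B]) (simp add: AB that)
    then have "pl2_at (A \<circ> (f \<circ> B)) (A x)" by (rule pl2_at_compose[OF _ A])
    then show "pl2_at (A \<circ> f \<circ> B) (A x)" by (simp add: o_assoc)
    have "pl2_at (f \<circ> A) (B x)" by (rule pl2_at_compose[OF A]) (simp add: AB that)
    then have "pl2_at (B \<circ> (f \<circ> A)) (B x)" by (rule pl2_at_compose[OF _ B])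
    then show "pl2_at (B \<circ> f \<circ> A) (B x)" by (simp add: o_assoc)
  qed
  interpret c: pl2_conjugation "\<kappa> \<circ> A" "B \<circ> \<eta>"
  proof
    show "strict_mono (\<kappa> \<circ> A)" by (auto simp: strict_mono_def less_iff A_def)
    show "isCont (\<kappa> \<circ> A) x" for x
      by (rule continuous_at_compose[OF pl2_at_filterlim(4)[OF A] cont])
    fix f x assume f: "pl2_at f x"
    show "pl2_at ((\<kappa> \<circ> A) \<circ> f \<circ> (B \<circ> \<eta>)) ((\<kappa> \<circ> A) x)"
      using pres_\<kappa>[OF conj(1)[OF f]] by (simp add: o_assoc)
    show "pl2_at ((B \<circ> \<eta>) \<circ> f \<circ> (\<kappa> \<circ> A)) ((B \<circ> \<eta>) x)"
      using conj(2)[OF pres_\<eta>[OF f]] by (simp add: o_assoc)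
  qed (simp_all add: AB)
  have "0 < B y" "B y < 1" using K by (simp_all add: B_def power_int_minus pw field_simps)
  then have "pl2_at (\<kappa> \<circ> A) (B y)" by (rule c.pl2_at_unit)
  then have "pl2_at ((\<kappa> \<circ> A) \<circ> B) y" by (rule pl2_at_compose[OF B])
  then show ?thesis by (simp add: o_def AB)
qed

section \<open>Piecewise linear homeomorphisms and their germs\<close>

lemma affine_near_deriv:
  fixes f :: "real \<Rightarrow> real"
  assumes "\<forall>\<^sub>F t in nhds x. f t = m * t + c"
  shows "\<forall>\<^sub>F y in nhds x. f differentiable (at y) \<and> deriv f y = m"
proof -
  have "\<forall>\<^sub>F y in nhds x. \<forall>\<^sub>F t in nhds y. f t = m * t + c"
    using assms by (simp add: eventually_eventually)
  then show ?thesis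
  proof eventually_elim
    case (elim y)
    have "((\<lambda>t. m * t + c) has_field_derivative m) (at y)" by (auto intro!: derivative_eq_intros)
    then have "(f has_field_derivative m) (at y)"
      using DERIV_cong_ev[OF refl elim refl] by blast
    then show ?case by (auto intro: DERIV_imp_deriv simp: field_differentiable_def real_differentiable_def)
  qed
qed

lemma affine_near_not_break:
  assumes "\<forall>\<^sub>F t in nhds x. f t = m * t + c"
  shows "x \<notin> breaks f"
proof -
  note ev = affine_near_deriv[OF assms]
  have "deriv f x = m" using eventually_nhds_x_imp_x[OF ev] by simp
  moreover have "\<forall>\<^sub>F y in nhds x. m = deriv f y" using ev by eventually_elim simp
  then have "(deriv f \<longlongrightarrow> m) (at x)"
    by (intro tendsto_eventually) (auto simp: eventually_at_filter elim: eventually_mono)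
  ultimately have "isCont (deriv f) x" by (simp add: isCont_def)
  moreover have "\<forall>\<^sub>F y in nhds x. f differentiable (at y)" using ev by eventually_elim simp
  ultimately show ?thesis by (simp add: breaks_def)
qed

text \<open>Slope and intercept together form a locally constant function on a connected
  set.\<close>

lemma locally_affine_interval:
  fixes f :: "real \<Rightarrow> real"
  assumes "\<And>x. a < x \<Longrightarrow> x < b \<Longrightarrow> \<exists>m c. \<forall>\<^sub>F t in nhds x. f t = m * t + c"
  shows "\<exists>m c. \<forall>x\<in>{a<..<b}. f x = m * x + c \<and> deriv f x = m"
proof -
  define g where "g x = (deriv f x, f x - deriv f x * x)" for x
  have "g constant_on {a<..<b}"
  proof (rule locally_constant_imp_constant)
    fix x assume "x \<in> {a<..<b}"
    then obtain m c where mc: "\<forall>\<^sub>F t in nhds x. f t = m * t + c" using assms[of x] by auto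
    have "\<forall>\<^sub>F y in nhds x. g y = (m, c)"
      using mc affine_near_deriv[OF mc] by eventually_elim (simp add: g_def)
    then obtain S where "open S" "x \<in> S" "\<And>y. y \<in> S \<Longrightarrow> g y = (m, c)"
      unfolding eventually_nhds by blast
    with \<open>x \<in> {a<..<b}\<close> show "\<exists>T. openin (top_of_set {a<..<b}) T \<and> x \<in> T \<and> (\<forall>y\<in>T. g y = g x)"
      by (intro exI[of _ "{a<..<b} \<inter> S"]) (auto simp: openin_open)
  qed simp
  then obtain m c where "\<And>x. x \<in> {a<..<b} \<Longrightarrow> g x = (m, c)"
    unfolding constant_on_def by (metis surj_pair)
  then have "deriv f x = m" "f x - deriv f x * x = c" if "x \<in> {a<..<b}" for x
    using that by (auto simp: g_def)
  then have "\<forall>x\<in>{a<..<b}. f x = m * x + c \<and> deriv f x = m" by (metis add.commute diff_add_cancel)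
  then show ?thesis by blast
qed

text \<open>The constant term is dyadic because the interval contains a dyadic point, whose image is
  dyadic.\<close>

lemma dyadic_affine_between_breaks:
  assumes pl: "piecewise_linear f" and slopes: "power_of_two_slopes f"
    and dy: "\<And>x. x \<in> dyadics \<Longrightarrow> f x \<in> dyadics"
    and "a < b" and nb: "\<And>x. a < x \<Longrightarrow> x < b \<Longrightarrow> x \<notin> breaks f"
  shows "\<exists>k::int. \<exists>c\<in>dyadics. \<forall>x\<in>{a<..<b}. f x = 2 powi k * x + c"
proof -
  have "\<exists>m c. \<forall>x\<in>{a<..<b}. f x = m * x + c \<and> deriv f x = m"
  proof (rule locally_affine_interval)
    fix x assume "a < x" "x < b"
    then have "x \<notin> breaks f" by (rule nb)
    then show "\<exists>m c. \<forall>\<^sub>F t in nhds x. f t = m * t + c" using pl by (simp add: piecewise_linear_def)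
  qed
  then obtain m c where mc: "\<And>x. x \<in> {a<..<b} \<Longrightarrow> f x = m * x + c \<and> deriv f x = m" by blast
  obtain u where u: "u \<in> dyadics" "a < u" "u < b" using dyadics_dense[OF \<open>a < b\<close>] by blast
  then obtain k :: int where k: "m = 2 powi k"
    using slopes nb mc[of u] unfolding power_of_two_slopes_def by fastforce
  have "c = f u - 2 powi k * u" using mc[of u] u k by simp
  then have "c \<in> dyadics" using u dy by simp
  then show ?thesis using mc k by blast
qed

text \<open>Breaks are isolated, so \<open>f\<close> is affine on an interval on each side of
  \<open>x\<close>, and continuity supplies the value at \<open>x\<close>. \<open>PL2\<close> is not
  mentioned because lifts of circle maps are treated in the same way.\<close>

lemma pl2_at_piecewise_linear:
  assumes cont: "isCont f x" and pl: "piecewise_linear f" and slopes: "power_of_two_slopes f"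
    and br: "breaks f \<subseteq> dyadics" and dy: "\<And>x. x \<in> dyadics \<Longrightarrow> f x \<in> dyadics"
  shows "pl2_at f x"
proof -
  obtain U where U: "open U" "x \<in> U" "U \<inter> breaks f \<subseteq> {x}"
    using pl unfolding piecewise_linear_def by blast
  then obtain e where e: "e > 0" "ball x e \<subseteq> U" by (auto simp: open_contains_ball)
  have nb: "y \<notin> breaks f" if "x - e < y" "y < x + e" "y \<noteq> x" for y
  proof -
    have "y \<in> ball x e" using that by (simp add: dist_real_def)
    then show ?thesis using e(2) U(3) that(3) by blast
  qed
  show ?thesis
  proof (cases "x \<in> breaks f")
    case False
    then have "\<exists>k::int. \<exists>c\<in>dyadics. \<forall>t\<in>{x - e<..<x + e}. f t = 2 powi k * t + c"
      using nb e(1) by (intro dyadic_affine_between_breaks[OF pl slopes dy]) (simp, simp, metis)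
    then obtain k :: int and c where kc: "c \<in> dyadics" "\<And>t. t \<in> {x - e<..<x + e} \<Longrightarrow> f t = 2 powi k * t + c"
      by blast
    have "\<forall>\<^sub>F t in nhds x. t \<in> {x - e<..<x + e}" using e(1) by (intro eventually_nhds_in_open) auto
    then have "\<forall>\<^sub>F t in nhds x. f t = 2 powi k * t + c" by eventually_elim (rule kc(2))
    then show ?thesis by (rule pl2_at_affine_near[OF kc(1)])
  next
    case True
    have "\<exists>k::int. \<exists>c\<in>dyadics. \<forall>t\<in>{x - e<..<x}. f t = 2 powi k * t + c"
      using nb e(1) by (intro dyadic_affine_between_breaks[OF pl slopes dy]) auto
    then obtain k :: int and c where kc: "c \<in> dyadics" "\<And>t. t \<in> {x - e<..<x} \<Longrightarrow> f t = 2 powi k * t + c"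
      by blast
    have "\<exists>k::int. \<exists>c\<in>dyadics. \<forall>t\<in>{x<..<x + e}. f t = 2 powi k * t + c"
      using nb e(1) by (intro dyadic_affine_between_breaks[OF pl slopes dy]) auto
    then obtain l :: int and d where ld: "d \<in> dyadics" "\<And>t. t \<in> {x<..<x + e} \<Longrightarrow> f t = 2 powi l * t + d"
      by blast
    have left: "\<forall>\<^sub>F t in at_left x. f t = 2 powi k * t + c"
      unfolding eventually_at_left_field using kc(2) e(1) by (intro exI[of _ "x - e"]) auto
    have right: "\<forall>\<^sub>F t in at_right x. f t = 2 powi l * t + d"
      unfolding eventually_at_right_field using ld(2) e(1) by (intro exI[of _ "x + e"]) auto
    have lim: "(f \<longlongrightarrow> f x) (at_left x)" "(f \<longlongrightarrow> f x) (at_right x)"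
      using cont by (auto simp: isCont_def intro: tendsto_within_subset)
    have "((\<lambda>t. 2 powi k * t + c) \<longlongrightarrow> 2 powi k * x + c) (at_left x)" by (intro tendsto_intros)
    then have "f x = 2 powi k * x + c"
      using Lim_transform_eventually[OF lim(1) left] tendsto_unique[OF trivial_limit_at_left_real] by blast
    moreover have "((\<lambda>t. 2 powi l * t + d) \<longlongrightarrow> 2 powi l * x + d) (at_right x)" by (intro tendsto_intros)
    then have "f x = 2 powi l * x + d"
      using Lim_transform_eventually[OF lim(2) right] tendsto_unique[OF trivial_limit_at_right_real] by blast
    ultimately show ?thesis
      using kc(1) ld(1) left right True br by (intro pl2_atI[of c d f x k l]) auto
  qed
qed

lemma pl2_at_PL2: "f \<in> PL2 \<Longrightarrow> pl2_at f x"
  unfolding PL2_def homeo_def homeomorphism_def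
  by (auto intro!: pl2_at_piecewise_linear simp: continuous_on_eq_continuous_at)

text \<open>The one-sided slopes are the one-sided limits of \<open>deriv f\<close>; its continuity
  makes them equal, and the value at \<open>x\<close> then makes the constant terms equal.\<close>

lemma pl2_at_not_break:
  assumes "pl2_at f x" "x \<notin> breaks f"
  shows "\<exists>k::int. \<exists>c\<in>dyadics. \<forall>\<^sub>F t in nhds x. f t = 2 powi k * t + c"
proof -
  obtain k l :: int and c d where f: "c \<in> dyadics" "f x = 2 powi k * x + c" "f x = 2 powi l * x + d"
    "\<forall>\<^sub>F t in at_left x. f t = 2 powi k * t + c" "\<forall>\<^sub>F t in at_right x. f t = 2 powi l * t + d"
    using assms(1) by (rule pl2_atE) blast
  obtain a where a: "a < x" "\<And>t. a < t \<Longrightarrow> t < x \<Longrightarrow> f t = 2 powi k * t + c"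
    using f(4) unfolding eventually_at_left_field by blast
  obtain b where b: "x < b" "\<And>t. x < t \<Longrightarrow> t < b \<Longrightarrow> f t = 2 powi l * t + d"
    using f(5) unfolding eventually_at_right_field by blast
  have der: "deriv f t = 2 powi k" if "a < t" "t < x" for t
  proof -
    have "\<forall>\<^sub>F s in nhds t. s \<in> {a<..<x}" using that by (intro eventually_nhds_in_open) auto
    then have "\<forall>\<^sub>F s in nhds t. f s = 2 powi k * s + c" by eventually_elim (simp add: a(2))
    from eventually_nhds_x_imp_x[OF affine_near_deriv[OF this]] show ?thesis by simp
  qed
  have der': "deriv f t = 2 powi l" if "x < t" "t < b" for t
  proof -
    have "\<forall>\<^sub>F s in nhds t. s \<in> {x<..<b}" using that by (intro eventually_nhds_in_open) auto
    then have "\<forall>\<^sub>F s in nhds t. f s = 2 powi l * s + d" by eventually_elim (simp add: b(2))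
    from eventually_nhds_x_imp_x[OF affine_near_deriv[OF this]] show ?thesis by simp
  qed
  have "isCont (deriv f) x" using assms(2) by (simp add: breaks_def)
  then have lim: "(deriv f \<longlongrightarrow> deriv f x) (at_left x)" "(deriv f \<longlongrightarrow> deriv f x) (at_right x)"
    by (auto simp: isCont_def intro: tendsto_within_subset)
  have "(deriv f \<longlongrightarrow> 2 powi k) (at_left x)"
    using a(1) der unfolding eventually_at_left_field by (intro tendsto_eventually) (auto simp: eventually_at_left_field)
  then have 1: "2 powi k = deriv f x" using tendsto_unique[OF _ lim(1)] by (metis trivial_limit_at_left_real)
  have "(deriv f \<longlongrightarrow> 2 powi l) (at_right x)"
    using b(1) der' by (intro tendsto_eventually) (auto simp: eventually_at_right_field)
  then have 2: "2 powi l = deriv f x" using tendsto_unique[OF _ lim(2)] by (metis trivial_limit_at_right_real)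
  have kl: "2 powi l = (2 powi k :: real)" "d = c" using 1 2 f(2,3) by simp_all
  have "\<forall>\<^sub>F t in nhds x. f t = 2 powi k * t + c"
    using f unfolding eventually_nhds_split kl by simp
  then show ?thesis using f(1) by blast
qed

lemma breaks_isolated:
  assumes "pl2_at f x"
  shows "\<exists>U. open U \<and> x \<in> U \<and> U \<inter> breaks f \<subseteq> {x}"
proof -
  have "\<forall>\<^sub>F y in at x. y \<notin> breaks f"
    using pl2_at_near[OF assms] by eventually_elim (use affine_near_not_break in blast)
  then show ?thesis unfolding eventually_at_topological by blast
qed

lemma breaks_subset_dyadics:
  assumes "\<And>x. pl2_at f x"
  shows "breaks f \<subseteq> dyadics"
proof (rule subsetI, rule ccontr)
  fix x assume x: "x \<in> breaks f" "x \<notin> dyadics"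
  obtain k l :: int and c d where f: "f x = 2 powi k * x + c"
    "\<forall>\<^sub>F t in at_left x. f t = 2 powi k * t + c" "\<forall>\<^sub>F t in at_right x. f t = 2 powi l * t + d"
    "k = l \<and> c = d"
    using assms[of x] by (rule pl2_atE) (use x(2) in blast)
  then have "\<forall>\<^sub>F t in nhds x. f t = 2 powi k * t + c" unfolding eventually_nhds_split by simp
  then show False using x(1) affine_near_not_break by blast
qed

lemma piecewise_linear_pl2_at:
  assumes "\<And>x. pl2_at f x"
  shows "piecewise_linear f" "power_of_two_slopes f"
proof -
  have *: "\<exists>k::int. \<exists>c\<in>dyadics. \<forall>\<^sub>F t in nhds x. f t = 2 powi k * t + c" if "x \<notin> breaks f" for x
    by (rule pl2_at_not_break[OF assms that])
  show "piecewise_linear f"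
    unfolding piecewise_linear_def using breaks_isolated[OF assms] * by meson
  show "power_of_two_slopes f"
    unfolding power_of_two_slopes_def
  proof (intro allI impI)
    fix x assume "x \<notin> breaks f"
    then obtain k :: int and c where "\<forall>\<^sub>F t in nhds x. f t = 2 powi k * t + c" using * by blast
    from eventually_nhds_x_imp_x[OF affine_near_deriv[OF this]]
    show "\<exists>k::int. deriv f x = 2 powi k" by blast
  qed
qed

lemma PL2_I:
  assumes "homeo f" "strict_mono f" and pl: "\<And>x. pl2_at f x"
  shows "f \<in> PL2"
proof -
  have "discrete (breaks f)"
    unfolding discrete_def isolated_in_def
  proof (intro ballI conjI)
    fix x assume x: "x \<in> breaks f"
    obtain U where "open U" "x \<in> U" "U \<inter> breaks f \<subseteq> {x}" using breaks_isolated[OF pl] by blast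
    then show "\<exists>T. open T \<and> T \<inter> breaks f = {x}" using x by blast
  qed
  moreover have "f ` dyadics \<subseteq> dyadics" using pl2_at_dyadics[OF pl] by blast
  ultimately show ?thesis
    unfolding PL2_def using assms(1,2) piecewise_linear_pl2_at[OF pl] breaks_subset_dyadics[OF pl] by simp
qed

text \<open>The induction covers all representatives \<open>f\<close> of the germ, since the rules
  fix a germ through particular representatives only. The target is carried along because
  \<open>comp\<close> needs \<open>g\<close> at the point \<open>f x\<close>.\<close>

lemma generated_germ_predicate:
  fixes P :: "'a::topological_space \<Rightarrow> ('a \<Rightarrow> 'a) \<Rightarrow> bool"
  assumes gen: "generated_germ \<F> x y \<gamma>"
    and base: "\<And>U f x. (U, f) \<in> \<F> \<Longrightarrow> x \<in> U \<Longrightarrow> P x f"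
    and cong: "\<And>x f g. P x f \<Longrightarrow> \<forall>\<^sub>F z in nhds x. g z = f z \<Longrightarrow> P x g"
    and comp: "\<And>x f g. P x f \<Longrightarrow> P (f x) g \<Longrightarrow> P x (g \<circ> f)"
    and inv: "\<And>x f g. P x f \<Longrightarrow> \<forall>\<^sub>F z in nhds x. g (f z) = z \<Longrightarrow> P (f x) g"
  shows "\<gamma> = germ x f \<Longrightarrow> P x f \<and> f x = y"
  using gen
proof (induction arbitrary: f)
  case (generator U f' x)
  then have ev: "\<forall>\<^sub>F z in nhds x. f z = f' z" by (simp add: germ_eq_iff eq_commute)
  then show ?case
    using cong[OF base[OF generator(1,2)] ev] eventually_nhds_x_imp_x[OF ev] by simp
next
  case (inverse_generator U f' V W x g)
  have "\<forall>\<^sub>F z in nhds x. g (f' z) = z"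
    using inverse_generator(2,4,6) unfolding eventually_nhds homeomorphism_def by auto
  moreover have "P x f'" using base inverse_generator(1,4,5) by blast
  ultimately have "P (f' x) g" "g (f' x) = x" using inv eventually_nhds_x_imp_x by blast+
  moreover have ev: "\<forall>\<^sub>F z in nhds (f' x). f z = g z"
    using inverse_generator.prems by (simp add: germ_eq_iff eq_commute)
  ultimately show ?case using cong[OF _ ev] eventually_nhds_x_imp_x[OF ev] by simp
next
  case (composition x y f1 z g1)
  have 1: "P x f1 \<and> f1 x = y" by (rule composition.IH(1)[OF refl])
  have 2: "P y g1 \<and> g1 y = z" by (rule composition.IH(2)[OF refl])
  have "P x (g1 \<circ> f1)" by (rule comp) (use 1 2 in simp_all)
  moreover have ev: "\<forall>\<^sub>F z in nhds x. f z = (g1 \<circ> f1) z"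
    using composition.prems by (simp add: germ_eq_iff eq_commute)
  ultimately have "P x f" by (rule cong)
  then show ?case using 1 2 eventually_nhds_x_imp_x[OF ev] by simp
qed

section \<open>Bumps generate all germs\<close>

text \<open>One map contains all the germs needed: slope 2 on \<open>[c, c + w]\<close>, the
  translation by \<open>w\<close> on \<open>[c + w, c + 2 * w]\<close>, slope \<open>1/2\<close> on
  \<open>[c + 2 * w, c + 4 * w]\<close>. The last piece is twice as long as the first, so it takes
  back the gain of \<open>w\<close>.\<close>

definition bump :: "real \<Rightarrow> real \<Rightarrow> real \<Rightarrow> real" where
  "bump c w t = (if t \<le> c then t else if t \<le> c + w then 2 * t - c else if t \<le> c + 2 * w then t + w
     else if t \<le> c + 4 * w then (t + c + 4 * w) / 2 else t)"

text \<open>Each function is used on its own side of \<open>a\<close> only; at \<open>a\<close>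
  itself the left formula comes from \<open>f\<close> and the right one from
  \<open>g\<close>.\<close>

lemma pl2_at_If:
  assumes a: "a \<in> dyadics" and eq: "f a = g a"
    and f: "x \<le> a \<Longrightarrow> pl2_at f x" and g: "a \<le> x \<Longrightarrow> pl2_at g x"
  shows "pl2_at (\<lambda>t. if t \<le> a then f t else g t) x"
proof -
  consider "x < a" | "x = a" | "a < x" by linarith
  then show ?thesis
  proof cases
    case 1
    have "\<forall>\<^sub>F t in nhds x. t < a" using 1 by (simp add: eventually_nhds_in_open[of "{..<a}", simplified])
    then have ev: "\<forall>\<^sub>F t in nhds x. (if t \<le> a then f t else g t) = f t" by eventually_elim simp
    show ?thesis using 1 by (intro pl2_at_cong[OF f ev]) simp
  next
    case 3
    have "\<forall>\<^sub>F t in nhds x. a < t" using 3 by (simp add: eventually_nhds_in_open[of "{a<..}", simplified])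
    then have ev: "\<forall>\<^sub>F t in nhds x. (if t \<le> a then f t else g t) = g t" by eventually_elim simp
    show ?thesis using 3 by (intro pl2_at_cong[OF g ev]) simp
  next
    case 2
    obtain k l :: int and c d where F: "c \<in> dyadics" "f x = 2 powi k * x + c" "\<forall>\<^sub>F t in at_left x. f t = 2 powi k * t + c"
      by (rule pl2_atE[OF f[OF eq_refl[OF 2]]]) blast
    obtain k' l' :: int and c' d' where G: "d' \<in> dyadics" "g x = 2 powi l' * x + d'" "\<forall>\<^sub>F t in at_right x. g t = 2 powi l' * t + d'"
      by (rule pl2_atE[OF g[OF eq_refl[OF 2[symmetric]]]]) blast
    have "\<forall>\<^sub>F t in at_left x. t < x" by (simp add: eventually_at_filter)
    then have "\<forall>\<^sub>F t in at_left x. (if t \<le> a then f t else g t) = 2 powi k * t + c"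
      using F(3) by eventually_elim (simp add: 2)
    moreover have "\<forall>\<^sub>F t in at_right x. x < t" by (simp add: eventually_at_filter)
    then have "\<forall>\<^sub>F t in at_right x. (if t \<le> a then f t else g t) = 2 powi l' * t + d'"
      using G(3) by eventually_elim (simp add: 2)
    ultimately show ?thesis
      using F G a eq 2 by (intro pl2_atI[of c d' _ x k l']) auto
  qed
qed

lemma pl2_at_bump:
  assumes c: "c \<in> dyadics" and w: "w \<in> dyadics" "w > 0"
  shows "pl2_at (bump c w) x"
proof -
  have id: "pl2_at (\<lambda>t. t) x" for x using pl2_at_affine[of 0 0 x] by simp
  have dbl: "pl2_at (\<lambda>t. 2 * t - c) x" for x using pl2_at_affine[of "- c" 1 x] c by simp
  have tr: "pl2_at (\<lambda>t. t + w) x" for x using pl2_at_affine[of w 0 x] w by simp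
  have hlf: "pl2_at (\<lambda>t. (t + c + 4 * w) / 2) x" for x
    using pl2_at_affine[of "(c + 4 * w) / 2" "-1" x] c w by (simp add: power_int_minus add_divide_distrib add.assoc)
  have 1: "pl2_at (\<lambda>t. if t \<le> c + 4 * w then (t + c + 4 * w) / 2 else t) x" for x
    by (rule pl2_at_If) (use c w id hlf in auto)
  have 2: "pl2_at (\<lambda>t. if t \<le> c + 2 * w then t + w else if t \<le> c + 4 * w then (t + c + 4 * w) / 2 else t) x" for x
    by (rule pl2_at_If) (use c w tr 1 in auto)
  have 3: "pl2_at (\<lambda>t. if t \<le> c + w then 2 * t - c else if t \<le> c + 2 * w then t + w
      else if t \<le> c + 4 * w then (t + c + 4 * w) / 2 else t) x" for x
    by (rule pl2_at_If) (use c w dbl 2 in auto)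
  have "pl2_at (\<lambda>t. if t \<le> c then t else if t \<le> c + w then 2 * t - c else if t \<le> c + 2 * w then t + w
      else if t \<le> c + 4 * w then (t + c + 4 * w) / 2 else t) x" for x
    by (rule pl2_at_If) (use c w id 3 in auto)
  then show ?thesis unfolding bump_def .
qed

lemma bump_strict_mono: "w > 0 \<Longrightarrow> strict_mono (bump c w)"
  unfolding bump_def by (intro strict_monoI) (simp add: field_simps split: if_splits)

text \<open>Surjective by the intermediate value theorem, with continuous inverse because a
  continuous injection of the line is open.\<close>

lemma homeo_real:
  fixes f :: "real \<Rightarrow> real"
  assumes "strict_mono f" and cont: "\<And>x. isCont f x" and unbounded: "\<And>y. \<exists>x. f x \<le> y" "\<And>y. \<exists>x. y \<le> f x"
  shows "homeo f"
proof -
  have "\<exists>x. f x = y" for y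
  proof -
    obtain a b where ab: "f a \<le> y" "y \<le> f b" using unbounded by blast
    then have "\<not> b < a" using assms(1) by (metis order.trans strict_monoD not_less)
    then have "\<exists>x\<ge>a. x \<le> b \<and> f x = y" using ab cont by (intro IVT) auto
    then show ?thesis by blast
  qed
  then have "range f = UNIV" by (metis surjI surj_def)
  moreover have inj: "inj f" using assms(1) by (rule strict_mono_imp_inj_on)
  moreover have con: "continuous_on UNIV f" by (simp add: cont continuous_at_imp_continuous_on)
  moreover have "open (f ` U)" if "open U" for U
    using inj injective_eq_1d_open_map_UNIV[OF con is_interval_univ] that by simp
  ultimately obtain g where "homeomorphism UNIV UNIV f g"
    by (elim homeomorphism_injective_open_map) (auto simp: openin_open)
  then show ?thesis unfolding homeo_def by blast
qed

lemma bump_BPL2: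
  assumes "c \<in> dyadics" "w \<in> dyadics" "w > 0"
  shows "bump c w \<in> BPL2"
proof -
  have "homeo (bump c w)"
  proof (rule homeo_real)
    show "strict_mono (bump c w)" using assms(3) by (rule bump_strict_mono)
    show "isCont (bump c w) x" for x using pl2_at_filterlim(4)[OF pl2_at_bump[OF assms]] .
    show "\<exists>x. bump c w x \<le> y" for y by (rule exI[of _ "min y c"]) (simp add: bump_def)
    show "\<exists>x. y \<le> bump c w x" for y
      using assms(3) by (intro exI[of _ "max y (c + 5 * w)"]) (simp add: bump_def)
  qed
  then have "bump c w \<in> PL2"
    using bump_strict_mono[OF assms(3)] pl2_at_bump[OF assms] by (intro PL2_I)
  moreover have "{x. bump c w x \<noteq> x} \<subseteq> {c..c + 4 * w}" by (auto simp: bump_def split: if_splits)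
  then have "bounded {x. bump c w x \<noteq> x}" by (rule bounded_subset[rotated]) simp
  ultimately show ?thesis by (simp add: BPL2_def)
qed

text \<open>Only bumps of width at most \<open>1/2\<close> are used, since these also live on the circle.\<close>

locale bump_closed =
  fixes P :: "real \<Rightarrow> (real \<Rightarrow> real) \<Rightarrow> bool"
  assumes cong: "\<And>x f g. P x f \<Longrightarrow> \<forall>\<^sub>F t in nhds x. g t = f t \<Longrightarrow> P x g"
    and comp: "\<And>x f g. P x f \<Longrightarrow> P (f x) g \<Longrightarrow> P x (g \<circ> f)"
    and bump: "\<And>c w x. c \<in> dyadics \<Longrightarrow> w \<in> dyadics \<Longrightarrow> 0 < w \<Longrightarrow> w \<le> 1/8 \<Longrightarrow> c \<le> x \<Longrightarrow> x \<le> c + 4 * w \<Longrightarrow> P x (bump c w)"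
    and bump_inverse: "\<And>c w x g. c \<in> dyadics \<Longrightarrow> w \<in> dyadics \<Longrightarrow> 0 < w \<Longrightarrow> w \<le> 1/8 \<Longrightarrow> c \<le> x \<Longrightarrow> x \<le> c + 4 * w \<Longrightarrow>
      \<forall>\<^sub>F t in nhds x. g (bump c w t) = t \<Longrightarrow> P (bump c w x) g"
begin

lemma compI: "P x f \<Longrightarrow> P (f x) g \<Longrightarrow> (\<And>t. k t = g (f t)) \<Longrightarrow> P x k"
  using cong[OF comp] by simp

lemma bump_on_interval:
  assumes "c \<in> dyadics" "w \<in> dyadics" "0 < w" "w \<le> 1/8" "c \<le> a" "b \<le> c + 4 * w" "a < x" "x < b"
    and "\<And>t. a < t \<Longrightarrow> t < b \<Longrightarrow> bump c w t = f t"
  shows "P x f"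
proof (rule cong)
  show "P x (bump c w)" by (rule bump) (use assms in auto)
  have "\<forall>\<^sub>F t in nhds x. t \<in> {a<..<b}" using assms by (intro eventually_nhds_in_open) auto
  then show "\<forall>\<^sub>F t in nhds x. f t = bump c w t" by eventually_elim (simp add: assms(9))
qed

text \<open>A bump never moves points to the left, so the translation by \<open>- w\<close> has to
  come from the inverse germ of a bump.\<close>

lemma small_translation:
  assumes w: "w \<in> dyadics" "0 < w" "w \<le> 1/8"
  shows "P x (\<lambda>t. t + w)" "P x (\<lambda>t. t - w)"
proof -
  show "P x (\<lambda>t. t + w)" for x
  proof -
    \<comment> \<open>This places \<open>x\<close> strictly between \<open>c + w\<close> and
      \<open>c + 2 * w\<close>, where the bump is the translation by \<open>w\<close>.\<close>
    obtain c where "c \<in> dyadics" "x - 2 * w < c" "c < x - w"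
      using dyadics_dense[of "x - 2 * w" "x - w"] w by auto
    then show ?thesis
      using w by (intro bump_on_interval[of c w "c + w" "c + 2 * w"]) (auto simp: bump_def)
  qed
  \<comment> \<open>Now \<open>x - w\<close> lies in the translated piece and is carried to
    \<open>x\<close>.\<close>
  obtain c where c: "c \<in> dyadics" "x - 3 * w < c" "c < x - 2 * w"
    using dyadics_dense[of "x - 3 * w" "x - 2 * w"] w by auto
  have "\<forall>\<^sub>F t in nhds (x - w). t \<in> {c + w<..<c + 2 * w}" using c by (intro eventually_nhds_in_open) auto
  then have "\<forall>\<^sub>F t in nhds (x - w). bump c w t - w = t"
    by eventually_elim (use w in \<open>simp add: bump_def\<close>)
  then have "P (bump c w (x - w)) (\<lambda>t. t - w)"
    by (rule bump_inverse[rotated 6]) (use c w in auto)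
  moreover have "bump c w (x - w) = x" using c w by (simp add: bump_def)
  ultimately show "P x (\<lambda>t. t - w)" by simp
qed

lemma translation:
  assumes "d \<in> dyadics"
  shows "P x (\<lambda>t. t + d)"
proof -
  have id: "P x (\<lambda>t. t)" for x
    by (rule compI[OF small_translation(1)[of "1/8"] small_translation(2)[of "1/8"]])
      (use dyadics_inverse_power[of 3] in simp_all)
  have nat: "P x (\<lambda>t. t + of_nat n * w)" "P x (\<lambda>t. t - of_nat n * w)" if w: "w \<in> dyadics" "0 < w" "w \<le> 1/8" for x w n
  proof (induction n arbitrary: x)
    case 0
    show "P x (\<lambda>t. t + of_nat 0 * w)" "P x (\<lambda>t. t - of_nat 0 * w)" for x using id by simp_all
  next
    case (Suc n)
    show "P x (\<lambda>t. t + of_nat (Suc n) * w)" for x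
      by (rule compI[OF small_translation(1)[OF w] Suc.IH(1)]) (simp add: algebra_simps)
    show "P x (\<lambda>t. t - of_nat (Suc n) * w)" for x
      by (rule compI[OF small_translation(2)[OF w] Suc.IH(2)]) (simp add: algebra_simps)
  qed
  obtain n where "d * 2 ^ n \<in> \<int>" using assms by (auto simp: dyadics_iff)
  then obtain i :: int where "d * 2 ^ n = of_int i" by (auto elim: Ints_cases)
  then have d: "d = of_int i / 2 ^ n" by (simp add: field_simps)
  \<comment> \<open>Three extra halvings give \<open>w \<le> 1/8\<close> and turn the numerator
    \<open>i\<close> into \<open>8 * i\<close>.\<close>
  define w :: real where "w = 1 / 2 ^ (n + 3)"
  have "(2::real) ^ 3 \<le> 2 ^ (n + 3)" by (intro power_increasing) auto
  then have w: "w \<in> dyadics" "0 < w" "w \<le> 1/8" by (simp_all add: w_def field_simps)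
  have dw: "d = of_int (8 * i) * w" by (simp add: d w_def power_add)
  show ?thesis
  proof (cases "i \<ge> 0")
    case True
    then show ?thesis using nat(1)[OF w, of x "nat (8 * i)"] by (simp add: dw)
  next
    case False
    then show ?thesis using nat(2)[OF w, of x "nat (- 8 * i)"] by (simp add: dw)
  qed
qed

text \<open>Doubling and halving are read off the two sloped pieces of a bump with
  \<open>w = 1/8\<close>; a translation repairs the constant term.\<close>

lemma affine:
  assumes "c \<in> dyadics"
  shows "P x (\<lambda>t. 2 powi k * t + c)"
proof -
  have w: "1/8 \<in> dyadics" using dyadics_inverse_power[of 3] by simp
  have dbl: "P x (\<lambda>t. 2 * t)" for x
  proof -
    obtain a where a: "a \<in> dyadics" "x - 1/8 < a" "a < x" using dyadics_dense[of "x - 1/8" x] by auto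
    have "P x (\<lambda>t. 2 * t - a)"
      using w a by (intro bump_on_interval[of a "1/8" a "a + 1/8"]) (auto simp: bump_def)
    then show ?thesis by (rule compI[OF _ translation[OF a(1)]]) simp
  qed
  have hlf: "P x (\<lambda>t. t / 2)" for x
  proof -
    obtain a where a: "a \<in> dyadics" "x - 4/8 < a" "a < x - 2/8" using dyadics_dense[of "x - 4/8" "x - 2/8"] by auto
    have "P x (\<lambda>t. (t + a + 1/2) / 2)"
      using w a by (intro bump_on_interval[of a "1/8" "a + 2/8" "a + 4/8"]) (auto simp: bump_def)
    moreover have "- ((a + 1/2) / 2) \<in> dyadics" using a(1) by (intro dyadics_minus dyadics_half dyadics_add) simp_all
    ultimately show ?thesis by (rule compI[OF _ translation]) (simp add: field_simps)
  qed
  have nat: "P x (\<lambda>t. 2 ^ n * t)" "P x (\<lambda>t. t / 2 ^ n)" for x n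
  proof (induction n arbitrary: x)
    case 0
    show "P x (\<lambda>t. 2 ^ 0 * t)" "P x (\<lambda>t. t / 2 ^ 0)" for x using translation[of 0 x] by simp_all
  next
    case (Suc n)
    show "P x (\<lambda>t. 2 ^ Suc n * t)" for x by (rule compI[OF dbl Suc.IH(1)]) simp
    show "P x (\<lambda>t. t / 2 ^ Suc n)" for x by (rule compI[OF hlf Suc.IH(2)]) simp
  qed
  have "P x (\<lambda>t. 2 powi k * t)"
  proof (cases "k \<ge> 0")
    case True
    then show ?thesis using nat(1)[of x "nat k"] by (simp add: power_int_def)
  next
    case False
    then show ?thesis using nat(2)[of x "nat (- k)"] by (simp add: power_int_def field_simps)
  qed
  then show ?thesis by (rule compI[OF _ translation[OF assms]]) simp
qed

text \<open>At \<open>c\<close> the slope of a bump changes from 1 to 2. For the ratio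
  \<open>1/2\<close>, the break at \<open>c + w\<close> is used, where the slope drops from 2 to 1,
  followed by an affine map of slope \<open>1/2\<close>; hence \<open>c = x - 1/8\<close> in
  \<open>down\<close>.\<close>

lemma one_sided:
  assumes x: "x \<in> dyadics"
  shows "P x (\<lambda>t. if t \<le> x then t else x + 2 powi k * (t - x))"
proof -
  have w: "1/8 \<in> dyadics" using dyadics_inverse_power[of 3] by simp
  have nhd: "\<forall>\<^sub>F t in nhds x. t \<in> {x - 1/8<..<x + 1/8}" by (intro eventually_nhds_in_open) auto
  have up: "P x (\<lambda>t. if t \<le> x then t else x + 2 * (t - x))"
  proof (rule cong[OF bump[of x "1/8"]])
    show "\<forall>\<^sub>F t in nhds x. (if t \<le> x then t else x + 2 * (t - x)) = bump x (1/8) t"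
      using nhd by eventually_elim (simp add: bump_def)
  qed (use x w in auto)
  have down: "P x (\<lambda>t. if t \<le> x then t else x + (t - x) / 2)"
  proof -
    define c where "c = x - 1/8"
    have "P x (bump c (1/8))" by (rule bump) (use x w in \<open>auto simp: c_def\<close>)
    moreover have "P (bump c (1/8) x) (\<lambda>t. 2 powi -1 * t + c / 2)"
      by (rule affine) (use x w in \<open>auto simp: c_def\<close>)
    ultimately have "P x ((\<lambda>t. 2 powi -1 * t + c / 2) \<circ> bump c (1/8))" by (rule comp)
    then show ?thesis
    proof (rule cong)
      show "\<forall>\<^sub>F t in nhds x. (if t \<le> x then t else x + (t - x) / 2) = ((\<lambda>t. 2 powi -1 * t + c / 2) \<circ> bump c (1/8)) t"
        using nhd by eventually_elim (auto simp: bump_def c_def power_int_minus field_simps)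
    qed
  qed
  have nat: "P x (\<lambda>t. if t \<le> x then t else x + 2 ^ n * (t - x))" "P x (\<lambda>t. if t \<le> x then t else x + (t - x) / 2 ^ n)" for n
  proof (induction n)
    case 0
    show "P x (\<lambda>t. if t \<le> x then t else x + 2 ^ 0 * (t - x))" "P x (\<lambda>t. if t \<le> x then t else x + (t - x) / 2 ^ 0)"
      using translation[of 0 x] by (simp_all add: if_distrib cong: if_cong)
  next
    case (Suc n)
    show "P x (\<lambda>t. if t \<le> x then t else x + 2 ^ Suc n * (t - x))"
      by (rule compI[OF up]) (use Suc.IH(1) in auto)
    show "P x (\<lambda>t. if t \<le> x then t else x + (t - x) / 2 ^ Suc n)"
      by (rule compI[OF down]) (use Suc.IH(2) in auto)
  qed
  show ?thesis
  proof (cases "k \<ge> 0")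
    case True
    then have pw: "2 powi k = (2::real) ^ nat k" by (simp add: power_int_def)
    show ?thesis unfolding pw by (rule nat(1))
  next
    case False
    then have pw: "2 powi k * s = s / (2::real) ^ nat (- k)" for s by (simp add: power_int_def field_simps)
    show ?thesis unfolding pw by (rule nat(2))
  qed
qed

text \<open>At a dyadic point, \<open>f\<close> is its left affine formula applied after a map
  \<open>W\<close> that is the identity on the left and has the quotient of the two slopes on the
  right. At other points \<open>f\<close> is affine.\<close>

lemma all_germs_at:
  assumes "pl2_at f x"
  shows "P x f"
proof -
  obtain k l :: int and c d where f: "c \<in> dyadics" "d \<in> dyadics" "f x = 2 powi k * x + c" "f x = 2 powi l * x + d"
    "\<forall>\<^sub>F t in at_left x. f t = 2 powi k * t + c" "\<forall>\<^sub>F t in at_right x. f t = 2 powi l * t + d"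
    "x \<notin> dyadics \<Longrightarrow> k = l \<and> c = d"
    using assms by (rule pl2_atE) blast
  show ?thesis
  proof (cases "x \<in> dyadics")
    case True
    define W where "W t = (if t \<le> x then t else x + 2 powi (l - k) * (t - x))" for t
    have "P x W" unfolding W_def by (rule one_sided[OF True])
    then have P: "P x ((\<lambda>t. 2 powi k * t + c) \<circ> W)" by (rule comp) (rule affine[OF f(1)])
    have "\<forall>\<^sub>F t in at_left x. t < x" by (simp add: eventually_at_filter)
    then have left: "\<forall>\<^sub>F t in at_left x. f t = ((\<lambda>t. 2 powi k * t + c) \<circ> W) t"
      using f(5) by eventually_elim (simp add: W_def)
    have pw: "2 powi k * (2 powi (l - k) * s) = 2 powi l * s" for s :: real by (simp add: power_int_diff)
    have "\<forall>\<^sub>F t in at_right x. x < t" by (simp add: eventually_at_filter)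
    then have right: "\<forall>\<^sub>F t in at_right x. f t = ((\<lambda>t. 2 powi k * t + c) \<circ> W) t"
      using f(6)
    proof eventually_elim
      case (elim t)
      then have "((\<lambda>t. 2 powi k * t + c) \<circ> W) t = 2 powi k * x + 2 powi k * (2 powi (l - k) * (t - x)) + c"
        by (simp add: W_def distrib_left)
      then show ?case using elim(2) f(3,4) unfolding pw by (simp add: right_diff_distrib)
    qed
    have "\<forall>\<^sub>F t in nhds x. f t = ((\<lambda>t. 2 powi k * t + c) \<circ> W) t"
      unfolding eventually_nhds_split using left right f(3) by (simp add: W_def)
    then show ?thesis by (rule cong[OF P])
  next
    case False
    then have "\<forall>\<^sub>F t in nhds x. f t = 2 powi k * t + c"
      unfolding eventually_nhds_split using f by simp
    then show ?thesis by (rule cong[OF affine[OF f(1)]])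
  qed
qed

end

section \<open>The groupoids on the line\<close>

text \<open>Near \<open>f x\<close> the local inverse \<open>g\<close> coincides with the global
  inverse of \<open>f\<close>, whose germ is generated.\<close>

lemma generated_germ_inverse:
  assumes f: "(UNIV, f) \<in> \<F>" "homeo f" and ev: "\<forall>\<^sub>F z in nhds x. g (f z) = z"
  shows "generated_germ \<F> (f x) (g (f x)) (germ (f x) g)"
proof -
  obtain f' where f': "homeomorphism UNIV UNIV f f'" using f(2) unfolding homeo_def by blast
  then have inv: "\<And>z. f' (f z) = z" "\<And>z. f (f' z) = z" and cont: "continuous_on UNIV f'"
    by (simp_all add: homeomorphism_def)
  have "generated_germ \<F> (f x) x (germ (f x) f')"
    by (rule generated_germ.inverse_generator[OF f(1) open_UNIV open_UNIV _ _ f']) simp_all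
  moreover have "filterlim f' (nhds (f' (f x))) (nhds (f x))"
    using cont unfolding continuous_on_def by (auto simp: tendsto_at_iff_tendsto_nhds)
  then have "\<forall>\<^sub>F s in nhds (f x). g (f (f' s)) = f' s"
    using ev unfolding filterlim_iff inv(1) by blast
  then have "germ (f x) f' = germ (f x) g"
    unfolding germ_eq_iff by eventually_elim (simp add: inv)
  moreover have "g (f x) = x" using eventually_nhds_x_imp_x[OF ev] .
  ultimately show ?thesis by simp
qed

lemma generated_germ_cong:
  assumes "generated_germ \<F> x (f x) (germ x f)" "\<forall>\<^sub>F z in nhds x. g z = f z"
  shows "generated_germ \<F> x (g x) (germ x g)"
proof -
  have "germ x g = germ x f" using assms(2) by (simp add: germ_eq_iff)
  moreover have "g x = f x" using eventually_nhds_x_imp_x[OF assms(2)] .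
  ultimately show ?thesis using assms(1) by simp
qed

lemma preserves_germ:
  assumes "preserves G h" "inj h" "open U" "x \<in> U" "\<And>y. y \<in> U \<Longrightarrow> germ y f \<in> G y (f y)"
  shows "germ (h x) (h \<circ> f \<circ> inv h) \<in> G (h x) (h (f x))"
proof -
  have "(U, f) \<in> compatible_functions G" using assms(3,5) by (simp add: compatible_functions_def)
  then have "(h ` U, h \<circ> f \<circ> inv h) \<in> compatible_functions G"
    using assms(1) by (auto simp: preserves_def)
  then show ?thesis using assms(2,4) by (auto simp: compatible_functions_def)
qed

lemma homeo_inv:
  assumes "homeo h"
  shows "inj h" "inj (inv h)" "inv (inv h) = h" "h (inv h y) = y" "inv h (h x) = x" "homeo (inv h)"
    "continuous_on UNIV h"
proof -
  obtain g where g: "homeomorphism UNIV UNIV h g" using assms unfolding homeo_def by blast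
  then have gh: "\<And>z. g (h z) = z" "\<And>z. h (g z) = z" by (simp_all add: homeomorphism_def)
  then have bij: "bij h" by (metis bijI')
  then have "inv h = g" using gh by (metis inv_equality)
  then show "homeo (inv h)" using g homeomorphism_symD unfolding homeo_def by blast
  show "continuous_on UNIV h" using g by (simp add: homeomorphism_def)
  show "inj h" "inj (inv h)" "inv (inv h) = h" "h (inv h y) = y" "inv h (h x) = x"
    using bij by (simp_all add: bij_is_inj bij_is_surj surj_f_inv_f inv_inv_eq bij_imp_bij_inv)
qed

text \<open>Stated for every family between \<open>BPL2\<close> and \<open>PL2\<close>, which
  identifies \<open>germs_B2\<close> with \<open>germs_P2\<close>: elements of \<open>PL2\<close>
  have only dyadic piecewise linear germs, and the bumps in \<open>BPL2\<close> already generate all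
  of these.\<close>

lemma line_germ_iff:
  assumes \<F>: "BPL2 \<subseteq> \<F>" "\<F> \<subseteq> PL2"
  shows "germ x f \<in> generated_groupoid ({UNIV} \<times> \<F>) x (f x) \<longleftrightarrow> pl2_at f x"
proof
  assume "germ x f \<in> generated_groupoid ({UNIV} \<times> \<F>) x (f x)"
  then have gen: "generated_germ ({UNIV} \<times> \<F>) x (f x) (germ x f)" by (simp add: generated_groupoid_def)
  have "pl2_at f x \<and> f x = f x"
    by (rule generated_germ_predicate[where P = "\<lambda>x f. pl2_at f x", OF gen])
      (use \<F> pl2_at_PL2 pl2_at_cong pl2_at_compose pl2_at_local_inverse(1) in blast)+
  then show "pl2_at f x" by simp
next
  have mem: "(UNIV, bump c w) \<in> {UNIV} \<times> \<F>" if "c \<in> dyadics" "w \<in> dyadics" "0 < w" for c w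
    using bump_BPL2[OF that] \<F>(1) by auto
  interpret bump_closed "\<lambda>x f. generated_germ ({UNIV} \<times> \<F>) x (f x) (germ x f)"
  proof
    show "generated_germ ({UNIV} \<times> \<F>) x (g x) (germ x g)"
      if "generated_germ ({UNIV} \<times> \<F>) x (f x) (germ x f)" "\<forall>\<^sub>F t in nhds x. g t = f t" for x f g
      using that by (rule generated_germ_cong)
    show "generated_germ ({UNIV} \<times> \<F>) x ((g \<circ> f) x) (germ x (g \<circ> f))"
      if "generated_germ ({UNIV} \<times> \<F>) x (f x) (germ x f)" "generated_germ ({UNIV} \<times> \<F>) (f x) (g (f x)) (germ (f x) g)"
      for x f g using generated_germ.composition[OF that] by simp
    fix c w x :: real assume cw: "c \<in> dyadics" "w \<in> dyadics" "0 < w"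
    show "generated_germ ({UNIV} \<times> \<F>) x (bump c w x) (germ x (bump c w))"
      using mem[OF cw] by (rule generated_germ.generator) simp
    fix g assume "\<forall>\<^sub>F t in nhds x. g (bump c w t) = t"
    moreover have "homeo (bump c w)" using bump_BPL2[OF cw] by (simp add: BPL2_def PL2_def)
    ultimately show "generated_germ ({UNIV} \<times> \<F>) (bump c w x) (g (bump c w x)) (germ (bump c w x) g)"
      using mem[OF cw] by (intro generated_germ_inverse)
  qed
  show "pl2_at f x \<Longrightarrow> germ x f \<in> generated_groupoid ({UNIV} \<times> \<F>) x (f x)"
    using all_germs_at by (simp add: generated_groupoid_def)
qed

lemma line_normalizer:
  assumes \<F>: "BPL2 \<subseteq> \<F>" "\<F> \<subseteq> PL2" and h: "homeo h" "strict_mono h"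
    and norm: "normalizes h (generated_groupoid ({UNIV} \<times> \<F>))"
  shows "pl2_at h x"
proof -
  note iff = line_germ_iff[OF \<F>]
  have conj: "pl2_at (k \<circ> f \<circ> inv k) (k x)"
    if k: "preserves (generated_groupoid ({UNIV} \<times> \<F>)) k" "homeo k" and f: "pl2_at f x" for k f x
  proof -
    obtain U where U: "open U" "x \<in> U" "\<And>y. y \<in> U \<Longrightarrow> pl2_at f y"
      using pl2_at_nhds[OF f] unfolding eventually_nhds by blast
    have "germ (k x) (k \<circ> f \<circ> inv k) \<in> generated_groupoid ({UNIV} \<times> \<F>) (k x) (k (f x))"
      by (rule preserves_germ[OF k(1) homeo_inv(1)[OF k(2)] U(1,2)]) (simp add: iff U(3))
    also have "k (f x) = (k \<circ> f \<circ> inv k) (k x)" by (simp add: homeo_inv(5)[OF k(2)])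
    finally show ?thesis unfolding iff .
  qed
  interpret pl2_conjugation h "inv h"
  proof
    show "strict_mono h" by (rule h)
    show "h (inv h x) = x" "inv h (h x) = x" for x using homeo_inv[OF h(1)] by simp_all
    show "isCont h x" for x
      using homeo_inv(7)[OF h(1)] by (simp add: continuous_on_eq_continuous_at)
    fix f x assume f: "pl2_at f x"
    show "pl2_at (h \<circ> f \<circ> inv h) (h x)"
      using norm by (intro conj h(1) f) (simp add: normalizes_def)
    have "pl2_at (inv h \<circ> f \<circ> inv (inv h)) (inv h x)"
      using norm by (intro conj f homeo_inv(6)[OF h(1)]) (simp add: normalizes_def)
    then show "pl2_at (inv h \<circ> f \<circ> h) (inv h x)" by (simp add: homeo_inv(3)[OF h(1)])
  qed
  show ?thesis by (rule pl2_at_everywhere)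
qed

lemma line_normalizer_compatible:
  assumes "homeo h" "strict_mono h" "normalizes h germs_B2 \<or> normalizes h germs_P2"
  shows "compatible germs_P2 h"
proof -
  have sub: "BPL2 \<subseteq> PL2" by (auto simp: BPL2_def)
  have "pl2_at h x" for x
    using assms(3)
  proof
    assume "normalizes h germs_B2"
    then show ?thesis
      unfolding germs_B2_def by (rule line_normalizer[OF order_refl sub assms(1,2)])
  next
    assume "normalizes h germs_P2"
    then show ?thesis
      unfolding germs_P2_def by (rule line_normalizer[OF sub order_refl assms(1,2)])
  qed
  then show ?thesis
    unfolding compatible_def compatible_functions_def germs_P2_def
    by (auto simp: line_germ_iff[OF sub order_refl])
qed

section \<open>Germs on the circle\<close>

lemma to_circle_eq_iff: "to_circle x = to_circle y \<longleftrightarrow> x - y \<in> \<int>"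
  by (rule circle.abs_eq_iff)

lemma to_circle_add_of_int [simp]: "to_circle (x + of_int n) = to_circle x"
  by (simp add: to_circle_eq_iff)

lemma to_circle_cases: obtains x where "p = to_circle x"
  by (metis Quotient3_abs_rep Quotient3_circle)

text \<open>The projection is continuous and open: the preimage of the image of an open set is the
  union of its integer translates. This moves statements about germs from the circle to the
  line.\<close>

lemma eventually_nhds_to_circle:
  "(\<forall>\<^sub>F p in nhds (to_circle x). Q p) \<longleftrightarrow> (\<forall>\<^sub>F t in nhds x. Q (to_circle t))"
proof
  assume "\<forall>\<^sub>F p in nhds (to_circle x). Q p"
  then obtain S where S: "open S" "to_circle x \<in> S" "\<And>p. p \<in> S \<Longrightarrow> Q p" unfolding eventually_nhds by blast
  have "open (to_circle -` S)" using S(1) by (simp add: open_circle_def)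
  then show "\<forall>\<^sub>F t in nhds x. Q (to_circle t)"
    unfolding eventually_nhds using S by (intro exI[of _ "to_circle -` S"]) auto
next
  assume "\<forall>\<^sub>F t in nhds x. Q (to_circle t)"
  then obtain T where T: "open T" "x \<in> T" "\<And>t. t \<in> T \<Longrightarrow> Q (to_circle t)" unfolding eventually_nhds by blast
  have "to_circle -` to_circle ` T = (\<Union>n::int. (\<lambda>t. of_int n + t) ` T)"
  proof (intro set_eqI iffI)
    fix s assume "s \<in> to_circle -` to_circle ` T"
    then obtain t where t: "t \<in> T" "s - t \<in> \<int>" by (auto simp: to_circle_eq_iff)
    then obtain n where "s - t = of_int n" by (auto elim: Ints_cases)
    then have "s = of_int n + t" by simp
    then show "s \<in> (\<Union>n::int. (\<lambda>t. of_int n + t) ` T)" using t(1) by blast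
  next
    fix s assume "s \<in> (\<Union>n::int. (\<lambda>t. of_int n + t) ` T)"
    then show "s \<in> to_circle -` to_circle ` T" by (auto simp: add.commute[of "of_int _"])
  qed
  moreover have "open (\<Union>n::int. (\<lambda>t. of_int n + t) ` T)"
    using open_translation[OF T(1)] by (intro open_UN) auto
  ultimately have "open (to_circle ` T)" by (simp add: open_circle_def)
  then show "\<forall>\<^sub>F p in nhds (to_circle x). Q p"
    unfolding eventually_nhds using T by (intro exI[of _ "to_circle ` T"]) auto
qed

definition lifts_near :: "real \<Rightarrow> (real \<Rightarrow> real) \<Rightarrow> (circle \<Rightarrow> circle) \<Rightarrow> bool" where
  "lifts_near x F f \<longleftrightarrow> (\<forall>\<^sub>F t in nhds x. f (to_circle t) = to_circle (F t))"

lemma lifts_near_at: "lifts_near x F f \<Longrightarrow> f (to_circle x) = to_circle (F x)"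
  unfolding lifts_near_def by (rule eventually_nhds_x_imp_x)

text \<open>\<open>F\<close> is composed with a local inverse \<open>s\<close> of the projection.
  Two points within \<open>1/2\<close> of \<open>x\<close> that differ by an integer coincide, so
  the choice in \<open>s\<close> is forced near \<open>x\<close>.\<close>

lemma lifts_near_exists: "\<exists>f. lifts_near x F f"
proof -
  define s where "s p = (SOME t. \<bar>t - x\<bar> < 1/2 \<and> to_circle t = p)" for p
  have "\<forall>\<^sub>F t in nhds x. t \<in> {x - 1/2<..<x + 1/2}" by (intro eventually_nhds_in_open) auto
  then have "\<forall>\<^sub>F t in nhds x. to_circle (F (s (to_circle t))) = to_circle (F t)"
  proof eventually_elim
    case (elim t)
    then have "\<bar>t - x\<bar> < 1/2 \<and> to_circle t = to_circle t" by (auto simp: abs_if)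
    then have s: "\<bar>s (to_circle t) - x\<bar> < 1/2 \<and> to_circle (s (to_circle t)) = to_circle t"
      unfolding s_def by (rule someI)
    then have "s (to_circle t) - t \<in> \<int>" by (simp add: to_circle_eq_iff)
    moreover have "x - 1/2 < t" "t < x + 1/2" using elim by auto
    then have "\<bar>s (to_circle t) - t\<bar> < 1" using s by linarith
    ultimately have "s (to_circle t) - t = 0" using Ints_nonzero_abs_ge1 by fastforce
    then show ?case by simp
  qed
  then show ?thesis
    unfolding lifts_near_def by (intro exI[of _ "\<lambda>p. to_circle (F (s p))"])
qed

lemma lifts_near_unique:
  assumes "lifts_near x F f" "lifts_near x F g"
  shows "\<forall>\<^sub>F p in nhds (to_circle x). f p = g p"
  using assms unfolding lifts_near_def eventually_nhds_to_circle by eventually_elim simp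

lemma lifts_near_cong:
  assumes "lifts_near x F f" "\<forall>\<^sub>F p in nhds (to_circle x). g p = f p"
  shows "lifts_near x F g"
  using assms unfolding lifts_near_def eventually_nhds_to_circle by eventually_elim simp

lemma lifts_near_compose:
  assumes "lifts_near x F f" "lifts_near (F x) G g" "filterlim F (nhds (F x)) (nhds x)"
  shows "lifts_near x (G \<circ> F) (g \<circ> f)"
proof -
  have "\<forall>\<^sub>F t in nhds x. g (to_circle (F t)) = to_circle (G (F t))"
    using assms(2,3) unfolding lifts_near_def filterlim_iff by blast
  then show ?thesis
    using assms(1) unfolding lifts_near_def by eventually_elim simp
qed

definition circle_pl2_at :: "(circle \<Rightarrow> circle) \<Rightarrow> real \<Rightarrow> bool" where
  "circle_pl2_at f x \<longleftrightarrow> (\<exists>F. pl2_at F x \<and> lifts_near x F f)"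

lemma circle_pl2_at_cong:
  "circle_pl2_at f x \<Longrightarrow> \<forall>\<^sub>F p in nhds (to_circle x). g p = f p \<Longrightarrow> circle_pl2_at g x"
  unfolding circle_pl2_at_def using lifts_near_cong by blast

lemma pl2_at_translate:
  assumes "pl2_at f x" shows "pl2_at (\<lambda>t. f t + of_int n) x"
proof -
  have "pl2_at ((\<lambda>t. t + of_int n) \<circ> f) x"
    using pl2_at_affine[of "of_int n" 0] by (intro pl2_at_compose[OF assms]) simp
  then show ?thesis by (simp add: o_def)
qed

text \<open>Lifts may be corrected by an integer, so the end of one lift can be matched with the
  start of the next.\<close>

lemma circle_pl2_at_lift:
  assumes "circle_pl2_at f x" "f (to_circle x) = to_circle y"
  shows "\<exists>F. pl2_at F x \<and> lifts_near x F f \<and> F x = y"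
proof -
  obtain F where F: "pl2_at F x" "lifts_near x F f" using assms(1) unfolding circle_pl2_at_def by blast
  have "y - F x \<in> \<int>" using lifts_near_at[OF F(2)] assms(2) by (simp flip: to_circle_eq_iff)
  then obtain n where n: "y - F x = of_int n" by (auto elim: Ints_cases)
  have "lifts_near x (\<lambda>t. F t + of_int n) f" using F(2) by (simp add: lifts_near_def)
  then show ?thesis
    using pl2_at_translate[OF F(1), of n] n by (intro exI[of _ "\<lambda>t. F t + of_int n"]) simp
qed

lemma circle_pl2_at_compose:
  assumes f: "circle_pl2_at f x" and g: "circle_pl2_at g y" and y: "f (to_circle x) = to_circle y"
  shows "circle_pl2_at (g \<circ> f) x"
proof -
  obtain F where F: "pl2_at F x" "lifts_near x F f" "F x = y" using circle_pl2_at_lift[OF f y] by blast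
  obtain G where G: "pl2_at G y" "lifts_near y G g" using g unfolding circle_pl2_at_def by blast
  have "pl2_at (G \<circ> F) x" using pl2_at_compose[OF F(1)] G(1) F(3) by simp
  moreover have "lifts_near x (G \<circ> F) (g \<circ> f)"
    using F(2) G(2) pl2_at_filterlim(3)[OF F(1)] F(3) by (intro lifts_near_compose) auto
  ultimately show ?thesis unfolding circle_pl2_at_def by blast
qed

text \<open>The local inverse \<open>G\<close> of the lift \<open>F\<close> lifts \<open>g\<close>:
  evaluate \<open>g (f p) = p\<close> at the projection of \<open>G s\<close> and use
  \<open>F (G s) = s\<close>.\<close>

lemma circle_pl2_at_inverse:
  assumes f: "circle_pl2_at f x" and y: "f (to_circle x) = to_circle y"
    and ev: "\<forall>\<^sub>F p in nhds (to_circle x). g (f p) = p"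
  shows "circle_pl2_at g y"
proof -
  obtain F where F: "pl2_at F x" "lifts_near x F f" "F x = y" using circle_pl2_at_lift[OF f y] by blast
  obtain G where G: "G y = x" "\<forall>\<^sub>F t in nhds x. G (F t) = t"
    using pl2_at_local_inverse_exists[OF F(1)] F(3) by blast
  note inv = pl2_at_local_inverse[OF F(1) G(2), unfolded F(3)]
  have lim: "filterlim G (nhds x) (nhds y)" using pl2_at_filterlim(3)[OF inv(1)] G(1) by simp
  have "\<forall>\<^sub>F t in nhds x. f (to_circle t) = to_circle (F t)" using F(2) by (simp add: lifts_near_def)
  then have 1: "\<forall>\<^sub>F s in nhds y. f (to_circle (G s)) = to_circle (F (G s))"
    using lim unfolding filterlim_iff by blast
  have "\<forall>\<^sub>F t in nhds x. g (f (to_circle t)) = to_circle t" using ev by (simp add: eventually_nhds_to_circle)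
  then have 2: "\<forall>\<^sub>F s in nhds y. g (f (to_circle (G s))) = to_circle (G s)"
    using lim unfolding filterlim_iff by blast
  have "lifts_near y G g"
    unfolding lifts_near_def using 1 2 inv(2) by eventually_elim simp
  then show ?thesis using inv(1) unfolding circle_pl2_at_def by blast
qed

lemma circle_pl2_at_T21:
  assumes "f \<in> T21"
  shows "circle_pl2_at f x"
proof -
  obtain F where F: "circle_lift F f" "piecewise_linear F" "power_of_two_slopes F" "to_circle ` breaks F \<subseteq> circle_dyadics"
    and dy: "f ` circle_dyadics \<subseteq> circle_dyadics"
    using assms unfolding T21_def by blast
  have lift: "f (to_circle t) = to_circle (F t)" for t using F(1) by (simp add: circle_lift_def)
  \<comment> \<open>Integers are dyadic, so whether a representative is dyadic depends only on its
    class.\<close>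
  have cd: "t \<in> dyadics" if "to_circle t \<in> circle_dyadics" for t
  proof -
    obtain u where u: "u \<in> dyadics" "t - u \<in> \<int>"
      using \<open>to_circle t \<in> circle_dyadics\<close> by (auto simp: circle_dyadics_def to_circle_eq_iff)
    then have "(t - u) + u \<in> dyadics" using dyadics_Ints by (intro dyadics_add) auto
    then show ?thesis by simp
  qed
  have "pl2_at F x"
  proof (rule pl2_at_piecewise_linear[OF _ F(2,3)])
    show "isCont F x" using F(1) by (simp add: circle_lift_def continuous_on_eq_continuous_at)
    show "breaks F \<subseteq> dyadics" using F(4) cd by blast
    show "F t \<in> dyadics" if "t \<in> dyadics" for t
      using that dy lift[of t] by (intro cd) (force simp: circle_dyadics_def)
  qed
  then show ?thesis unfolding circle_pl2_at_def lifts_near_def using lift by auto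
qed

text \<open>\<open>homeo\<close> is carried through the induction because the case of inverses needs
  a bijective \<open>f\<close>.\<close>

lemma circle_pl2_at_BT21:
  assumes "f \<in> BT21"
  shows "homeo f \<and> (\<forall>x. circle_pl2_at f x)"
  using assms unfolding BT21_def
proof induction
  case one
  have "lifts_near x (\<lambda>t. t) id" for x by (simp add: lifts_near_def)
  moreover have "pl2_at (\<lambda>t. t) x" for x using pl2_at_affine[of 0 0 x] by simp
  ultimately have "circle_pl2_at id x" for x unfolding circle_pl2_at_def by blast
  moreover have "homeo (id :: circle \<Rightarrow> circle)" unfolding homeo_def id_def using homeomorphism_ident by blast
  ultimately show ?case by blast
next
  case (incl f)
  then show ?case using circle_pl2_at_T21 by (auto simp: T21_def)
next
  case (inverse f)
  then have h: "homeo f" by blast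
  have "circle_pl2_at (inv f) y" for y
  proof -
    obtain x where x: "inv f (to_circle y) = to_circle x" by (rule to_circle_cases)
    have fx: "f (to_circle x) = to_circle y" unfolding x[symmetric] by (rule homeo_inv(4)[OF h])
    show ?thesis
    proof (rule circle_pl2_at_inverse[of f x, OF _ fx])
      show "circle_pl2_at f x" using inverse.IH by blast
      show "\<forall>\<^sub>F p in nhds (to_circle x). inv f (f p) = p" by (simp add: homeo_inv(5)[OF h])
    qed
  qed
  then show ?case using homeo_inv(6)[OF h] by blast
next
  case (comp f g)
  have "homeo (f \<circ> g)" using comp.IH unfolding homeo_def by (metis homeomorphism_compose)
  moreover have "circle_pl2_at (f \<circ> g) x" for x
    by (rule to_circle_cases[of "g (to_circle x)"]) (use comp.IH circle_pl2_at_compose in blast)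
  ultimately show ?case by blast
qed

section \<open>Bumps on the circle\<close>

lemma periodic_of_int:
  fixes F :: "real \<Rightarrow> real"
  assumes per: "\<And>t. F (t + 1) = F t + 1"
  shows "F (t + of_int n) = F t + of_int n"
proof -
  have nat: "F (t + of_nat n) = F t + of_nat n" for t n
  proof (induction n)
    case (Suc n)
    then show ?case using per[of "t + of_nat n"] by (simp add: algebra_simps)
  qed simp
  show ?thesis
  proof (cases "n \<ge> 0")
    case True
    then show ?thesis using nat[of t "nat n"] by simp
  next
    case False
    then show ?thesis using nat[of "t + of_int n" "nat (- n)"] by simp
  qed
qed

lemma circle_map_of_periodic:
  assumes per: "\<And>t. F (t + 1) = F t + 1"
  shows "\<exists>f. \<forall>t. f (to_circle t) = to_circle (F t)"
proof (intro exI allI)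
  fix t
  have "rep_circle (to_circle t) - t \<in> \<int>"
    unfolding to_circle_eq_iff[symmetric] by (metis Quotient3_abs_rep Quotient3_circle)
  then obtain n where "rep_circle (to_circle t) - t = of_int n" by (auto elim: Ints_cases)
  then have "rep_circle (to_circle t) = t + of_int n" by simp
  then show "(\<lambda>p. to_circle (F (rep_circle p))) (to_circle t) = to_circle (F t)"
    using periodic_of_int[of F, OF per] by simp
qed

lemma circle_continuous:
  assumes "continuous_on UNIV F" "\<And>t. f (to_circle t) = to_circle (F t)"
  shows "continuous_on UNIV f"
  unfolding continuous_on_open_vimage[OF open_UNIV]
proof (intro allI impI)
  fix S :: "circle set" assume "open S"
  then have "open (to_circle -` S)" by (simp add: open_circle_def)
  then have "open (F -` (to_circle -` S))"
    using assms(1) by (simp add: continuous_on_open_vimage)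
  moreover have "to_circle -` (f -` S) = F -` (to_circle -` S)" using assms(2) by auto
  ultimately show "open (f -` S \<inter> UNIV)" by (simp add: open_circle_def)
qed

lemma circle_homeo_of_periodic:
  assumes per: "\<And>t. F (t + 1) = F t + 1" and F: "homeo F" and f: "\<And>t. f (to_circle t) = to_circle (F t)"
  shows "homeo f"
proof -
  obtain G where G: "homeomorphism UNIV UNIV F G" using F unfolding homeo_def by blast
  then have inv: "\<And>t. G (F t) = t" "\<And>t. F (G t) = t" and cont: "continuous_on UNIV F" "continuous_on UNIV G"
    by (simp_all add: homeomorphism_def)
  have "G (t + 1) = G t + 1" for t using per[of "G t"] inv by metis
  then obtain g where g: "\<And>t. g (to_circle t) = to_circle (G t)" using circle_map_of_periodic by blast
  have "g (f p) = p" "f (g p) = p" for p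
    by (cases p rule: to_circle_cases; simp add: f g inv)+
  moreover have "continuous_on UNIV f" "continuous_on UNIV g"
    using circle_continuous cont f g by blast+
  ultimately have "homeomorphism UNIV UNIV f g" by (auto intro!: homeomorphismI)
  then show ?thesis unfolding homeo_def by blast
qed

text \<open>The set of breaks of \<open>F\<close> is invariant under integer translations, so its
  isolation on the line passes to its image on the circle.\<close>

lemma T21_of_periodic:
  assumes per: "\<And>t. F (t + 1) = F t + 1" and F: "homeo F" "strict_mono F" "\<And>x. pl2_at F x"
    and f: "\<And>t. f (to_circle t) = to_circle (F t)"
  shows "f \<in> T21"
proof -
  have shift: "x + of_int n \<notin> breaks F" if nb: "x \<notin> breaks F" for x n
  proof -
    obtain k :: int and c where "\<forall>\<^sub>F t in nhds x. F t = 2 powi k * t + c"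
      using pl2_at_not_break[OF F(3) nb] by blast
    moreover have "((\<lambda>t. t - of_int n) \<longlongrightarrow> x + of_int n - of_int n) (nhds (x + of_int n))"
      by (intro tendsto_intros filterlim_ident)
    then have "filterlim (\<lambda>t. t - of_int n) (nhds x) (nhds (x + of_int n))" by simp
    ultimately have "\<forall>\<^sub>F t in nhds (x + of_int n). F (t - of_int n) = 2 powi k * (t - of_int n) + c"
      unfolding filterlim_iff by blast
    then have "\<forall>\<^sub>F t in nhds (x + of_int n). F t = 2 powi k * t + (c + of_int n - 2 powi k * of_int n)"
    proof eventually_elim
      case (elim t)
      have "F t = F (t - of_int n) + of_int n" using periodic_of_int[of F "t - of_int n" n, OF per] by simp
      then show ?case using elim by (simp add: algebra_simps)
    qed
    then show ?thesis by (rule affine_near_not_break)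
  qed
  have "discrete (to_circle ` breaks F)"
    unfolding discrete_def isolated_in_def
  proof (intro ballI conjI)
    fix p assume p: "p \<in> to_circle ` breaks F"
    then obtain x where x: "x \<in> breaks F" "p = to_circle x" by blast
    obtain U where U: "open U" "x \<in> U" "U \<inter> breaks F \<subseteq> {x}" using breaks_isolated[OF F(3)] by blast
    have "\<forall>\<^sub>F t in nhds x. t \<in> U" using U by (intro eventually_nhds_in_open)
    then have "\<forall>\<^sub>F t in nhds x. to_circle t \<in> to_circle ` breaks F \<longrightarrow> to_circle t = p"
    proof eventually_elim
      case (elim t)
      show ?case
      proof
        assume "to_circle t \<in> to_circle ` breaks F"
        then obtain y where y: "y \<in> breaks F" "t - y \<in> \<int>" by (auto simp: to_circle_eq_iff)
        then obtain n where "t - y = of_int n" by (auto elim: Ints_cases)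
        then have "y = t + of_int (- n)" by simp
        then have "t \<in> breaks F" using shift[of t "- n"] y(1) by blast
        then show "to_circle t = p" using elim U(3) x(2) by blast
      qed
    qed
    then have "\<forall>\<^sub>F q in nhds p. q \<in> to_circle ` breaks F \<longrightarrow> q = p"
      unfolding x(2) eventually_nhds_to_circle .
    then obtain T where "open T" "p \<in> T" "\<And>q. q \<in> T \<Longrightarrow> q \<in> to_circle ` breaks F \<longrightarrow> q = p"
      unfolding eventually_nhds by blast
    then show "\<exists>T. open T \<and> T \<inter> to_circle ` breaks F = {p}" using p by (intro exI[of _ T]) blast
  qed
  moreover have "circle_lift F f"
    using homeo_inv(7)[OF F(1)] f by (simp add: circle_lift_def)
  moreover have "to_circle ` breaks F \<subseteq> circle_dyadics"
    using breaks_subset_dyadics[OF F(3)] unfolding circle_dyadics_def by blast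
  moreover have "f ` circle_dyadics \<subseteq> circle_dyadics"
    using pl2_at_dyadics[OF F(3)] f unfolding circle_dyadics_def by auto
  moreover have "homeo f" by (rule circle_homeo_of_periodic[of F, OF per F(1) f])
  ultimately show ?thesis
    unfolding T21_def using F(2) piecewise_linear_pl2_at[OF F(3)] by blast
qed

text \<open>The bump is repeated with period 1. Its support has length at most \<open>1/2\<close>,
  so half of the circle stays fixed and the resulting map is among the generators of
  \<open>BT21\<close>.\<close>

lemma circle_bump:
  assumes c: "c \<in> dyadics" and w: "w \<in> dyadics" "0 < w" "w \<le> 1/8"
  shows "\<exists>f. f \<in> T21 \<and> (\<exists>a b. a < b \<and> (\<forall>p \<in> to_circle ` {a<..<b}. f p = p)) \<and>
    (\<forall>x. c \<le> x \<longrightarrow> x \<le> c + 4 * w \<longrightarrow> lifts_near x (bump c w) f)"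
proof -
  define B where "B t = of_int \<lfloor>t - c\<rfloor> + bump c w (t - of_int \<lfloor>t - c\<rfloor>)" for t
  have out: "bump c w t = t" if "t \<le> c \<or> c + 1/2 \<le> t" for t using that w by (auto simp: bump_def)
  \<comment> \<open>The formula of the \<open>n\<close>-th period also holds on the half period
    before it, where both neighbouring copies are the identity. So it is valid around the boundary
    point \<open>c + of_int n\<close> too.\<close>
  have loc: "B t = of_int n + bump c w (t - of_int n)" if t: "c + of_int n - 1/2 < t" "t < c + of_int n + 1" for t n
  proof (cases "c + of_int n \<le> t")
    case True
    then have "\<lfloor>t - c\<rfloor> = n" using t by (simp add: floor_eq_iff)
    then show ?thesis by (simp add: B_def)
  next
    case False
    then have "\<lfloor>t - c\<rfloor> = n - 1" using t by (simp add: floor_eq_iff)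
    then show ?thesis using False t out[of "t - (of_int n - 1)"] out[of "t - of_int n"] by (simp add: B_def)
  qed
  have near: "\<forall>\<^sub>F t in nhds x. B t = of_int n + bump c w (t - of_int n)" if "n = \<lfloor>x - c\<rfloor>" for x n
  proof -
    have "\<forall>\<^sub>F t in nhds x. t \<in> {c + of_int n - 1/2<..<c + of_int n + 1}"
      unfolding that by (intro eventually_nhds_in_open) (auto, linarith+)
    then show ?thesis by eventually_elim (auto intro: loc)
  qed
  have per: "B (t + 1) = B t + 1" for t
  proof -
    have "\<lfloor>t + 1 - c\<rfloor> = \<lfloor>t - c\<rfloor> + 1" using floor_add_int[of "t - c" 1] by (simp add: algebra_simps)
    then show ?thesis by (simp add: B_def)
  qed
  have pl: "pl2_at B x" for x
  proof -
    define n where "n = \<lfloor>x - c\<rfloor>"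
    have "pl2_at (\<lambda>t. t - of_int n) x" using pl2_at_affine[of "- of_int n" 0 x] by simp
    then have "pl2_at (bump c w \<circ> (\<lambda>t. t - of_int n)) x"
      by (rule pl2_at_compose) (rule pl2_at_bump[OF c w(1,2)])
    from pl2_at_translate[OF this, of n] show ?thesis
      by (rule pl2_at_cong) (use near[OF n_def] in \<open>simp add: add.commute\<close>)
  qed
  have mono: "strict_mono B"
  proof (rule strict_monoI)
    fix s t :: real assume st: "s < t"
    note bm = strict_mono_less[OF bump_strict_mono[OF w(2)], of c]
    show "B s < B t"
    proof (cases "\<lfloor>s - c\<rfloor> = \<lfloor>t - c\<rfloor>")
      case True
      then show ?thesis using st by (simp add: B_def bm)
    next
      case False
      then have "\<lfloor>s - c\<rfloor> + 1 \<le> \<lfloor>t - c\<rfloor>" using st floor_mono[of "s - c" "t - c"] by linarith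
      \<comment> \<open>Values in different periods are separated by a boundary point, which
        \<open>B\<close> fixes.\<close>
      then have "of_int \<lfloor>s - c\<rfloor> + 1 \<le> (of_int \<lfloor>t - c\<rfloor> :: real)" by linarith
      moreover have "bump c w (s - of_int \<lfloor>s - c\<rfloor>) < bump c w (c + 1)" unfolding bm by linarith
      then have "bump c w (s - of_int \<lfloor>s - c\<rfloor>) < c + 1" by (simp add: out)
      moreover have "\<not> bump c w (t - of_int \<lfloor>t - c\<rfloor>) < bump c w c" unfolding bm by linarith
      then have "c \<le> bump c w (t - of_int \<lfloor>t - c\<rfloor>)" by (simp add: out)
      ultimately show ?thesis unfolding B_def by linarith
    qed
  qed
  have Bn: "B (c + of_int n) = c + of_int n" for n by (simp add: B_def out)
  have "homeo B"
  proof (rule homeo_real[OF mono pl2_at_filterlim(4)[OF pl]])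
    show "\<exists>x. B x \<le> y" for y using Bn[of "\<lfloor>y - c\<rfloor>"] by (intro exI[of _ "c + of_int \<lfloor>y - c\<rfloor>"]) linarith
    show "\<exists>x. y \<le> B x" for y using Bn[of "\<lceil>y - c\<rceil>"] by (intro exI[of _ "c + of_int \<lceil>y - c\<rceil>"]) linarith
  qed
  moreover obtain f where f: "\<And>t. f (to_circle t) = to_circle (B t)"
    using circle_map_of_periodic[of B, OF per] by blast
  ultimately have "f \<in> T21" using mono pl per by (intro T21_of_periodic[of B])
  moreover have "f p = p" if p: "p \<in> to_circle ` {c + 1/2<..<c + 1}" for p
  proof -
    obtain t where t: "p = to_circle t" "c + 1/2 < t" "t < c + 1" using p by auto
    then show ?thesis using loc[of 0 t] out[of t] by (simp add: f)
  qed
  then have "\<exists>a b. a < b \<and> (\<forall>p \<in> to_circle ` {a<..<b}. f p = p)"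
    by (intro exI[of _ "c + 1/2"] exI[of _ "c + 1"]) simp
  moreover have "lifts_near x (bump c w) f" if x: "c \<le> x" "x \<le> c + 4 * w" for x
  proof -
    have "\<lfloor>x - c\<rfloor> = 0" using x w by (simp add: floor_eq_iff)
    then have "\<forall>\<^sub>F t in nhds x. B t = bump c w t" using near[of 0 x] by simp
    then show ?thesis unfolding lifts_near_def f by eventually_elim simp
  qed
  ultimately show ?thesis by blast
qed

section \<open>The groupoids on the circle\<close>

text \<open>Generation is proved on the line: \<open>bump_closed\<close> is interpreted for a
  predicate on lifts, so the construction of germs from bumps serves the circle unchanged.\<close>

lemma circle_germ_iff:
  assumes bumps: "{f \<in> T21. \<exists>a b. a < b \<and> (\<forall>p \<in> to_circle ` {a<..<b}. f p = p)} \<subseteq> \<F>"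
    and pl: "\<And>f x. f \<in> \<F> \<Longrightarrow> circle_pl2_at f x"
  shows "germ (to_circle x) f \<in> generated_groupoid ({UNIV} \<times> \<F>) (to_circle x) (f (to_circle x)) \<longleftrightarrow> circle_pl2_at f x"
proof
  assume "germ (to_circle x) f \<in> generated_groupoid ({UNIV} \<times> \<F>) (to_circle x) (f (to_circle x))"
  then have gen: "generated_germ ({UNIV} \<times> \<F>) (to_circle x) (f (to_circle x)) (germ (to_circle x) f)"
    by (simp add: generated_groupoid_def)
  define P where "P p f \<longleftrightarrow> (\<forall>x. to_circle x = p \<longrightarrow> circle_pl2_at f x)" for p f
  have "P (to_circle x) f \<and> f (to_circle x) = f (to_circle x)"
  proof (rule generated_germ_predicate[where P = P, OF gen])
    show "P p f" if "(U, f) \<in> {UNIV} \<times> \<F>" for U f p using that pl by (auto simp: P_def)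
    show "P p g" if "P p f" "\<forall>\<^sub>F z in nhds p. g z = f z" for p f g
      using that circle_pl2_at_cong unfolding P_def by blast
    show "P p (g \<circ> f)" if f: "P p f" and g: "P (f p) g" for p f g
      unfolding P_def
    proof (intro allI impI)
      fix x assume "to_circle x = p"
      moreover obtain y where "f p = to_circle y" by (rule to_circle_cases)
      ultimately show "circle_pl2_at (g \<circ> f) x"
        using f g unfolding P_def by (intro circle_pl2_at_compose[of f x g y]) auto
    qed
    show "P (f p) g" if f: "P p f" and ev: "\<forall>\<^sub>F z in nhds p. g (f z) = z" for p f g
      unfolding P_def
    proof (intro allI impI)
      fix y assume y: "to_circle y = f p"
      obtain x where x: "p = to_circle x" by (rule to_circle_cases)
      show "circle_pl2_at g y"
      proof (rule circle_pl2_at_inverse[of f x])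
        show "circle_pl2_at f x" using f x by (simp add: P_def)
        show "f (to_circle x) = to_circle y" using x y by simp
        show "\<forall>\<^sub>F p in nhds (to_circle x). g (f p) = p" using ev x by simp
      qed
    qed
  qed simp
  then show "circle_pl2_at f x" by (simp add: P_def)
next
  \<comment> \<open>All circle maps lifted by \<open>F\<close> near \<open>x\<close> have the same
    germ, so it is enough to treat one of them (\<open>PI\<close>). The conjunct
    \<open>pl2_at F x\<close> supplies the continuity needed for composing lifts.\<close>
  define P where "P x F \<longleftrightarrow> pl2_at F x \<and> (\<forall>f. lifts_near x F f \<longrightarrow>
      generated_germ ({UNIV} \<times> \<F>) (to_circle x) (f (to_circle x)) (germ (to_circle x) f))" for x F
  have PI: "P x F" if "pl2_at F x" "lifts_near x F f"
    "generated_germ ({UNIV} \<times> \<F>) (to_circle x) (f (to_circle x)) (germ (to_circle x) f)" for x F f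
    unfolding P_def
  proof (intro conjI allI impI that(1))
    fix g assume "lifts_near x F g"
    from lifts_near_unique[OF this that(2)]
    show "generated_germ ({UNIV} \<times> \<F>) (to_circle x) (g (to_circle x)) (germ (to_circle x) g)"
      by (rule generated_germ_cong[OF that(3)])
  qed
  interpret bump_closed P
  proof
    show "P x G" if F: "P x F" and ev: "\<forall>\<^sub>F t in nhds x. G t = F t" for x F G
    proof -
      obtain f where f: "lifts_near x F f" using lifts_near_exists by blast
      have "lifts_near x G f"
        using f ev unfolding lifts_near_def by eventually_elim simp
      then show ?thesis using F f pl2_at_cong[OF _ ev] unfolding P_def[of x F] by (intro PI) auto
    qed
    show "P x (G \<circ> F)" if F: "P x F" and G: "P (F x) G" for x F G
    proof -
      obtain f g where fg: "lifts_near x F f" "lifts_near (F x) G g" using lifts_near_exists by metis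
      have pF: "pl2_at F x" and pG: "pl2_at G (F x)" using F G by (simp_all add: P_def)
      have "generated_germ ({UNIV} \<times> \<F>) (to_circle x) (to_circle (F x)) (germ (to_circle x) f)"
        using F fg(1) lifts_near_at[OF fg(1)] by (auto simp: P_def)
      moreover have "generated_germ ({UNIV} \<times> \<F>) (to_circle (F x)) (g (to_circle (F x))) (germ (to_circle (F x)) g)"
        using G fg(2) by (auto simp: P_def)
      ultimately have "generated_germ ({UNIV} \<times> \<F>) (to_circle x) (g (to_circle (F x))) (germ (to_circle x) (g \<circ> f))"
        by (rule generated_germ.composition)
      then have "generated_germ ({UNIV} \<times> \<F>) (to_circle x) ((g \<circ> f) (to_circle x)) (germ (to_circle x) (g \<circ> f))"
        by (simp add: lifts_near_at[OF fg(1)])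
      then show ?thesis
        by (rule PI[OF pl2_at_compose[OF pF pG] lifts_near_compose[OF fg pl2_at_filterlim(3)[OF pF]]])
    qed
    fix c w x :: real
    assume cw: "c \<in> dyadics" "w \<in> dyadics" "0 < w" "w \<le> 1/8" and x: "c \<le> x" "x \<le> c + 4 * w"
    obtain b where b: "b \<in> T21" "\<exists>a a'. a < a' \<and> (\<forall>p \<in> to_circle ` {a<..<a'}. b p = p)" "lifts_near x (bump c w) b"
      using circle_bump[OF cw] x by blast
    then have mem: "(UNIV, b) \<in> {UNIV} \<times> \<F>" using bumps by auto
    have pb: "pl2_at (bump c w) x" by (rule pl2_at_bump[OF cw(1-3)])
    show "P x (bump c w)"
      using generated_germ.generator[OF mem] by (intro PI[OF pb b(3)]) simp
    fix G assume G: "\<forall>\<^sub>F t in nhds x. G (bump c w t) = t"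
    obtain g where g: "lifts_near (bump c w x) G g" using lifts_near_exists by blast
    have "lifts_near x (G \<circ> bump c w) (g \<circ> b)"
      by (rule lifts_near_compose[OF b(3) g pl2_at_filterlim(3)[OF pb]])
    then have "\<forall>\<^sub>F p in nhds (to_circle x). g (b p) = p"
      using G unfolding eventually_nhds_to_circle lifts_near_def by eventually_elim simp
    then have "generated_germ ({UNIV} \<times> \<F>) (b (to_circle x)) (g (b (to_circle x))) (germ (b (to_circle x)) g)"
      using b(1) by (intro generated_germ_inverse[OF mem]) (auto simp: T21_def)
    then show "P (bump c w x) G"
      using pl2_at_local_inverse(1)[OF pb G] g unfolding lifts_near_at[OF b(3)] by (intro PI)
  qed
  assume "circle_pl2_at f x"
  then obtain F where F: "pl2_at F x" "lifts_near x F f" unfolding circle_pl2_at_def by blast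
  then have "P x F" by (intro all_germs_at)
  then show "germ (to_circle x) f \<in> generated_groupoid ({UNIV} \<times> \<F>) (to_circle x) (f (to_circle x))"
    using F(2) by (simp add: generated_groupoid_def P_def)
qed

section \<open>Normalizers on the circle\<close>

lemma integer_valued_eventually_const:
  fixes f :: "real \<Rightarrow> real"
  assumes "\<forall>\<^sub>F t in nhds x. f t \<in> \<int>" "isCont f x"
  shows "\<forall>\<^sub>F t in nhds x. f t = f x"
proof -
  have x: "f x \<in> \<int>" using eventually_nhds_x_imp_x[OF assms(1)] .
  have "(f \<longlongrightarrow> f x) (nhds x)" using assms(2) by (simp add: isCont_def tendsto_at_iff_tendsto_nhds)
  then have "\<forall>\<^sub>F t in nhds x. dist (f t) (f x) < 1" by (rule tendstoD) simp
  with assms(1) show ?thesis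
  proof eventually_elim
    case (elim t)
    have "f t - f x \<in> \<int>" using elim(1) x by (rule Ints_diff)
    moreover have "\<bar>f t - f x\<bar> < 1" using elim(2) by (simp add: dist_real_def)
    ultimately have "f t - f x = 0" using Ints_nonzero_abs_ge1 by fastforce
    then show ?case by simp
  qed
qed

text \<open>\<open>K \<circ> F \<circ> inv K\<close> lifts the conjugated circle germ, which has
  some dyadic piecewise linear lift \<open>G\<close>. Their difference is continuous with integer
  values near \<open>K x\<close>, hence locally a constant integer.\<close>

lemma circle_conjugation:
  assumes bumps: "{f \<in> T21. \<exists>a b. a < b \<and> (\<forall>p \<in> to_circle ` {a<..<b}. f p = p)} \<subseteq> \<F>"
    and pl: "\<And>f x. f \<in> \<F> \<Longrightarrow> circle_pl2_at f x"
    and k: "preserves (generated_groupoid ({UNIV} \<times> \<F>)) k" "homeo k"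
    and K: "\<And>t. k (to_circle t) = to_circle (K t)" "homeo K" and F: "pl2_at F x"
  shows "pl2_at (K \<circ> F \<circ> inv K) (K x)"
proof -
  have iff: "germ (to_circle x) f \<in> generated_groupoid ({UNIV} \<times> \<F>) (to_circle x) (f (to_circle x)) \<longleftrightarrow>
      circle_pl2_at f x" for x f
    by (rule circle_germ_iff[OF bumps pl])
  define L where "L = K \<circ> F \<circ> inv K"
  have inv_k: "inv k (to_circle t) = to_circle (inv K t)" for t
    using homeo_inv(5)[OF k(2), of "to_circle (inv K t)"] K(1)[of "inv K t"] homeo_inv(4)[OF K(2)] by simp
  obtain f where f: "lifts_near x F f" using lifts_near_exists by blast
  have "\<forall>\<^sub>F t in nhds x. lifts_near t F f"
    using f unfolding lifts_near_def by (simp add: eventually_eventually)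
  with pl2_at_nhds[OF F] have "\<forall>\<^sub>F t in nhds x. germ (to_circle t) f \<in>
      generated_groupoid ({UNIV} \<times> \<F>) (to_circle t) (f (to_circle t))"
    by eventually_elim (auto simp: iff circle_pl2_at_def)
  then have "\<forall>\<^sub>F p in nhds (to_circle x). germ p f \<in> generated_groupoid ({UNIV} \<times> \<F>) p (f p)"
    by (simp add: eventually_nhds_to_circle)
  then obtain U where U: "open U" "to_circle x \<in> U"
    "\<And>p. p \<in> U \<Longrightarrow> germ p f \<in> generated_groupoid ({UNIV} \<times> \<F>) p (f p)"
    unfolding eventually_nhds by blast
  have "germ (k (to_circle x)) (k \<circ> f \<circ> inv k) \<in>
      generated_groupoid ({UNIV} \<times> \<F>) (k (to_circle x)) (k (f (to_circle x)))"
    by (rule preserves_germ[OF k(1) homeo_inv(1)[OF k(2)] U])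
  moreover have "k (f (to_circle x)) = (k \<circ> f \<circ> inv k) (to_circle (K x))"
    by (simp add: inv_k homeo_inv(5)[OF K(2)])
  ultimately have "circle_pl2_at (k \<circ> f \<circ> inv k) (K x)"
    by (simp only: K(1) iff)
  then obtain G where G: "pl2_at G (K x)" "lifts_near (K x) G (k \<circ> f \<circ> inv k)"
    unfolding circle_pl2_at_def by blast
  have cont: "isCont K t" "isCont (inv K) t" for t
    using homeo_inv(7)[OF K(2)] homeo_inv(7)[OF homeo_inv(6)[OF K(2)]]
    by (simp_all add: continuous_on_eq_continuous_at)
  have invx: "inv K (K x) = x" by (rule homeo_inv(5)[OF K(2)])
  have "(inv K \<longlongrightarrow> inv K (K x)) (nhds (K x))"
    using cont(2)[of "K x"] by (simp only: isCont_def tendsto_at_iff_tendsto_nhds)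
  then have "\<forall>\<^sub>F t in nhds (K x). f (to_circle (inv K t)) = to_circle (F (inv K t))"
    using f unfolding lifts_near_def filterlim_iff invx by blast
  with G(2) have "\<forall>\<^sub>F t in nhds (K x). L t - G t \<in> \<int>"
    unfolding lifts_near_def by eventually_elim (simp add: inv_k K(1) to_circle_eq_iff L_def)
  moreover have "isCont L (K x)"
    unfolding L_def o_assoc[symmetric]
    by (intro continuous_at_compose cont) (simp_all add: invx pl2_at_filterlim(4)[OF F])
  then have "isCont (\<lambda>t. L t - G t) (K x)"
    using pl2_at_filterlim(4)[OF G(1)] by (intro continuous_intros)
  ultimately have ev: "\<forall>\<^sub>F t in nhds (K x). L t - G t = L (K x) - G (K x)"
    by (rule integer_valued_eventually_const)
  have "L (K x) - G (K x) \<in> \<int>"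
    using eventually_nhds_x_imp_x[OF \<open>\<forall>\<^sub>F t in nhds (K x). L t - G t \<in> \<int>\<close>] .
  then obtain n where n: "L (K x) - G (K x) = of_int n" by (auto elim: Ints_cases)
  have "\<forall>\<^sub>F t in nhds (K x). L t = G t + of_int n"
    using ev unfolding n by eventually_elim simp
  then show ?thesis
    unfolding L_def[symmetric] by (rule pl2_at_cong[OF pl2_at_translate[OF G(1)]])
qed

text \<open>No information on the degree of \<open>h\<close> is needed: \<open>H (x + 1) - H x\<close> is a positive integer, which
  makes \<open>H\<close> surjective.\<close>

lemma circle_normalizer:
  assumes bumps: "{f \<in> T21. \<exists>a b. a < b \<and> (\<forall>p \<in> to_circle ` {a<..<b}. f p = p)} \<subseteq> \<F>"
    and pl: "\<And>f x. f \<in> \<F> \<Longrightarrow> circle_pl2_at f x"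
    and h: "homeo h" "circle_orientation_preserving h"
    and norm: "normalizes h (generated_groupoid ({UNIV} \<times> \<F>))"
  shows "circle_pl2_at h x"
proof -
  obtain H where H: "continuous_on UNIV H" "\<And>t. h (to_circle t) = to_circle (H t)" "strict_mono H"
    using h(2) unfolding circle_orientation_preserving_def circle_lift_def by blast
  have step: "H t + 1 \<le> H (t + 1)" for t
  proof -
    have "to_circle (H (t + 1)) = to_circle (H t)"
      using to_circle_add_of_int[of t 1] by (simp flip: H(2))
    then have "H (t + 1) - H t \<in> \<int>" by (simp add: to_circle_eq_iff)
    then obtain n where n: "H (t + 1) - H t = of_int n" by (auto elim: Ints_cases)
    moreover have "H t < H (t + 1)" using H(3) by (simp add: strict_mono_less)
    ultimately have "0 < n" by simp
    then show ?thesis using n by simp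
  qed
  have up: "H t + of_nat n \<le> H (t + of_nat n)" for t n
  proof (induction n)
    case (Suc n)
    then show ?case using step[of "t + of_nat n"] by (simp add: algebra_simps)
  qed simp
  have "homeo H"
  proof (rule homeo_real[OF H(3)])
    show "isCont H t" for t using H(1) by (simp add: continuous_on_eq_continuous_at)
    show "\<exists>t. H t \<le> y" for y
    proof -
      obtain n :: nat where "H 0 - y \<le> of_nat n" using real_arch_simple by blast
      then have "H (- of_nat n) \<le> y" using up[of "- of_nat n" n] by simp
      then show ?thesis by blast
    qed
    show "\<exists>t. y \<le> H t" for y
    proof -
      obtain n :: nat where "y - H 0 \<le> of_nat n" using real_arch_simple by blast
      then have "y \<le> H (of_nat n)" using up[of 0 n] by simp
      then show ?thesis by blast
    qed
  qed
  have inv_h: "inv h (to_circle t) = to_circle (inv H t)" for t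
    using homeo_inv(5)[OF h(1), of "to_circle (inv H t)"] H(2)[of "inv H t"] homeo_inv(4)[OF \<open>homeo H\<close>] by simp
  interpret pl2_conjugation H "inv H"
  proof
    show "strict_mono H" by (rule H(3))
    show "H (inv H x) = x" "inv H (H x) = x" for x using homeo_inv[OF \<open>homeo H\<close>] by simp_all
    show "isCont H x" for x using H(1) by (simp add: continuous_on_eq_continuous_at)
    fix F x assume F: "pl2_at F x"
    show "pl2_at (H \<circ> F \<circ> inv H) (H x)"
      using norm by (intro circle_conjugation[OF bumps pl _ h(1) H(2) \<open>homeo H\<close> F]) (simp_all add: normalizes_def)
    have "pl2_at (inv H \<circ> F \<circ> inv (inv H)) (inv H x)"
      using norm by (intro circle_conjugation[OF bumps pl _ homeo_inv(6)[OF h(1)] inv_h homeo_inv(6)[OF \<open>homeo H\<close>] F])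
        (simp_all add: normalizes_def)
    then show "pl2_at (inv H \<circ> F \<circ> H) (inv H x)" by (simp add: homeo_inv(3)[OF \<open>homeo H\<close>])
  qed
  have "lifts_near x H h" by (simp add: lifts_near_def H(2))
  then show ?thesis using pl2_at_everywhere unfolding circle_pl2_at_def by blast
qed

lemma circle_normalizer_compatible:
  assumes h: "homeo h" "circle_orientation_preserving h"
    and norm: "normalizes h germs_B21 \<or> normalizes h germs_T21"
  shows "compatible germs_T21 h"
proof -
  have T: "{f \<in> T21. \<exists>a b. a < b \<and> (\<forall>p \<in> to_circle ` {a<..<b}. f p = p)} \<subseteq> T21" by blast
  have BT: "{f \<in> T21. \<exists>a b. a < b \<and> (\<forall>p \<in> to_circle ` {a<..<b}. f p = p)} \<subseteq> BT21"
    unfolding BT21_def by (intro subsetI generated_group.incl)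
  have pl: "circle_pl2_at h x" for x
    using norm
  proof
    assume "normalizes h germs_B21"
    then show ?thesis
      unfolding germs_B21_def by (rule circle_normalizer[OF BT _ h, rotated]) (simp add: circle_pl2_at_BT21)
  next
    assume "normalizes h germs_T21"
    then show ?thesis
      unfolding germs_T21_def by (rule circle_normalizer[OF T _ h, rotated]) (simp add: circle_pl2_at_T21)
  qed
  have "germ p h \<in> generated_groupoid ({UNIV} \<times> T21) p (h p)" for p
  proof -
    obtain x where p: "p = to_circle x" by (rule to_circle_cases)
    show ?thesis
      unfolding p by (rule circle_germ_iff[OF T, THEN iffD2]) (simp_all add: circle_pl2_at_T21 pl)
  qed
  then show ?thesis
    unfolding compatible_def compatible_functions_def germs_T21_def by simp
qed

theorem theorem6p5:
  shows "(\<forall>h :: real \<Rightarrow> real. homeo h \<longrightarrow> strict_mono h \<longrightarrow>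
            normalizes h germs_B2 \<or> normalizes h germs_P2 \<longrightarrow> compatible germs_P2 h) \<and>
         (\<forall>h :: circle \<Rightarrow> circle. homeo h \<longrightarrow> circle_orientation_preserving h \<longrightarrow>
            normalizes h germs_B21 \<or> normalizes h germs_T21 \<longrightarrow> compatible germs_T21 h)"
  using line_normalizer_compatible circle_normalizer_compatible by blast

end
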